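(* Assume objective regularity, i.e. $\nabla f,\nabla g$ are jointly Lipschitz in $(x,y)$ with constants $\ell_{f,1},\ell_{g,1}$; for every $x$, $g(x,\cdot)$ is $\rho_g$-strongly convex for some $\rho_g>0$; $f,g\in C^2$ with $\nabla^2f,\nabla^2g$ jointly Lipschitz in $(x,y)$ with constants $\ell_{f,2},\ell_{g,2}$; and for all $(x,y)$, $\|\nabla_xf(x,y)\|_2\le\ell_{f,0}$, $\|\nabla_yf(x,y)\|_2\le\ell_{f,0}$ and $\|\nabla_xg(x,y)\|_2\le\ell_{g,0}$. Assume also $\inf_{x\in\mathbb R^{d_x}}F_\mu(x)>-\infty$ and the stochastic oracle assumptions stated in the context. Let $T\ge1$ be a fixed integer, let $c_\xi>0$ be a sufficiently small absolute numerical constant, and let the local Dikin constants be fixed as described in the context. Let the iterates be generated by the stochastic barrier-metric first-order algorithm with initial warm starts $z_0\in T_{\eta,\mu}(x_0)$, $y_0\in T^{\lambda_0}_{\eta,\mu}(x_0)$, and with the schedule $$\alpha_k=\frac{\alpha_0}{(k+k_0)^{3/5}},\qquad\gamma_k=\frac{\gamma_0}{(k+k_0)^{2/5}},\qquad\lambda_k=\lambda_0\Bigl(\frac{k+k_0}{k_0}\Bigr)^{1/5},\qquad\delta_k=\lambda_{k+1}-\lambda_k,$$ which is assumed to be barrier-aware (i.e. to satisfy the barrier-aware conditions of the context) and additionally to satisfy the stochastic tube-closure inequalities stated in the context. Then the exact and proxy target neighborhoods remain forward invariant (for every $k$, $z_k^{(t)}\in T_{\eta,\mu}(x_k)$ and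 $y_k^{(t)}\in T^{\lambda_k}_{\eta,\mu}(x_k)$ for $0\le t\le T$, and $z_{k+1}\in T_{\eta,\mu}(x_{k+1})$, $y_{k+1}\in T^{\lambda_{k+1}}_{\eta,\mu}(x_{k+1})$, along the stochastic trajectory), and $$\min_{0\le k\le K-1}\mathbb E\|\nabla F_\mu(x_k)\|_2^2=\widetilde O(K^{-2/5}).$$ Equivalently, the algorithm reaches an $\epsilon$-stationary point of $F_\mu$, in the sense $\min_{0\le k<K}\mathbb E\|\nabla F_\mu(x_k)\|_2^2\le\epsilon$, within $K=\widetilde O(\epsilon^{-5/2})$ outer iterations.
   Context: $\widetilde O$ hides logarithmic factors and constants independent of $K$ (resp. $\epsilon$). Problem. $Y=\{y\in\mathbb R^{d_y}:Ay\le b\}$ is a compact full-dimensional polytope with nonempty interior, $a_i^\top$ ($i=1,\dots,m$) the rows of $A$; $X=\mathbb R^{d_x}$; $f,g:\mathbb R^{d_x}\times\mathbb R^{d_y}\to\mathbb R$. With $y^\star(x)=\arg\min_{y\in Y}g(x,y)$ one assumes $\inf_xf(x,y^\star(x))>-\infty$. Objective regularity: (A1) $\nabla f,\nabla g$ jointly Lipschitz with constants $\ell_{f,1},\ell_{g,1}$; (A2) $g(x,\cdot)$ is $\rho_g$-strongly convex for every $x$, $\rho_g>0$; (A3) $f,g\in C^2$ with $\nabla^2f,\nabla^2g$ jointly Lipschitz with constants $\ell_{f,2},\ell_{g,2}$; (A4) for all $(x,y)$, $\|\nabla_xf\|_2,\|\nabla_yf\|_2\le\ell_{f,0}$ and $\|\nabla_xg\|_2\le\ell_{g,0}$.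 Barrier objects ($\mu>0$ fixed). $\phi(y)=-\sum_i\log(b_i-a_i^\top y)$; $\psi_\mu(x,y)=g(x,y)+\mu\phi(y)$; $y_\mu^\star(x)=\arg\min_{y\in\operatorname{int}(Y)}\psi_\mu(x,y)$; $\psi_\mu^\star(x)=\min_{\operatorname{int}(Y)}\psi_\mu(x,\cdot)$; $F_\mu(x)=f(x,y_\mu^\star(x))$; $L_{\lambda,\mu}(x,y)=f(x,y)+\lambda(\psi_\mu(x,y)-\psi_\mu^\star(x))$; $y^\star_{\lambda,\mu}(x)\in\arg\min_{y\in\operatorname{int}(Y)}L_{\lambda,\mu}(x,y)$. Dikin geometry. For $c\in\operatorname{int}(Y)$: $H_c=\nabla^2\phi(c)$, $\|u\|_c^2=\langle H_cu,u\rangle$, $\|w\|_{c,*}^2=\langle H_c^{-1}w,w\rangle$, $\|M\|_{2\to c,*}=\sup_{\|u\|_2=1}\|Mu\|_{c,*}$, $\|M\|_{c\to c,*}=\sup_{\|u\|_c=1}\|Mu\|_{c,*}$, $\|M\|_{2\to c}=\sup_{\|u\|_2=1}\|Mu\|_c$. For $r>0$: $T_{r,\mu}(x)=\{y\in\operatorname{int}(Y):\|y-y_\mu^\star(x)\|_{y_\mu^\star(x)}\le r\}$ and $T^\lambda_{r,\mu}(x)=\{y\in\operatorname{int}(Y):\|y-y^\star_{\lambda,\mu}(x)\|_{y^\star_{\lambda,\mu}(x)}\le r\}$. A radius $\eta\in(0,1/2)$ is fixed. $\nabla^2_{xy}h\in\mathbb R^{d_y\times d_x}$ is the $x$-derivative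 of $\nabla_yh$. Local Dikin constants. $\rho_\psi^\eta>0$, $\ell_{\psi,1}^\eta,\ell_{\psi,2}^\eta,\ell_{f,0}^\eta,\ell_{f,1}^\eta,\ell_{f,2}^\eta$ and a threshold $\lambda_\eta<\infty$ are finite constants, depending on $\eta,\mu,Y$ and the regularity constants only, such that for all $x$, and for both choices $(c,\mathcal T)=(y_\mu^\star(x),T_{2\eta,\mu}(x))$ and $(c,\mathcal T)=(y^\star_{\lambda,\mu}(x),T^\lambda_{2\eta,\mu}(x))$ with any $\lambda\ge\lambda_\eta$, and all $y,y_1,y_2\in\mathcal T$: $\rho_\psi^\eta H_c\preceq\nabla^2_{yy}\psi_\mu(x,y)\preceq\ell_{\psi,1}^\eta H_c$; $\|\nabla^2_{xy}\psi_\mu(x,y)\|_{2\to c,*}\le\ell_{\psi,1}^\eta$; $\|\nabla^2_{yy}\psi_\mu(x,y_1)-\nabla^2_{yy}\psi_\mu(x,y_2)\|_{c\to c,*}$ and $\|\nabla^2_{xy}\psi_\mu(x,y_1)-\nabla^2_{xy}\psi_\mu(x,y_2)\|_{2\to c,*}$ are $\le\ell_{\psi,2}^\eta\|y_1-y_2\|_c$; $\|\nabla_yf(x,y)\|_{c,*}\le\ell_{f,0}^\eta$; $\|\nabla^2_{xy}f(x,y)\|_{2\to c,*}\le\ell_{f,1}^\eta$; $\|\nabla^2_{yy}f(x,y)\|_{c\to c,*}\le\ell_{f,1}^\eta$; and the differences of $\nabla^2_{xy}f,\nabla^2_{yy}f$ satisfy the analogous Lipschitz bounds with $\ell_{f,2}^\eta$.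 Further $\ell_{*,0}^\eta\ge1$, $\ell_{\lambda,0}^\eta$, $L_F^\eta$, $\ell_{\lambda,1}^\eta$, $\ell_{*,1}^\eta\ge\max\{1,\ell_{\lambda,1}^\eta\}$ are finite constants such that for all $x_1,x_2$ and $\lambda,\lambda_1,\lambda_2\ge\lambda_0$: $\|y_\mu^\star(x_2)-y_\mu^\star(x_1)\|_{y_\mu^\star(x_1)}\le\ell_{*,0}^\eta\|x_2-x_1\|_2$; $\|y^\star_{\lambda_2,\mu}(x_2)-y^\star_{\lambda_1,\mu}(x_1)\|_{y^\star_{\lambda_1,\mu}(x_1)}\le\frac{2\ell_{f,0}^\eta}{\rho_\psi^\eta}|\frac1{\lambda_2}-\frac1{\lambda_1}|+\ell_{\lambda,0}^\eta\|x_2-x_1\|_2$; $\|\nabla F_\mu(x_2)-\nabla F_\mu(x_1)\|_2\le L_F^\eta\|x_2-x_1\|_2$; and the Jacobians satisfy $\|\nabla y_\mu^\star(x_2)-\nabla y_\mu^\star(x_1)\|_{2\to y_\mu^\star(x_1)}\le\ell_{*,1}^\eta\|x_2-x_1\|_2$ and $\|\nabla y^\star_{\lambda,\mu}(x_2)-\nabla y^\star_{\lambda,\mu}(x_1)\|_{2\to y^\star_{\lambda,\mu}(x_1)}\le\ell_{\lambda,1}^\eta\|x_2-x_1\|_2$. Conventions on $\eta$ and constants. With $\theta_\eta=(1-\eta)^{-2}-1$, $\eta$ is small enough that $\theta_\eta L\le m/4$ for the curvature pairs $(m,L)=(\rho_\psi^\eta,\ell_{\psi,1}^\eta)$ and $(m,L)=(\lambda\rho_\psi^\eta/2,\lambda\ell_{\psi,1}^\eta+\ell_{f,1}^\eta)$,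 $\lambda\ge\lambda_0$. The local Dikin constants are understood after absorbing fixed $\eta$-dependent factors coming from comparing the frozen metrics $\nabla^2\phi(z_k),\nabla^2\phi(y_k)$ with the center metrics ($\rho_\psi^\eta$ decreased, the other constants increased). The initial multiplier satisfies $\lambda_0\ge\lambda_\eta$. Stochastic oracles. Only $f$-gradients are stochastic; $g,\phi,\psi_\mu$ are deterministic. With $\mathcal F$ the sigma-field of the algorithmic history before a query, for every $\mathcal F$-measurable $(x,y)$ the oracles satisfy $\mathbb E[\widehat\nabla_yf(x,y;\zeta)\mid\mathcal F]=\nabla_yf(x,y)$, $\mathbb E[\widehat\nabla_xf(x,y;\zeta)\mid\mathcal F]=\nabla_xf(x,y)$, $\mathbb E[\|\widehat\nabla_yf-\nabla_yf\|_2^2\mid\mathcal F]\le\sigma_{f,y}^2$, $\mathbb E[\|\widehat\nabla_xf-\nabla_xf\|_2^2\mid\mathcal F]\le\sigma_{f,x}^2$. Local almost-sure bounds: there are finite $\bar\ell_{f,x,0}^\eta,\bar\ell_{f,y,0}^\eta$ such that, on the event that the trackers are in the neighborhoods, for every visited $x$ and $\lambda$ and every $y\in T_{2\eta,\mu}(x)\cup T^\lambda_{2\eta,\mu}(x)$, almost surely $\|\widehat\nabla_xf(x,y;\zeta)\|_2\le\bar\ell_{f,x,0}^\eta$ and $\|\widehat\nabla_yf(x,y;\zeta)\|_*\le\bar\ell_{f,y,0}^\eta$, where $\|\cdot\|_*$ is the dual norm $\|\cdot\|_{c,*}$ at the relevant exact or proxy center $c$. Stochastic algorithm (inner length $T$,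 ratio $\xi>0$). For $k=0,1,\dots$: $z_k^{(0)}=z_k$, $y_k^{(0)}=y_k$; for $t=0,\dots,T-1$, $z_k^{(t+1)}=z_k^{(t)}-\gamma_k\nabla^2\phi(z_k)^{-1}\nabla_y\psi_\mu(x_k,z_k^{(t)})$ and $y_k^{(t+1)}=y_k^{(t)}-\alpha_k\nabla^2\phi(y_k)^{-1}\bigl(\widehat\nabla_yf(x_k,y_k^{(t)};\zeta^y_{k,t})+\lambda_k\nabla_y\psi_\mu(x_k,y_k^{(t)})\bigr)$; $z_{k+1}=z_k^{(T)}$, $y_{k+1}=y_k^{(T)}$; $\widehat q_k^x=\widehat\nabla_xf(x_k,y_{k+1};\zeta_k^x)+\lambda_k(\nabla_xg(x_k,y_{k+1})-\nabla_xg(x_k,z_{k+1}))$; $x_{k+1}=x_k-\xi\alpha_k\widehat q_k^x$; $\lambda_{k+1}=\lambda_k+\delta_k$. Barrier-aware conditions. With $\beta_k=\alpha_k\lambda_k$, for all $k$: (S1) $\lambda_0\ge\max\{2\ell_{f,1}^\eta/\rho_\psi^\eta,\ 8\ell_{f,0}^\eta/(\eta\rho_\psi^\eta)\}$, $\beta_k\le\gamma_k\le\min\{1/(4\ell_{\psi,1}^\eta),\ 1/(4T\rho_\psi^\eta)\}$, $\alpha_k\le1/(2\xi L_F^\eta)$; (S2) $\delta_k/\lambda_k\le T\rho_\psi^\eta\beta_k/16$, $\delta_k=\lambda_{k+1}-\lambda_k\ge0$; (S3) with $D=\ell_{f,0}/\lambda_0+2\ell_{g,0}$, $$\frac\xi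 T\le\min\Bigl\{\frac{\eta\rho_\psi^\eta}{16\ell_{*,0}^\eta D},\ \frac{\eta\rho_\psi^\eta}{64\ell_{\lambda,0}^\eta D},\ \frac{c_\xi\rho_\psi^\eta}{\max\{\ell_{\psi,1}^\eta(\ell_{*,0}^\eta)^2,\ \ell_{*,1}^\eta\sqrt{\max(\ell_{g,0}^2,\ell_{f,0}^2)}\}}\Bigr\}.$$ Stochastic tube-closure inequalities. With $\Gamma_{\psi,k}=1-(1-\rho_\psi^\eta\gamma_k)^T$, $\Gamma_{L,k}=1-(1-\tfrac78\rho_\psi^\eta\beta_k)^T$, $\bar\sigma_y^\eta=\ell_{f,0}^\eta+\bar\ell_{f,y,0}^\eta$, for every $k$: $T\alpha_k\bar\sigma_y^\eta\le\frac\eta8\Gamma_{L,k}$; $\ell_{*,0}^\eta\xi\beta_k\bigl(\bar\ell_{f,x,0}^\eta/\lambda_0+2\ell_{g,0}\bigr)\le\frac\eta8\Gamma_{\psi,k}$; $\Bigl(\frac{T\ell_{f,0}^\eta}{8\lambda_0}+\xi\ell_{\lambda,0}^\eta\bigl(\bar\ell_{f,x,0}^\eta/\lambda_0+2\ell_{g,0}\bigr)\Bigr)\beta_k\le\frac\eta8\Gamma_{L,k}$. *)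

theory Defs
  imports "HOL-Probability.Probability" "HOL-Library.Landau_Symbols"
begin

section \<open>Calculus\<close>

definition grad :: "('a::real_inner \<Rightarrow> real) \<Rightarrow> 'a \<Rightarrow> 'a" where
  "grad h x = (THE D. GDERIV h x :> D)"

definition hess :: "('a::real_inner \<Rightarrow> real) \<Rightarrow> 'a \<Rightarrow> 'a \<Rightarrow> 'a" where
  "hess h x = frechet_derivative (grad h) (at x)"

definition C2 :: "('a::real_inner \<Rightarrow> real) \<Rightarrow> bool" where
  "C2 h \<longleftrightarrow> (\<forall>x. h differentiable (at x)) \<and> (\<forall>x. grad h differentiable (at x)) \<and>
     (\<forall>u. continuous_on UNIV (\<lambda>x. hess h x u))"

definition strongly_convex :: "real \<Rightarrow> ('a::real_inner \<Rightarrow> real) \<Rightarrow> bool" where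
  "strongly_convex \<rho> h \<longleftrightarrow> (\<forall>u v t. 0 \<le> t \<longrightarrow> t \<le> 1 \<longrightarrow>
     h ((1 - t) *\<^sub>R u + t *\<^sub>R v) \<le> (1 - t) * h u + t * h v - \<rho> / 2 * t * (1 - t) * (norm (u - v))\<^sup>2)"

definition grad_x :: "((real^'n) \<times> (real^'d) \<Rightarrow> real) \<Rightarrow> real^'n \<Rightarrow> real^'d \<Rightarrow> real^'n" where
  "grad_x h x y = grad (\<lambda>x'. h (x', y)) x"

definition grad_y :: "((real^'n) \<times> (real^'d) \<Rightarrow> real) \<Rightarrow> real^'n \<Rightarrow> real^'d \<Rightarrow> real^'d" where
  "grad_y h x y = grad (\<lambda>y'. h (x, y')) y"

definition hess_yy :: "((real^'n) \<times> (real^'d) \<Rightarrow> real) \<Rightarrow> real^'n \<Rightarrow> real^'d \<Rightarrow> real^'d \<Rightarrow> real^'d" where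
  "hess_yy h x y = frechet_derivative (\<lambda>y'. grad_y h x y') (at y)"

definition hess_xy :: "((real^'n) \<times> (real^'d) \<Rightarrow> real) \<Rightarrow> real^'n \<Rightarrow> real^'d \<Rightarrow> real^'n \<Rightarrow> real^'d" where
  "hess_xy h x y = frechet_derivative (\<lambda>x'. grad_y h x' y) (at x)"

definition op_norm :: "('a \<Rightarrow> real) \<Rightarrow> ('b \<Rightarrow> real) \<Rightarrow> ('a \<Rightarrow> 'b) \<Rightarrow> real" where
  "op_norm N\<^sub>1 N\<^sub>2 M = (SUP u\<in>{u. N\<^sub>1 u = 1}. N\<^sub>2 (M u))"

definition loewner_le :: "('a::real_inner \<Rightarrow> 'a) \<Rightarrow> ('a \<Rightarrow> 'a) \<Rightarrow> bool" where
  "loewner_le P Q \<longleftrightarrow> (\<forall>u. P u \<bullet> u \<le> Q u \<bullet> u)"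

text \<open>\<open>h = O(g * polylog(g))\<close> along the filter \<open>F\<close>; the implied constant may depend on everything
  except the variable of the filter.\<close>

definition soft_O :: "'a filter \<Rightarrow> ('a \<Rightarrow> real) \<Rightarrow> ('a \<Rightarrow> real) \<Rightarrow> bool" where
  "soft_O F h g \<longleftrightarrow> (\<exists>p::nat. h \<in> O[F](\<lambda>s. g s * \<bar>ln \<bar>g s\<bar>\<bar> ^ p))"

section \<open>The bilevel problem and its barrier reformulation\<close>

record ('n, 'd, 'm) bilevel =
  Amat :: "real^'d^'m"
  bvec :: "real^'m"
  upper :: "(real^'n) \<times> (real^'d) \<Rightarrow> real"
  lower :: "(real^'n) \<times> (real^'d) \<Rightarrow> real"
  mu :: real

definition feas :: "('n::finite, 'd::finite, 'm::finite) bilevel \<Rightarrow> (real^'d) set" where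
  "feas P = {y. \<forall>i. (Amat P *v y) $ i \<le> bvec P $ i}"

definition phi :: "('n::finite, 'd::finite, 'm::finite) bilevel \<Rightarrow> real^'d \<Rightarrow> real" where
  "phi P y = - (\<Sum>i\<in>UNIV. ln (bvec P $ i - (Amat P *v y) $ i))"

definition psi :: "('n::finite, 'd::finite, 'm::finite) bilevel \<Rightarrow> (real^'n) \<times> (real^'d) \<Rightarrow> real" where
  "psi P = (\<lambda>(x, y). lower P (x, y) + mu P * phi P y)"

definition lower_sol :: "('n::finite, 'd::finite, 'm::finite) bilevel \<Rightarrow> real^'n \<Rightarrow> real^'d" where
  "lower_sol P x = arg_min_on (\<lambda>y. lower P (x, y)) (feas P)"

definition ystar :: "('n::finite, 'd::finite, 'm::finite) bilevel \<Rightarrow> real^'n \<Rightarrow> real^'d" where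
  "ystar P x = arg_min_on (\<lambda>y. psi P (x, y)) (interior (feas P))"

definition psi_min :: "('n::finite, 'd::finite, 'm::finite) bilevel \<Rightarrow> real^'n \<Rightarrow> real" where
  "psi_min P x = (INF y\<in>interior (feas P). psi P (x, y))"

definition Fmu :: "('n::finite, 'd::finite, 'm::finite) bilevel \<Rightarrow> real^'n \<Rightarrow> real" where
  "Fmu P x = upper P (x, ystar P x)"

definition Lag :: "('n::finite, 'd::finite, 'm::finite) bilevel \<Rightarrow> real \<Rightarrow> real^'n \<Rightarrow> real^'d \<Rightarrow> real" where
  "Lag P lam x y = upper P (x, y) + lam * (psi P (x, y) - psi_min P x)"

text \<open>The upper objective need not be convex in \<open>y\<close>, so minimisers of the penalised objective need
  not be unique: \<open>yl lam x\<close> is an arbitrary fixed selection.\<close>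

definition proxy_selection ::
  "('n::finite, 'd::finite, 'm::finite) bilevel \<Rightarrow> (real \<Rightarrow> real^'n \<Rightarrow> real^'d) \<Rightarrow> bool" where
  "proxy_selection P yl \<longleftrightarrow>
     (\<forall>lam>0. \<forall>x. is_arg_min (Lag P lam x) (\<lambda>y. y \<in> interior (feas P)) (yl lam x))"

record reg_consts =
  l_f0 :: real
  l_f1 :: real
  l_f2 :: real
  l_g0 :: real
  l_g1 :: real
  l_g2 :: real
  rho_g :: real

definition standing_problem :: "('n::finite, 'd::finite, 'm::finite) bilevel \<Rightarrow> bool" where
  "standing_problem P \<longleftrightarrow> compact (feas P) \<and> interior (feas P) \<noteq> {} \<and> mu P > 0 \<and>
     bdd_below (range (\<lambda>x. upper P (x, lower_sol P x)))"

definition objective_regularity ::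
  "('n::finite, 'd::finite, 'm::finite) bilevel \<Rightarrow> reg_consts \<Rightarrow> bool" where
  "objective_regularity P R \<longleftrightarrow>
     (l_f1 R)-lipschitz_on UNIV (grad (upper P)) \<and>
     (l_g1 R)-lipschitz_on UNIV (grad (lower P)) \<and>
     rho_g R > 0 \<and> (\<forall>x. strongly_convex (rho_g R) (\<lambda>y. lower P (x, y))) \<and>
     C2 (upper P) \<and> C2 (lower P) \<and>
     (\<forall>v w. onorm (\<lambda>u. hess (upper P) v u - hess (upper P) w u) \<le> l_f2 R * norm (v - w)) \<and>
     (\<forall>v w. onorm (\<lambda>u. hess (lower P) v u - hess (lower P) w u) \<le> l_g2 R * norm (v - w)) \<and>
     (\<forall>x y. norm (grad_x (upper P) x y) \<le> l_f0 R \<and> norm (grad_y (upper P) x y) \<le> l_f0 R \<and>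
            norm (grad_x (lower P) x y) \<le> l_g0 R)"

section \<open>Dikin geometry\<close>

definition dnorm :: "('n::finite, 'd::finite, 'm::finite) bilevel \<Rightarrow> real^'d \<Rightarrow> real^'d \<Rightarrow> real" where
  "dnorm P c u = sqrt (hess (phi P) c u \<bullet> u)"

definition dual_norm :: "('n::finite, 'd::finite, 'm::finite) bilevel \<Rightarrow> real^'d \<Rightarrow> real^'d \<Rightarrow> real" where
  "dual_norm P c w = sqrt (inv (hess (phi P) c) w \<bullet> w)"

definition dikin_tube :: "('n::finite, 'd::finite, 'm::finite) bilevel \<Rightarrow> real \<Rightarrow> real^'d \<Rightarrow> (real^'d) set" where
  "dikin_tube P r c = {y \<in> interior (feas P). dnorm P c (y - c) \<le> r}"

abbreviation tube :: "('n::finite, 'd::finite, 'm::finite) bilevel \<Rightarrow> real \<Rightarrow> real^'n \<Rightarrow> (real^'d) set" where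
  "tube P r x \<equiv> dikin_tube P r (ystar P x)"

text \<open>\<open>d_f0, d_f1, d_f2\<close> are the Dikin counterparts of the Euclidean \<open>l_f0, l_f1, l_f2\<close>; \<open>l_star\<close> and \<open>l_lam\<close>
  belong to the exact and the proxy solution map, and \<open>lam_eta\<close> is the multiplier threshold.\<close>

record dikin_consts =
  rho_psi :: real
  l_psi1 :: real
  l_psi2 :: real
  d_f0 :: real
  d_f1 :: real
  d_f2 :: real
  lam_eta :: real
  l_star0 :: real
  l_star1 :: real
  l_lam0 :: real
  l_lam1 :: real
  L_F :: real

definition local_bounds ::
  "('n::finite, 'd::finite, 'm::finite) bilevel \<Rightarrow> dikin_consts \<Rightarrow> real^'n \<Rightarrow> real^'d \<Rightarrow> (real^'d) set \<Rightarrow> bool" where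
  "local_bounds P C x c S \<longleftrightarrow>
     (\<forall>y\<in>S.
        loewner_le (\<lambda>u. rho_psi C *\<^sub>R hess (phi P) c u) (hess_yy (psi P) x y) \<and>
        loewner_le (hess_yy (psi P) x y) (\<lambda>u. l_psi1 C *\<^sub>R hess (phi P) c u) \<and>
        op_norm norm (dual_norm P c) (hess_xy (psi P) x y) \<le> l_psi1 C \<and>
        dual_norm P c (grad_y (upper P) x y) \<le> d_f0 C \<and>
        op_norm norm (dual_norm P c) (hess_xy (upper P) x y) \<le> d_f1 C \<and>
        op_norm (dnorm P c) (dual_norm P c) (hess_yy (upper P) x y) \<le> d_f1 C) \<and>
     (\<forall>y\<^sub>1\<in>S. \<forall>y\<^sub>2\<in>S.
        op_norm (dnorm P c) (dual_norm P c) (\<lambda>u. hess_yy (psi P) x y\<^sub>1 u - hess_yy (psi P) x y\<^sub>2 u)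
          \<le> l_psi2 C * dnorm P c (y\<^sub>1 - y\<^sub>2) \<and>
        op_norm norm (dual_norm P c) (\<lambda>u. hess_xy (psi P) x y\<^sub>1 u - hess_xy (psi P) x y\<^sub>2 u)
          \<le> l_psi2 C * dnorm P c (y\<^sub>1 - y\<^sub>2) \<and>
        op_norm (dnorm P c) (dual_norm P c) (\<lambda>u. hess_yy (upper P) x y\<^sub>1 u - hess_yy (upper P) x y\<^sub>2 u)
          \<le> d_f2 C * dnorm P c (y\<^sub>1 - y\<^sub>2) \<and>
        op_norm norm (dual_norm P c) (\<lambda>u. hess_xy (upper P) x y\<^sub>1 u - hess_xy (upper P) x y\<^sub>2 u)
          \<le> d_f2 C * dnorm P c (y\<^sub>1 - y\<^sub>2))"

text \<open>All bounds refer to the metrics at the exact and proxy centres. They are preserved when \<open>rho_psi\<close>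
  is decreased and the other constants are increased, so constants into which factors from a comparison
  with the frozen metrics have been absorbed are a special case. The
  bounds on Jacobians include that the Jacobians exist.\<close>

definition local_dikin_constants ::
  "('n::finite, 'd::finite, 'm::finite) bilevel \<Rightarrow> (real \<Rightarrow> real^'n \<Rightarrow> real^'d) \<Rightarrow> dikin_consts \<Rightarrow>
   real \<Rightarrow> real \<Rightarrow> bool" where
  "local_dikin_constants P yl C \<eta> lam\<^sub>0 \<longleftrightarrow>
     rho_psi C > 0 \<and> lam_eta C > 0 \<and>
     (\<forall>x. local_bounds P C x (ystar P x) (tube P (2 * \<eta>) x)) \<and>
     (\<forall>x. \<forall>lam\<ge>lam_eta C. local_bounds P C x (yl lam x) (dikin_tube P (2 * \<eta>) (yl lam x))) \<and>
     l_star0 C \<ge> 1 \<and> l_star1 C \<ge> max 1 (l_lam1 C) \<and>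
     (\<forall>x\<^sub>1 x\<^sub>2. dnorm P (ystar P x\<^sub>1) (ystar P x\<^sub>2 - ystar P x\<^sub>1) \<le> l_star0 C * norm (x\<^sub>2 - x\<^sub>1)) \<and>
     (\<forall>x\<^sub>1 x\<^sub>2. \<forall>lam\<^sub>1\<ge>lam\<^sub>0. \<forall>lam\<^sub>2\<ge>lam\<^sub>0.
        dnorm P (yl lam\<^sub>1 x\<^sub>1) (yl lam\<^sub>2 x\<^sub>2 - yl lam\<^sub>1 x\<^sub>1)
          \<le> 2 * d_f0 C / rho_psi C * \<bar>1 / lam\<^sub>2 - 1 / lam\<^sub>1\<bar> + l_lam0 C * norm (x\<^sub>2 - x\<^sub>1)) \<and>
     (\<forall>x\<^sub>1 x\<^sub>2. norm (grad (Fmu P) x\<^sub>2 - grad (Fmu P) x\<^sub>1) \<le> L_F C * norm (x\<^sub>2 - x\<^sub>1)) \<and>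
     (\<forall>x. ystar P differentiable (at x)) \<and>
     (\<forall>x\<^sub>1 x\<^sub>2. op_norm norm (dnorm P (ystar P x\<^sub>1))
          (\<lambda>u. frechet_derivative (ystar P) (at x\<^sub>2) u - frechet_derivative (ystar P) (at x\<^sub>1) u)
          \<le> l_star1 C * norm (x\<^sub>2 - x\<^sub>1)) \<and>
     (\<forall>x. \<forall>lam\<ge>lam\<^sub>0. yl lam differentiable (at x)) \<and>
     (\<forall>x\<^sub>1 x\<^sub>2. \<forall>lam\<ge>lam\<^sub>0. op_norm norm (dnorm P (yl lam x\<^sub>1))
          (\<lambda>u. frechet_derivative (yl lam) (at x\<^sub>2) u - frechet_derivative (yl lam) (at x\<^sub>1) u)
          \<le> l_lam1 C * norm (x\<^sub>2 - x\<^sub>1))"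

definition radius_condition :: "dikin_consts \<Rightarrow> real \<Rightarrow> real \<Rightarrow> bool" where
  "radius_condition C \<eta> lam\<^sub>0 \<longleftrightarrow> 0 < \<eta> \<and> \<eta> < 1/2 \<and>
     (let \<theta> = 1 / (1 - \<eta>)\<^sup>2 - 1 in
        \<theta> * l_psi1 C \<le> rho_psi C / 4 \<and>
        (\<forall>lam\<ge>lam\<^sub>0. \<theta> * (lam * l_psi1 C + d_f1 C) \<le> (lam * rho_psi C / 2) / 4))"

section \<open>The stochastic algorithm\<close>

text \<open>\<open>z k t\<close> and \<open>y k t\<close> are the inner iterates \<open>t = 0, \<dots>, T\<close> of outer iteration \<open>k\<close>, so that \<open>z k 0\<close>
  is the tracker at the start of iteration \<open>k\<close>. \<open>Gx\<close>, \<open>Gy\<close> are the oracles, \<open>\<zeta>x\<close>, \<open>\<zeta>y\<close> their samples.\<close>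

definition barrier_run ::
  "('n::finite, 'd::finite, 'm::finite) bilevel \<Rightarrow> nat \<Rightarrow> real \<Rightarrow>
   (nat \<Rightarrow> real) \<Rightarrow> (nat \<Rightarrow> real) \<Rightarrow> (nat \<Rightarrow> real) \<Rightarrow>
   ((real^'n) \<times> (real^'d) \<Rightarrow> 's \<Rightarrow> real^'n) \<Rightarrow> ((real^'n) \<times> (real^'d) \<Rightarrow> 's \<Rightarrow> real^'d) \<Rightarrow>
   (nat \<Rightarrow> 's) \<Rightarrow> (nat \<Rightarrow> nat \<Rightarrow> 's) \<Rightarrow>
   (nat \<Rightarrow> real^'n) \<Rightarrow> (nat \<Rightarrow> nat \<Rightarrow> real^'d) \<Rightarrow> (nat \<Rightarrow> nat \<Rightarrow> real^'d) \<Rightarrow> bool" where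
  "barrier_run P T \<xi> \<alpha> \<gamma> lam Gx Gy \<zeta>x \<zeta>y x y z \<longleftrightarrow>
     (\<forall>k. \<forall>t<T. z k (Suc t) = z k t -
          \<gamma> k *\<^sub>R inv (hess (phi P) (z k 0)) (grad_y (psi P) (x k) (z k t))) \<and>
     (\<forall>k. \<forall>t<T. y k (Suc t) = y k t -
          \<alpha> k *\<^sub>R inv (hess (phi P) (y k 0))
            (Gy (x k, y k t) (\<zeta>y k t) + lam k *\<^sub>R grad_y (psi P) (x k) (y k t))) \<and>
     (\<forall>k. z (Suc k) 0 = z k T) \<and>
     (\<forall>k. y (Suc k) 0 = y k T) \<and>
     (\<forall>k. x (Suc k) = x k - (\<xi> * \<alpha> k) *\<^sub>R
          (Gx (x k, y (Suc k) 0) (\<zeta>x k) +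
           lam k *\<^sub>R (grad_x (lower P) (x k) (y (Suc k) 0) - grad_x (lower P) (x k) (z (Suc k) 0))))"

text \<open>\<open>Hy k t\<close> is the history before the \<open>y\<close>-query at inner step \<open>t\<close> of iteration \<open>k\<close>, and \<open>Hx k\<close> the
  history before the \<open>x\<close>-query of iteration \<open>k\<close>: any filtration, ordered by query time, to which the
  iterates are adapted.\<close>

definition history ::
  "'w measure \<Rightarrow> nat \<Rightarrow> (nat \<Rightarrow> 'w measure) \<Rightarrow> (nat \<Rightarrow> nat \<Rightarrow> 'w measure) \<Rightarrow>
   (nat \<Rightarrow> 'w \<Rightarrow> real^'n) \<Rightarrow> (nat \<Rightarrow> nat \<Rightarrow> 'w \<Rightarrow> real^'d) \<Rightarrow> (nat \<Rightarrow> nat \<Rightarrow> 'w \<Rightarrow> real^'d) \<Rightarrow> bool" where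
  "history M T Hx Hy x y z \<longleftrightarrow>
     (\<forall>k. subalgebra M (Hx k)) \<and> (\<forall>k. \<forall>t<T. subalgebra M (Hy k t)) \<and>
     (\<forall>k t. Suc t < T \<longrightarrow> subalgebra (Hy k (Suc t)) (Hy k t)) \<and>
     (\<forall>k. \<forall>t<T. subalgebra (Hx k) (Hy k t)) \<and>
     (\<forall>k. subalgebra (Hy (Suc k) 0) (Hx k)) \<and>
     (\<forall>k. \<forall>t<T. x k \<in> borel_measurable (Hy k t) \<and>
         y k t \<in> borel_measurable (Hy k t) \<and> z k t \<in> borel_measurable (Hy k t)) \<and>
     (\<forall>k. x k \<in> borel_measurable (Hx k) \<and>
         y k T \<in> borel_measurable (Hx k) \<and> z k T \<in> borel_measurable (Hx k))"

definition vec_cond_exp :: "'w measure \<Rightarrow> 'w measure \<Rightarrow> ('w \<Rightarrow> real^'d) \<Rightarrow> 'w \<Rightarrow> real^'d" where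
  "vec_cond_exp M F V w = (\<chi> i. real_cond_exp M F (\<lambda>w'. V w' $ i) w)"

definition oracle_at ::
  "'w measure \<Rightarrow> 'w measure \<Rightarrow> ('w \<Rightarrow> 's) \<Rightarrow> ((real^'n) \<times> (real^'d) \<Rightarrow> 's \<Rightarrow> real^'e) \<Rightarrow>
   ((real^'n) \<times> (real^'d) \<Rightarrow> real^'e) \<Rightarrow> real \<Rightarrow> bool" where
  "oracle_at M F \<zeta> G G0 \<sigma> \<longleftrightarrow>
     (\<forall>X \<in> borel_measurable F.
        (AE w in M. vec_cond_exp M F (\<lambda>w. G (X w) (\<zeta> w)) w = G0 (X w)) \<and>
        (AE w in M. nn_cond_exp M F (\<lambda>w. ennreal ((norm (G (X w) (\<zeta> w) - G0 (X w)))\<^sup>2)) w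
           \<le> ennreal (\<sigma>\<^sup>2)))"

definition stochastic_oracles ::
  "('n::finite, 'd::finite, 'm::finite) bilevel \<Rightarrow> 'w measure \<Rightarrow> 's measure \<Rightarrow> nat \<Rightarrow>
   (nat \<Rightarrow> 'w measure) \<Rightarrow> (nat \<Rightarrow> nat \<Rightarrow> 'w measure) \<Rightarrow>
   ((real^'n) \<times> (real^'d) \<Rightarrow> 's \<Rightarrow> real^'n) \<Rightarrow> ((real^'n) \<times> (real^'d) \<Rightarrow> 's \<Rightarrow> real^'d) \<Rightarrow>
   (nat \<Rightarrow> 'w \<Rightarrow> 's) \<Rightarrow> (nat \<Rightarrow> nat \<Rightarrow> 'w \<Rightarrow> 's) \<Rightarrow> real \<Rightarrow> real \<Rightarrow> bool" where
  "stochastic_oracles P M S T Hx Hy Gx Gy \<zeta>x \<zeta>y \<sigma>x \<sigma>y \<longleftrightarrow>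
     (\<lambda>(v, s). Gx v s) \<in> borel_measurable (borel \<Otimes>\<^sub>M S) \<and>
     (\<lambda>(v, s). Gy v s) \<in> borel_measurable (borel \<Otimes>\<^sub>M S) \<and>
     (\<forall>k. \<zeta>x k \<in> measurable M S) \<and> (\<forall>k. \<forall>t<T. \<zeta>y k t \<in> measurable M S) \<and>
     (\<forall>k. \<forall>t<T. oracle_at M (Hy k t) (\<zeta>y k t) Gy (\<lambda>(x, y). grad_y (upper P) x y) \<sigma>y) \<and>
     (\<forall>k. oracle_at M (Hx k) (\<zeta>x k) Gx (\<lambda>(x, y). grad_x (upper P) x y) \<sigma>x)"

text \<open>The bounds hold only on the event that the current trackers lie in their neighbourhoods. The
  points are history-measurable maps rather than constants, because the algorithm queries the oracles at
  random points.\<close>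

definition oracle_local_bounds ::
  "('n::finite, 'd::finite, 'm::finite) bilevel \<Rightarrow> (real \<Rightarrow> real^'n \<Rightarrow> real^'d) \<Rightarrow> real \<Rightarrow> 'w measure \<Rightarrow> nat \<Rightarrow>
   (nat \<Rightarrow> real) \<Rightarrow> (nat \<Rightarrow> 'w measure) \<Rightarrow> (nat \<Rightarrow> nat \<Rightarrow> 'w measure) \<Rightarrow>
   ((real^'n) \<times> (real^'d) \<Rightarrow> 's \<Rightarrow> real^'n) \<Rightarrow> ((real^'n) \<times> (real^'d) \<Rightarrow> 's \<Rightarrow> real^'d) \<Rightarrow>
   (nat \<Rightarrow> 'w \<Rightarrow> 's) \<Rightarrow> (nat \<Rightarrow> nat \<Rightarrow> 'w \<Rightarrow> 's) \<Rightarrow>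
   (nat \<Rightarrow> 'w \<Rightarrow> real^'n) \<Rightarrow> (nat \<Rightarrow> nat \<Rightarrow> 'w \<Rightarrow> real^'d) \<Rightarrow> (nat \<Rightarrow> nat \<Rightarrow> 'w \<Rightarrow> real^'d) \<Rightarrow>
   real \<Rightarrow> real \<Rightarrow> bool" where
  "oracle_local_bounds P yl \<eta> M T lam Hx Hy Gx Gy \<zeta>x \<zeta>y x y z bfx bfy \<longleftrightarrow>
     (\<forall>k. \<forall>t<T. \<forall>Y \<in> borel_measurable (Hy k t). AE w in M.
        z k t w \<in> tube P \<eta> (x k w) \<and> y k t w \<in> dikin_tube P \<eta> (yl (lam k) (x k w)) \<longrightarrow>
          (Y w \<in> tube P (2 * \<eta>) (x k w) \<longrightarrow>
             dual_norm P (ystar P (x k w)) (Gy (x k w, Y w) (\<zeta>y k t w)) \<le> bfy) \<and>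
          (Y w \<in> dikin_tube P (2 * \<eta>) (yl (lam k) (x k w)) \<longrightarrow>
             dual_norm P (yl (lam k) (x k w)) (Gy (x k w, Y w) (\<zeta>y k t w)) \<le> bfy)) \<and>
     (\<forall>k. \<forall>Y \<in> borel_measurable (Hx k). AE w in M.
        z k T w \<in> tube P \<eta> (x k w) \<and> y k T w \<in> dikin_tube P \<eta> (yl (lam k) (x k w)) \<and>
        Y w \<in> tube P (2 * \<eta>) (x k w) \<union> dikin_tube P (2 * \<eta>) (yl (lam k) (x k w)) \<longrightarrow>
          norm (Gx (x k w, Y w) (\<zeta>x k w)) \<le> bfx)"

definition best_grad ::
  "('n::finite, 'd::finite, 'm::finite) bilevel \<Rightarrow> 'w measure \<Rightarrow> (nat \<Rightarrow> 'w \<Rightarrow> real^'n) \<Rightarrow> nat \<Rightarrow> real" where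
  "best_grad P M x K = Min ((\<lambda>k. LINT w|M. (norm (grad (Fmu P) (x k w)))\<^sup>2) ` {0..<K})"

section \<open>Step-size conditions\<close>

text \<open>Bounds whose denominator may vanish are multiplied out, since division by zero yields zero.\<close>

definition barrier_aware ::
  "reg_consts \<Rightarrow> dikin_consts \<Rightarrow> real \<Rightarrow> nat \<Rightarrow> real \<Rightarrow> real \<Rightarrow>
   (nat \<Rightarrow> real) \<Rightarrow> (nat \<Rightarrow> real) \<Rightarrow> (nat \<Rightarrow> real) \<Rightarrow> bool" where
  "barrier_aware R C \<eta> T \<xi> c\<^sub>\<xi> \<alpha> \<gamma> lam \<longleftrightarrow>
     lam 0 \<ge> max (2 * d_f1 C / rho_psi C) (8 * d_f0 C / (\<eta> * rho_psi C)) \<and>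
     (\<forall>k. \<alpha> k * lam k \<le> \<gamma> k \<and>
          \<gamma> k \<le> min (1 / (4 * l_psi1 C)) (1 / (4 * real T * rho_psi C)) \<and>
          \<alpha> k * (2 * \<xi> * L_F C) \<le> 1) \<and>
     (\<forall>k. (lam (Suc k) - lam k) / lam k \<le> real T * rho_psi C * (\<alpha> k * lam k) / 16 \<and>
          lam (Suc k) - lam k \<ge> 0) \<and>
     (let D = l_f0 R / lam 0 + 2 * l_g0 R in
        \<xi> / real T * (16 * l_star0 C * D) \<le> \<eta> * rho_psi C \<and>
        \<xi> / real T * (64 * l_lam0 C * D) \<le> \<eta> * rho_psi C \<and>
        \<xi> / real T \<le> c\<^sub>\<xi> * rho_psi C /
          max (l_psi1 C * (l_star0 C)\<^sup>2) (l_star1 C * sqrt (max ((l_g0 R)\<^sup>2) ((l_f0 R)\<^sup>2))))"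

definition tube_closure ::
  "reg_consts \<Rightarrow> dikin_consts \<Rightarrow> real \<Rightarrow> nat \<Rightarrow> real \<Rightarrow> real \<Rightarrow> real \<Rightarrow>
   (nat \<Rightarrow> real) \<Rightarrow> (nat \<Rightarrow> real) \<Rightarrow> (nat \<Rightarrow> real) \<Rightarrow> bool" where
  "tube_closure R C \<eta> T \<xi> bfx bfy \<alpha> \<gamma> lam \<longleftrightarrow>
     (\<forall>k. let \<beta> = \<alpha> k * lam k;
              \<Gamma>\<^sub>\<psi> = 1 - (1 - rho_psi C * \<gamma> k) ^ T;
              \<Gamma>\<^sub>L = 1 - (1 - 7/8 * rho_psi C * \<beta>) ^ T;
              \<sigma>\<^sub>y = d_f0 C + bfy
          in real T * \<alpha> k * \<sigma>\<^sub>y \<le> \<eta> / 8 * \<Gamma>\<^sub>L \<and>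
             l_star0 C * \<xi> * \<beta> * (bfx / lam 0 + 2 * l_g0 R) \<le> \<eta> / 8 * \<Gamma>\<^sub>\<psi> \<and>
             (real T * d_f0 C / (8 * lam 0) + \<xi> * l_lam0 C * (bfx / lam 0 + 2 * l_g0 R)) * \<beta>
               \<le> \<eta> / 8 * \<Gamma>\<^sub>L)"

end

theory Submission
  imports Defs "HOL-Real_Asymp.Real_Asymp"
begin

text \<open>
  The trackers \<open>z\<close> and \<open>y\<close> follow two moving targets, the minimiser \<open>ystar P x\<close> of the barrier objective and
  the minimiser \<open>yl lam x\<close> of the penalised objective. Distances to a target are measured in the metric that
  the barrier Hessian defines there. This metric changes little within its own unit ball
  (\<open>dikin_ball\<close>), so a step preconditioned by the metric frozen at the start of the inner loop still
  contracts towards the target (\<open>frozen_step_contracts\<close>). The contraction of one inner loop exceeds the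
  almost surely bounded noise and the drift of the targets, which the closure inequalities limit; hence the
  neighbourhoods are never left (\<open>next_z\<close>, \<open>next_y\<close>, \<open>AE_good\<close>).

  For the rate, the direction \<open>q\<close> used in the \<open>x\<close>-step is compared with the gradient of \<open>Fmu\<close>. At the exact
  targets it is off by \<open>O(1/lam)\<close> (\<open>bias_at_centres\<close>), by implicit differentiation of both stationarity
  conditions; the tracking errors add \<open>lam\<close> times their size (\<open>bias_bound\<close>). The potential
  \<open>Fmu + \<kappa> lam (a + b)\<close>, with \<open>a\<close> and \<open>b\<close> the squared tracking errors, balances these effects
  (\<open>potential_step\<close>): the contraction of the trackers pays for the bias that they cause, and the descent
  of \<open>Fmu\<close> pays for the drift of the targets, because the ratio of outer to inner step lengths is
  small.

  The drift also responds to the noise of the \<open>x\<close>-oracle. Estimating this response by Young's inequality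
  would leave an error of order \<open>\<alpha>\<close> per iteration, whose sum is as large as the sum of the step sizes.
  Instead, the targets are expanded to first order with a Lipschitz Jacobian. The linear response pairs the
  noise with a vector that the past determines and has mean zero (\<open>centred_noise_orthogonal\<close>), and only a
  remainder of order \<open>\<alpha>\<^sup>2 lam\<close> is left (\<open>tracking_after_drift\<close>).

  One iteration thus decreases the potential by \<open>\<xi> \<alpha> / 2\<close> times the squared gradient norm, up to centred
  noise and an error \<open>err\<close> (\<open>potential_decrease\<close>). Under the given exponents every term of \<open>err\<close> is of
  order \<open>1/k\<close> (\<open>err_rate\<close>). The weighted sum of the expected squared gradient norms up to \<open>K\<close> is therefore of
  order \<open>ln K\<close> (\<open>summed_decrease\<close>), while the weights add up to order \<open>K powr (2/5)\<close> (\<open>weighted_min_rate\<close>).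
  The potential inequality is only needed for large \<open>k\<close>, since finitely many iterations do not affect
  the rate.
\<close>

section \<open>Metrics given by positive definite operators\<close>

locale spd =
  fixes H :: "'a::euclidean_space \<Rightarrow> 'a"
  assumes lin: "linear H"
    and sym: "H u \<bullet> v = u \<bullet> H v"
    and pos: "u \<noteq> 0 \<Longrightarrow> 0 < H u \<bullet> u"
begin

text \<open>The norm of the metric and its dual norm.\<close>

definition N :: "'a \<Rightarrow> real" where "N u = sqrt (H u \<bullet> u)"
definition Nd :: "'a \<Rightarrow> real" where "Nd w = sqrt (inv H w \<bullet> w)"

lemma form_nonneg: "0 \<le> H u \<bullet> u"
  using pos[of u] lin by (cases "u = 0") (auto simp: linear_0)

lemma N_nonneg: "0 \<le> N u" by (simp add: N_def form_nonneg)
lemma N_sq: "(N u)\<^sup>2 = H u \<bullet> u" by (simp add: N_def form_nonneg)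
lemma N_eq0: "N u = 0 \<longleftrightarrow> u = 0"
  using pos[of u] lin by (cases "u = 0") (auto simp: N_def linear_0)

lemma bij: "bij H"
proof -
  have "inj H"
    using lin pos by (metis linear_injective_0 inner_zero_left less_irrefl)
  then show ?thesis
    using lin linear_injective_imp_surjective by (auto simp: bij_def)
qed

lemma H_inv [simp]: "H (inv H w) = w" using bij by (simp add: bij_is_surj surj_f_inv_f)
lemma inv_H [simp]: "inv H (H w) = w" using bij by (simp add: bij_is_inj inv_f_f)

lemma linear_inv: "linear (inv H)"
proof (rule linearI)
  show "inv H (u + v) = inv H u + inv H v" for u v
    using inv_H[of "inv H u + inv H v"] lin by (simp add: linear_add)
  show "inv H (r *\<^sub>R u) = r *\<^sub>R inv H u" for r u
    using inv_H[of "r *\<^sub>R inv H u"] lin by (simp add: linear_cmul)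
qed

text \<open>A symmetric operator is bounded by its quadratic form (polarisation). All operator estimates in
  a metric are instances of this: Cauchy--Schwarz, bounds for Hessians and bounds for gradient steps.\<close>

lemma form_bound:
  assumes S: "linear S" "\<And>u v. S u \<bullet> v = u \<bullet> S v" and b: "\<And>u. \<bar>S u \<bullet> u\<bar> \<le> k * (H u \<bullet> u)"
  shows "\<bar>S u \<bullet> v\<bar> \<le> k * N u * N v"
proof (cases "u = 0 \<or> v = 0")
  case True
  then show ?thesis using S(1) lin by (auto simp: N_def linear_0)
next
  case False
  then have p: "N u > 0" "N v > 0" using N_nonneg N_eq0 by (metis less_le)+
  \<comment> \<open>normalise both vectors before polarising\<close>
  define a where "a = u /\<^sub>R N u"
  define b where "b = v /\<^sub>R N v"
  have Ha: "H a \<bullet> a = 1" "H b \<bullet> b = 1"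
    using p N_sq[of u] N_sq[of v] lin
    by (auto simp: a_def b_def linear_cmul field_simps power2_eq_square)
  have pol: "4 * (S a \<bullet> b) = S (a + b) \<bullet> (a + b) - S (a - b) \<bullet> (a - b)"
    using S by (simp add: linear_add linear_diff inner_simps) (metis inner_commute)
  have par: "H (a + b) \<bullet> (a + b) + H (a - b) \<bullet> (a - b) = 4"
    using lin Ha by (simp add: linear_add linear_diff inner_simps)
  have "4 * \<bar>S a \<bullet> b\<bar> \<le> \<bar>S (a + b) \<bullet> (a + b)\<bar> + \<bar>S (a - b) \<bullet> (a - b)\<bar>"
    using pol by linarith
  also have "\<dots> \<le> k * (H (a + b) \<bullet> (a + b)) + k * (H (a - b) \<bullet> (a - b))"
    using b[of "a+b"] b[of "a-b"] by linarith
  also have "\<dots> = 4 * k" using par by (metis distrib_left mult.commute)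
  finally have 1: "\<bar>S a \<bullet> b\<bar> \<le> k" by simp
  have "S u \<bullet> v = N u * N v * (S a \<bullet> b)"
    using p S(1) by (simp add: a_def b_def linear_cmul field_simps)
  then have "\<bar>S u \<bullet> v\<bar> = N u * N v * \<bar>S a \<bullet> b\<bar>"
    using p by (simp add: abs_mult)
  also have "\<dots> \<le> N u * N v * k" using 1 p by (intro mult_left_mono) auto
  finally show ?thesis by (simp add: mult_ac)
qed

lemma cauchy: "\<bar>H u \<bullet> v\<bar> \<le> N u * N v"
  using form_bound[of H 1 u v] lin sym form_nonneg by simp

lemma N_inv: "N (inv H w) = Nd w"
  by (simp add: N_def Nd_def inner_commute)

lemma Nd_H: "Nd (H u) = N u"
  using N_inv[of "H u"] by simp

lemma Nd_nonneg: "0 \<le> Nd w" using N_nonneg N_inv by metis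

lemma dual_cauchy: "\<bar>w \<bullet> u\<bar> \<le> Nd w * N u"
  using cauchy[of "inv H w" u] N_inv[of w] by simp

lemma N_leI: assumes "\<And>v. H u \<bullet> v \<le> k * N v" shows "N u \<le> k"
proof (cases "u = 0")
  case True
  \<comment> \<open>testing with a nonzero vector forces \<open>k\<close> to be nonnegative\<close>
  obtain b :: 'a where "b \<in> Basis" using nonempty_Basis by blast
  then have b: "N b > 0" using N_nonneg N_eq0 by (metis less_le nonzero_Basis)
  have "0 \<le> k * N b" using assms[of b] True lin by (simp add: linear_0)
  then show ?thesis using b True by (simp add: N_eq0[THEN iffD2] zero_le_mult_iff)
next
  case False
  then have p: "N u > 0" using N_nonneg N_eq0 by (metis less_le)
  have "N u * N u \<le> k * N u" using assms[of u] N_sq[of u] by (simp add: power2_eq_square)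
  then show ?thesis using p by simp
qed

lemma Nd_leI: assumes "\<And>v. w \<bullet> v \<le> k * N v" shows "Nd w \<le> k"
  using N_leI[of "inv H w" k] assms N_inv[of w] by simp

lemma N_scale: "N (r *\<^sub>R u) = \<bar>r\<bar> * N u"
  using lin by (simp add: N_def linear_cmul real_sqrt_mult flip: power2_eq_square mult.assoc)

lemma N_minus: "N (- u) = N u" using N_scale[of "-1" u] by simp

lemma N_tri: "N (u + v) \<le> N u + N v"
proof (rule N_leI)
  fix w
  have "H (u + v) \<bullet> w = H u \<bullet> w + H v \<bullet> w" using lin by (simp add: linear_add inner_simps)
  also have "\<dots> \<le> N u * N w + N v * N w" using cauchy[of u w] cauchy[of v w] by linarith
  finally show "H (u + v) \<bullet> w \<le> (N u + N v) * N w" by (simp add: distrib_right)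
qed

lemma N_diff: "N (u - v) \<le> N u + N v"
  using N_tri[of u "-v"] N_minus[of v] by simp

lemma N_sum_sq: "(N (u + v))\<^sup>2 = (N u)\<^sup>2 + 2 * (H u \<bullet> v) + (N v)\<^sup>2"
  using lin by (simp add: N_sq linear_add inner_simps) (metis inner_commute sym)

lemma spd_inv: "spd (inv H)"
  unfolding spd_def
proof (intro conjI allI impI)
  show "linear (inv H)" by (rule linear_inv)
  show "inv H u \<bullet> v = u \<bullet> inv H v" for u v using sym[of "inv H u" "inv H v"] by simp
  show "0 < inv H u \<bullet> u" if "u \<noteq> 0" for u
    using pos[of "inv H u"] that by (metis H_inv inner_commute lin linear_0)
qed

lemma Nd_scale: "Nd (r *\<^sub>R w) = \<bar>r\<bar> * Nd w"
  using N_scale[of r "inv H w"] linear_inv by (simp add: N_inv[symmetric] linear_cmul)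

lemma Nd_minus: "Nd (- w) = Nd w" using Nd_scale[of "-1" w] by simp

lemma Nd_tri: "Nd (u + v) \<le> Nd u + Nd v"
  using N_tri[of "inv H u" "inv H v"] linear_inv by (simp add: N_inv[symmetric] linear_add)

lemma Nd_diff: "Nd (u - v) \<le> Nd u + Nd v"
  using Nd_tri[of u "-v"] Nd_minus[of v] by simp

lemma operator_bound:
  assumes "linear S" "\<And>u v. S u \<bullet> v = u \<bullet> S v" "\<And>u. \<bar>S u \<bullet> u\<bar> \<le> k * (H u \<bullet> u)"
  shows "Nd (S u) \<le> k * N u"
  using form_bound[OF assms, of u] by (intro Nd_leI) (metis abs_le_D1)

lemma N_le_scaled_norm: "\<exists>B\<ge>0. \<forall>u. N u \<le> B * norm u"
proof -
  obtain B where B: "B > 0" "\<And>u. norm (H u) \<le> B * norm u" using linear_bounded_pos[OF lin] by blast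
  have "N u \<le> sqrt B * norm u" for u
  proof -
    have "H u \<bullet> u \<le> norm (H u) * norm u" by (rule norm_cauchy_schwarz)
    also have "\<dots> \<le> B * norm u * norm u" using B by (intro mult_right_mono) auto
    finally have "H u \<bullet> u \<le> B * (norm u)\<^sup>2" by (simp add: power2_eq_square)
    then show ?thesis unfolding N_def by (metis real_sqrt_le_iff real_sqrt_mult real_sqrt_abs abs_norm_cancel)
  qed
  then show ?thesis using B by (intro exI[of _ "sqrt B"]) auto
qed

end

text \<open>Inversion reverses the order of forms: \<open>inv H w \<bullet> w\<close> is the pairing of \<open>w\<close> with \<open>v = inv H w\<close>, which
  the dual norm of \<open>H0\<close> bounds by the \<open>H0\<close>-norm of \<open>v\<close>.\<close>

lemma inv_order:
  assumes "spd H" "spd H0" and le: "\<And>u. H0 u \<bullet> u \<le> K * (H u \<bullet> u)" and K: "K \<ge> 0"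
  shows "inv H w \<bullet> w \<le> K * (inv H0 w \<bullet> w)"
proof -
  interpret H: spd H by fact
  interpret H0: spd H0 by fact
  let ?v = "inv H w"
  have e: "(H.Nd w)\<^sup>2 = w \<bullet> ?v" using H.N_sq[of ?v] by (simp add: H.N_inv)
  also have "\<dots> \<le> H0.Nd w * H0.N ?v" using H0.dual_cauchy[of w ?v] by simp
  also have "H0.N ?v \<le> sqrt K * H.Nd w"
    using le[of ?v] by (metis H.N_def H.N_inv H0.N_def real_sqrt_le_iff real_sqrt_mult)
  finally have *: "(H.Nd w)\<^sup>2 \<le> (H0.Nd w * sqrt K) * H.Nd w"
    using H0.Nd_nonneg[of w] by (simp add: mult_left_mono mult.assoc)
  have "H.Nd w \<le> H0.Nd w * sqrt K"
  proof (cases "H.Nd w = 0")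
    case True then show ?thesis using H0.Nd_nonneg[of w] K by simp
  next
    case False
    then have "H.Nd w > 0" using H.Nd_nonneg[of w] by simp
    then show ?thesis using * by (simp add: power2_eq_square)
  qed
  then have "(H.Nd w)\<^sup>2 \<le> (H0.Nd w * sqrt K)\<^sup>2" using H.Nd_nonneg by (rule power_mono)
  then show ?thesis
    using K spd.form_nonneg[OF H.spd_inv] spd.form_nonneg[OF H0.spd_inv]
    by (simp add: H.Nd_def H0.Nd_def power_mult_distrib mult.commute)
qed

text \<open>Two metrics whose forms agree up to the factor \<open>1 + \<theta>\<close>; the frozen metric of an inner loop is
  compared with the metric at the centre in this way.\<close>

locale two_metrics = H: spd H + H0: spd H0 for H H0 :: "'a::euclidean_space \<Rightarrow> 'a" +
  fixes \<theta> :: real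
  assumes th: "0 \<le> \<theta>"
    and upper: "H0 u \<bullet> u \<le> (1 + \<theta>) * (H u \<bullet> u)"
    and lower: "H u \<bullet> u \<le> (1 + \<theta>) * (H0 u \<bullet> u)"
begin

text \<open>The inverse forms agree up to the factor \<open>1 + \<theta>\<close> as well, so their difference is a symmetric operator
  whose form is at most \<open>\<theta>\<close> times that of \<open>inv H\<close>.\<close>

lemma inv_diff: "H.N (inv H w - inv H0 w) \<le> \<theta> * H.Nd w"
proof -
  interpret D: spd "inv H" by (rule H.spd_inv)
  let ?S = "\<lambda>w. inv H w - inv H0 w"
  have lS: "linear ?S" using H.linear_inv H0.linear_inv by (rule linear_compose_sub)
  have sS: "?S u \<bullet> v = u \<bullet> ?S v" for u v
    using D.sym[of u v] spd.sym[OF H0.spd_inv, of u v] by (simp add: inner_simps)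
  have bS: "\<bar>?S u \<bullet> u\<bar> \<le> \<theta> * (inv H u \<bullet> u)" for u
  proof -
    have 1: "inv H u \<bullet> u \<le> (1 + \<theta>) * (inv H0 u \<bullet> u)"
      using inv_order[OF H.spd_axioms H0.spd_axioms upper] th by simp
    have 2: "inv H0 u \<bullet> u \<le> (1 + \<theta>) * (inv H u \<bullet> u)"
      using inv_order[OF H0.spd_axioms H.spd_axioms lower] th by simp
    define h where "h = inv H u \<bullet> u"
    define h0 where "h0 = inv H0 u \<bullet> u"
    have n: "h \<ge> 0" using D.form_nonneg by (simp add: h_def)
    have "h \<le> (1 + \<theta>) * h0" "h0 \<le> (1 + \<theta>) * h" using 1 2 by (auto simp: h_def h0_def)
    moreover have "h - h0 \<le> \<theta> * h"
    proof (cases "h0 \<le> h")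
      case True
      then have "\<theta> * h0 \<le> \<theta> * h" using th by (rule mult_left_mono)
      then show ?thesis using calculation by (simp add: algebra_simps)
    next
      case False
      then show ?thesis using th n by (smt (verit) mult_nonneg_nonneg)
    qed
    ultimately have "\<bar>h - h0\<bar> \<le> \<theta> * h" by (simp add: algebra_simps abs_le_iff)
    then show ?thesis by (simp add: h_def h0_def inner_simps)
  qed
  have "spd.Nd (inv H) (?S w) \<le> \<theta> * spd.N (inv H) w"
    by (rule D.operator_bound[OF lS sS bS])
  moreover have "inv (inv H) = H" using H.bij by (simp add: inv_inv_eq)
  ultimately show ?thesis by (simp add: D.Nd_def D.N_def H.N_def H.Nd_def)
qed

lemma N_inv0: "H.N (inv H0 w) \<le> (1 + \<theta>) * H.Nd w"
proof -
  have "H.N (inv H0 w) = H.N (inv H w - (inv H w - inv H0 w))" by simp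
  also have "\<dots> \<le> H.N (inv H w) + H.N (inv H w - inv H0 w)" by (rule H.N_diff)
  finally show ?thesis using inv_diff[of w] by (simp add: H.N_inv algebra_simps)
qed

text \<open>A gradient step contracts when the gradient is preconditioned by the wrong metric: replacing
  \<open>H0\<close> by \<open>H\<close> costs \<open>\<gamma> \<theta> L\<close>, and with the right metric the step is the symmetric operator
  \<open>H - \<gamma> M\<close>, whose form lies between \<open>0\<close> and \<open>1 - \<gamma> m\<close>.\<close>

lemma gradient_step:
  assumes M: "linear M" "\<And>u v. M u \<bullet> v = u \<bullet> M v"
    and lo: "\<And>u. m * (H u \<bullet> u) \<le> M u \<bullet> u" and hi: "\<And>u. M u \<bullet> u \<le> L * (H u \<bullet> u)"
    and m: "0 \<le> m" and g: "0 \<le> \<gamma>" "\<gamma> * L \<le> 1"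
  shows "H.N (u - \<gamma> *\<^sub>R inv H0 (M u)) \<le> (1 - \<gamma> * m + \<gamma> * \<theta> * L) * H.N u"
proof -
  let ?S = "\<lambda>u. H u - \<gamma> *\<^sub>R M u"
  have lS: "linear ?S" using H.lin M(1)
    by (intro linear_compose_sub linear_compose_scale_right) auto
  have bS: "\<bar>?S u \<bullet> u\<bar> \<le> (1 - \<gamma> * m) * (H u \<bullet> u)" for u
  proof -
    have f: "0 \<le> H u \<bullet> u" by (rule H.form_nonneg)
    have "\<gamma> * (M u \<bullet> u) \<le> \<gamma> * L * (H u \<bullet> u)" using hi[of u] g by (simp add: mult_left_mono mult.assoc)
    also have "\<dots> \<le> 1 * (H u \<bullet> u)" using g f by (intro mult_right_mono) auto
    finally have 1: "0 \<le> ?S u \<bullet> u" by (simp add: inner_simps)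
    have "\<gamma> * (m * (H u \<bullet> u)) \<le> \<gamma> * (M u \<bullet> u)" using lo[of u] g by (simp add: mult_left_mono)
    then show ?thesis using 1 by (simp add: inner_simps algebra_simps)
  qed
  have "H.Nd (?S u) \<le> (1 - \<gamma> * m) * H.N u"
    by (rule H.operator_bound[OF lS _ bS]) (use M(2) H.sym in \<open>simp add: inner_simps\<close>)
  then have 1: "H.N (u - \<gamma> *\<^sub>R inv H (M u)) \<le> (1 - \<gamma> * m) * H.N u"
    using H.Nd_H[of "u - \<gamma> *\<^sub>R inv H (M u)"] H.lin by (simp add: linear_diff linear_cmul)
  have bM: "\<bar>M u \<bullet> u\<bar> \<le> L * (H u \<bullet> u)" for u
    using lo[of u] hi[of u] m H.form_nonneg[of u] by (smt (verit) mult_nonneg_nonneg)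
  have 2: "H.Nd (M u) \<le> L * H.N u" by (rule H.operator_bound[OF M bM])
  have "u - \<gamma> *\<^sub>R inv H0 (M u) = (u - \<gamma> *\<^sub>R inv H (M u)) + \<gamma> *\<^sub>R (inv H (M u) - inv H0 (M u))"
    by (simp add: algebra_simps)
  then have "H.N (u - \<gamma> *\<^sub>R inv H0 (M u))
    \<le> H.N (u - \<gamma> *\<^sub>R inv H (M u)) + H.N (\<gamma> *\<^sub>R (inv H (M u) - inv H0 (M u)))"
    using H.N_tri by metis
  also have "\<dots> \<le> (1 - \<gamma> * m) * H.N u + \<gamma> * (\<theta> * H.Nd (M u))"
    using 1 mult_left_mono[OF inv_diff[of "M u"] g(1)] g(1) by (simp only: H.N_scale abs_of_nonneg add_mono)
  also have "\<gamma> * (\<theta> * H.Nd (M u)) \<le> \<gamma> * (\<theta> * (L * H.N u))"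
    using 2 g th by (intro mult_left_mono) auto
  finally show ?thesis by (simp add: algebra_simps)
qed

end

section \<open>Gradients and Hessians\<close>

lemma grad_eqI:
  assumes "(h has_derivative (\<lambda>u. u \<bullet> D)) (at x)"
  shows "grad h x = D"
  unfolding grad_def
proof (rule the_equality)
  show "GDERIV h x :> D" using assms by (simp add: gderiv_def)
  fix D' assume "GDERIV h x :> D'"
  then have "(\<lambda>u. u \<bullet> D') = (\<lambda>u. u \<bullet> D)"
    using assms has_derivative_unique by (auto simp: gderiv_def)
  then have "(D' - D) \<bullet> (D' - D) = 0" by (metis inner_diff_right diff_self)
  then show "D' = D" by simp
qed

text \<open>Riesz representation: the derivative is the inner product with its adjoint at \<open>1\<close>.\<close>

lemma has_derivative_grad:
  fixes h :: "'a::euclidean_space \<Rightarrow> real"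
  assumes "h differentiable (at x)"
  shows "(h has_derivative (\<lambda>u. u \<bullet> grad h x)) (at x)"
proof -
  obtain h' where h': "(h has_derivative h') (at x)" using assms by (auto simp: differentiable_def)
  then have "linear h'" by (rule has_derivative_linear)
  then have "h' = (\<lambda>u. u \<bullet> adjoint h' 1)" by (auto simp: adjoint_works fun_eq_iff)
  then have "(h has_derivative (\<lambda>u. u \<bullet> adjoint h' 1)) (at x)" using h' by metis
  then show ?thesis using grad_eqI by metis
qed

lemma C2_grad:
  fixes h :: "'a::euclidean_space \<Rightarrow> real"
  assumes "C2 h"
  shows "(h has_derivative (\<lambda>u. u \<bullet> grad h x)) (at x)"
  using assms has_derivative_grad by (auto simp: C2_def)

lemma C2_hess:
  assumes "C2 h" shows "(grad h has_derivative hess h x) (at x)"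
  using assms by (auto simp: C2_def hess_def frechet_derivative_works[symmetric])

lemma C2_continuous_grad:
  assumes "C2 h" shows "continuous_on UNIV (grad h)"
  by (rule continuous_at_imp_continuous_on) (use C2_hess[OF assms] in \<open>auto intro: has_derivative_continuous\<close>)

text \<open>Testing against a fixed vector \<open>w\<close> makes the scalar mean value theorem available for vector-valued
  maps, with an intermediate point that depends on \<open>w\<close>. This suffices for bounds in a norm that is a
  supremum of such pairings.\<close>

lemma mvt_inner:
  fixes G :: "'a::real_normed_vector \<Rightarrow> 'b::real_inner"
  assumes "\<And>t. 0 \<le> t \<Longrightarrow> t \<le> 1 \<Longrightarrow> (G has_derivative G' (a + t *\<^sub>R u)) (at (a + t *\<^sub>R u))"
  shows "\<exists>t. 0 < t \<and> t < 1 \<and> (G (a + u) - G a) \<bullet> w = G' (a + t *\<^sub>R u) u \<bullet> w"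
proof -
  define F where "F = (\<lambda>t. G (a + t *\<^sub>R u) \<bullet> w)"
  have "(F has_real_derivative G' (a + t *\<^sub>R u) u \<bullet> w) (at t)"
    if "0 \<le> t" "t \<le> 1" for t
  proof -
    have "((\<lambda>t. a + t *\<^sub>R u) has_derivative (\<lambda>s. s *\<^sub>R u)) (at t)"
      by (auto intro!: derivative_eq_intros)
    from has_derivative_compose[OF this assms[OF that]]
    have "((\<lambda>t. G (a + t *\<^sub>R u) \<bullet> w) has_derivative (\<lambda>s. G' (a + t *\<^sub>R u) (s *\<^sub>R u) \<bullet> w)) (at t)"
      by (rule has_derivative_inner_left)
    moreover have "(\<lambda>s. G' (a + t *\<^sub>R u) (s *\<^sub>R u) \<bullet> w) = (*) (G' (a + t *\<^sub>R u) u \<bullet> w)"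
      using linear_cmul[OF has_derivative_linear[OF assms[OF that]]] by (auto simp: fun_eq_iff)
    ultimately show ?thesis by (simp add: has_field_derivative_def F_def)
  qed
  then obtain t where "0 < t" "t < 1" "F 1 - F 0 = (1 - 0) * (G' (a + t *\<^sub>R u) u \<bullet> w)"
    using MVT2[of 0 1 F "\<lambda>t. G' (a + t *\<^sub>R u) u \<bullet> w"] by auto
  then show ?thesis by (auto simp: inner_diff_left F_def)
qed

lemma mvt_grad:
  fixes h :: "'a::euclidean_space \<Rightarrow> real"
  assumes "\<And>v. (h has_derivative (\<lambda>u. u \<bullet> D v)) (at v)"
  shows "\<exists>t. 0 < t \<and> t < 1 \<and> h (a + u) - h a = u \<bullet> D (a + t *\<^sub>R u)"
  using mvt_inner[of h "\<lambda>v u. u \<bullet> D v" a u 1] assms by auto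

text \<open>Both sides are limits of the same second difference quotient of \<open>h\<close> over a shrinking
  parallelogram.\<close>

lemma hess_symmetric:
  fixes h :: "'a::euclidean_space \<Rightarrow> real"
  assumes h: "C2 h"
  shows "hess h v u \<bullet> w = u \<bullet> hess h v w"
proof -
  have quotient: "\<exists>p. norm p \<le> e * (norm u + norm w) \<and>
      h (v + e *\<^sub>R u + e *\<^sub>R w) - h (v + e *\<^sub>R u) - h (v + e *\<^sub>R w) + h v = e\<^sup>2 * (hess h (v + p) u \<bullet> w)"
    if e: "0 < e" for e and u w :: 'a
  proof -
    define k where "k = (\<lambda>y. h (y + e *\<^sub>R u) - h y)"
    have dk: "(k has_derivative (\<lambda>z. z \<bullet> (grad h (y + e *\<^sub>R u) - grad h y))) (at y)" for y
    proof -
      have "((\<lambda>y. y + e *\<^sub>R u) has_derivative (\<lambda>z. z)) (at y)" by (auto intro!: derivative_eq_intros)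
      from has_derivative_diff[OF has_derivative_compose[OF this C2_grad[OF h]] C2_grad[OF h]]
      show ?thesis by (simp add: k_def inner_diff_right)
    qed
    from mvt_grad[of k "\<lambda>y. grad h (y + e *\<^sub>R u) - grad h y" v "e *\<^sub>R w"] dk
    obtain t where t: "0 < t" "t < 1"
      "k (v + e *\<^sub>R w) - k v = (e *\<^sub>R w) \<bullet> (grad h (v + t *\<^sub>R e *\<^sub>R w + e *\<^sub>R u) - grad h (v + t *\<^sub>R e *\<^sub>R w))"
      by blast
    from mvt_inner[of "grad h" "hess h" "v + t *\<^sub>R e *\<^sub>R w" "e *\<^sub>R u" w] C2_hess[OF h]
    obtain s where s: "0 < s" "s < 1" "(grad h (v + t *\<^sub>R e *\<^sub>R w + e *\<^sub>R u) - grad h (v + t *\<^sub>R e *\<^sub>R w)) \<bullet> w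
        = hess h (v + t *\<^sub>R e *\<^sub>R w + s *\<^sub>R e *\<^sub>R u) (e *\<^sub>R u) \<bullet> w" by blast
    let ?p = "t *\<^sub>R e *\<^sub>R w + s *\<^sub>R e *\<^sub>R u"
    have "norm ?p \<le> norm (t *\<^sub>R e *\<^sub>R w) + norm (s *\<^sub>R e *\<^sub>R u)" by (rule norm_triangle_ineq)
    also have "\<dots> \<le> 1 * (e * norm w) + 1 * (e * norm u)"
      using t s e by (intro add_mono) (auto simp: mult_left_le_one_le)
    finally have "norm ?p \<le> e * (norm u + norm w)" by (simp add: algebra_simps)
    moreover have "k (v + e *\<^sub>R w) - k v = e\<^sup>2 * (hess h (v + ?p) u \<bullet> w)"
      using t(3) s(3) linear_cmul[OF has_derivative_linear[OF C2_hess[OF h]], of _ e u]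
      by (simp add: inner_commute[of w] power2_eq_square add.assoc)
    ultimately show ?thesis by (intro exI[of _ ?p]) (simp add: k_def add_ac)
  qed
  have close: "\<exists>p q. norm p \<le> e * (norm u + norm w) \<and> norm q \<le> e * (norm u + norm w) \<and>
      hess h (v + p) u \<bullet> w = hess h (v + q) w \<bullet> u" if e: "0 < e" for e
  proof -
    obtain p where p: "norm p \<le> e * (norm u + norm w)" 
      "h (v + e *\<^sub>R u + e *\<^sub>R w) - h (v + e *\<^sub>R u) - h (v + e *\<^sub>R w) + h v = e\<^sup>2 * (hess h (v + p) u \<bullet> w)"
      using quotient[OF e] by blast
    obtain q where q: "norm q \<le> e * (norm w + norm u)" 
      "h (v + e *\<^sub>R w + e *\<^sub>R u) - h (v + e *\<^sub>R w) - h (v + e *\<^sub>R u) + h v = e\<^sup>2 * (hess h (v + q) w \<bullet> u)"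
      using quotient[OF e] by blast
    have "e\<^sup>2 * (hess h (v + p) u \<bullet> w) = e\<^sup>2 * (hess h (v + q) w \<bullet> u)"
      unfolding p(2)[symmetric] q(2)[symmetric] by (simp add: add_ac)
    then show ?thesis using p(1) q(1) e by (auto simp: add.commute)
  qed
  have cont: "continuous (at v) (\<lambda>x. hess h x u \<bullet> w)" for u w
    using h by (intro continuous_intros) (auto simp: C2_def continuous_on_eq_continuous_at)
  have "\<bar>hess h v u \<bullet> w - hess h v w \<bullet> u\<bar> \<le> e" if e: "e > 0" for e
  proof -
    obtain d1 where d1: "d1 > 0" "\<And>x. dist x v < d1 \<Longrightarrow> dist (hess h x u \<bullet> w) (hess h v u \<bullet> w) < e/2"
      using cont[of u w] e unfolding continuous_at_eps_delta by (metis half_gt_zero)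
    obtain d2 where d2: "d2 > 0" "\<And>x. dist x v < d2 \<Longrightarrow> dist (hess h x w \<bullet> u) (hess h v w \<bullet> u) < e/2"
      using cont[of w u] e unfolding continuous_at_eps_delta by (metis half_gt_zero)
    define c where "c = min d1 d2 / (2 * (norm u + norm w + 1))"
    have c: "c > 0" using d1 d2 by (simp add: c_def add_nonneg_pos)
    have "c * (norm u + norm w) \<le> c * (norm u + norm w + 1)" using c by simp
    also have "\<dots> = min d1 d2 / 2" by (simp add: c_def field_simps add_nonneg_eq_0_iff)
    finally have cc: "c * (norm u + norm w) < d1" "c * (norm u + norm w) < d2" using d1 d2 by auto
    obtain p q where pq: "norm p \<le> c * (norm u + norm w)" "norm q \<le> c * (norm u + norm w)"
      "hess h (v + p) u \<bullet> w = hess h (v + q) w \<bullet> u" using close[OF c] by blast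
    then have "dist (v + p) v < d1" "dist (v + q) v < d2" using cc by (auto simp: dist_norm)
    then show ?thesis using d1(2)[of "v+p"] d2(2)[of "v+q"] pq(3)
      unfolding dist_real_def by (smt (verit) field_sum_of_halves)
  qed
  then have "\<bar>hess h v u \<bullet> w - hess h v w \<bullet> u\<bar> \<le> 0" by (rule field_le_epsilon) auto
  then show ?thesis by (simp add: inner_commute)
qed

context
  fixes h :: "(real^'n::finite) \<times> (real^'d::finite) \<Rightarrow> real"
  assumes h: "C2 h"
begin

lemma has_derivative_grad_x: "((\<lambda>x. h (x, y)) has_derivative (\<lambda>u. u \<bullet> fst (grad h (x, y)))) (at x)"
proof -
  have "((\<lambda>x. (x, y)) has_derivative (\<lambda>u. (u, 0))) (at x)" by (auto intro!: derivative_eq_intros)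
  from has_derivative_compose[OF this C2_grad[OF h]] show ?thesis by (simp add: inner_prod_def)
qed

lemma has_derivative_grad_y: "((\<lambda>y. h (x, y)) has_derivative (\<lambda>u. u \<bullet> snd (grad h (x, y)))) (at y)"
proof -
  have "((\<lambda>y. (x, y)) has_derivative (\<lambda>u. (0, u))) (at y)" by (auto intro!: derivative_eq_intros)
  from has_derivative_compose[OF this C2_grad[OF h]] show ?thesis by (simp add: inner_prod_def)
qed

lemma grad_x_fst: "grad_x h x y = fst (grad h (x, y))"
  unfolding grad_x_def by (rule grad_eqI) (rule has_derivative_grad_x)

lemma grad_y_snd: "grad_y h x y = snd (grad h (x, y))"
  unfolding grad_y_def by (rule grad_eqI) (rule has_derivative_grad_y)

lemma hess_add: "hess h v (u + w) = hess h v u + hess h v w"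
  using has_derivative_linear[OF C2_hess[OF h]] by (rule linear_add)

text \<open>Chain rule along a curve in both arguments; the partial Hessians are its special cases.\<close>

lemma grad_y_along:
  assumes "(c has_derivative c') (at x)" and "(d has_derivative d') (at x)"
  shows "((\<lambda>x. grad_y h (c x) (d x)) has_derivative (\<lambda>u. snd (hess h (c x, d x) (c' u, d' u)))) (at x)"
proof -
  have "((\<lambda>x. (c x, d x)) has_derivative (\<lambda>u. (c' u, d' u))) (at x)"
    using assms by (rule has_derivative_Pair)
  from has_derivative_snd[OF has_derivative_compose[OF this C2_hess[OF h]]]
  show ?thesis by (simp add: grad_y_snd)
qed

lemma hess_yy_snd: "hess_yy h x y v = snd (hess h (x, y) (0, v))"
  and has_derivative_hess_yy: "((\<lambda>y. grad_y h x y) has_derivative hess_yy h x y) (at y)"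
proof -
  have 1: "((\<lambda>y. grad_y h x y) has_derivative (\<lambda>u. snd (hess h (x, y) (0, u)))) (at y)"
    by (rule grad_y_along) (auto intro!: derivative_eq_intros)
  then have 2: "hess_yy h x y = (\<lambda>u. snd (hess h (x, y) (0, u)))"
    unfolding hess_yy_def by (simp add: frechet_derivative_at[symmetric])
  show "hess_yy h x y v = snd (hess h (x, y) (0, v))" by (simp add: 2)
  show "((\<lambda>y. grad_y h x y) has_derivative hess_yy h x y) (at y)" using 1 by (simp add: 2)
qed

lemma hess_xy_snd: "hess_xy h x y u = snd (hess h (x, y) (u, 0))"
  and has_derivative_hess_xy: "((\<lambda>x. grad_y h x y) has_derivative hess_xy h x y) (at x)"
proof -
  have 1: "((\<lambda>x. grad_y h x y) has_derivative (\<lambda>u. snd (hess h (x, y) (u, 0)))) (at x)"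
    by (rule grad_y_along) (auto intro!: derivative_eq_intros)
  then have 2: "hess_xy h x y = (\<lambda>u. snd (hess h (x, y) (u, 0)))"
    unfolding hess_xy_def by (simp add: frechet_derivative_at[symmetric])
  show "hess_xy h x y u = snd (hess h (x, y) (u, 0))" by (simp add: 2)
  show "((\<lambda>x. grad_y h x y) has_derivative hess_xy h x y) (at x)" using 1 by (simp add: 2)
qed

lemma linear_hess_yy: "linear (hess_yy h x y)"
  using has_derivative_hess_yy by (rule has_derivative_linear)

lemma linear_hess_xy: "linear (hess_xy h x y)"
  using has_derivative_hess_xy by (rule has_derivative_linear)

lemma has_derivative_grad_y_comp:
  assumes "(d has_derivative d') (at x)"
  shows "((\<lambda>x. grad_y h x (d x)) has_derivative (\<lambda>u. hess_xy h x (d x) u + hess_yy h x (d x) (d' u))) (at x)"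
proof -
  have "((\<lambda>x. grad_y h x (d x)) has_derivative (\<lambda>u. snd (hess h (x, d x) (u, d' u)))) (at x)"
    by (rule grad_y_along[OF _ assms]) (auto intro!: derivative_eq_intros)
  moreover have "snd (hess h (x, d x) (u, d' u)) = hess_xy h x (d x) u + hess_yy h x (d x) (d' u)" for u
    using hess_add[of "(x, d x)" "(u, 0)" "(0, d' u)"] by (simp add: hess_xy_snd hess_yy_snd)
  ultimately show ?thesis by simp
qed

lemma hess_yy_symmetric: "hess_yy h x y u \<bullet> v = u \<bullet> hess_yy h x y v"
  using hess_symmetric[OF h, of "(x, y)" "(0, u)" "(0, v)"] by (simp add: hess_yy_snd inner_prod_def)

text \<open>By symmetry of the Hessian, differentiating the \<open>x\<close>-gradient in \<open>y\<close> yields the transpose of the mixed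
  Hessian, which is the object that the local constants bound.\<close>

lemma has_derivative_grad_x_y:
  "((\<lambda>y. grad_x h x y \<bullet> u) has_derivative (\<lambda>v. v \<bullet> hess_xy h x y u)) (at y)"
proof -
  have "((\<lambda>y. (x, y)) has_derivative (\<lambda>u. (0, u))) (at y)" by (auto intro!: derivative_eq_intros)
  from has_derivative_inner_left[OF has_derivative_fst[OF has_derivative_compose[OF this C2_hess[OF h]]], of u]
  have "((\<lambda>y. grad_x h x y \<bullet> u) has_derivative (\<lambda>v. fst (hess h (x, y) (0, v)) \<bullet> u)) (at y)"
    by (simp add: grad_x_fst)
  moreover have "fst (hess h (x, y) (0, v)) \<bullet> u = v \<bullet> hess_xy h x y u" for v
    using hess_symmetric[OF h, of "(x, y)" "(0, v)" "(u, 0)"] by (simp add: hess_xy_snd inner_prod_def)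
  ultimately show ?thesis by simp
qed

lemma continuous_grad_x: "continuous_on UNIV (\<lambda>(x, y). grad_x h x y)"
  using continuous_on_fst[OF C2_continuous_grad[OF h]] by (simp add: grad_x_fst case_prod_beta)

lemma continuous_grad_y: "continuous_on UNIV (\<lambda>(x, y). grad_y h x y)"
  using continuous_on_snd[OF C2_continuous_grad[OF h]] by (simp add: grad_y_snd case_prod_beta)

end

text \<open>The sum of the tangent inequalities at \<open>u\<close> and \<open>v\<close>.\<close>

lemma strongly_convex_monotone:
  fixes h :: "'a::euclidean_space \<Rightarrow> real"
  assumes c: "strongly_convex \<rho> h" "0 \<le> \<rho>" and d: "\<And>v. (h has_derivative (\<lambda>u. u \<bullet> D v)) (at v)"
  shows "0 \<le> (D u - D v) \<bullet> (u - v)"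
proof -
  have tangent: "(v - u) \<bullet> D u \<le> h v - h u" for u v
  proof -
    have "((\<lambda>t. u + t *\<^sub>R (v - u)) has_derivative (\<lambda>s. s *\<^sub>R (v - u))) (at 0)"
      by (auto intro!: derivative_eq_intros)
    from has_derivative_compose[OF this d[of "u + 0 *\<^sub>R (v - u)"]]
    have "((\<lambda>t. h (u + t *\<^sub>R (v - u))) has_real_derivative (v - u) \<bullet> D u) (at 0)"
      by (simp add: has_field_derivative_def mult_commute_abs)
    then have "((\<lambda>t. (h (u + t *\<^sub>R (v - u)) - h u) / t) \<longlongrightarrow> (v - u) \<bullet> D u) (at_right 0)"
      using has_field_derivative_at_within[of _ _ 0 "{0<..}"] by (fastforce simp: has_field_derivative_iff)
    moreover have "eventually (\<lambda>t. (h (u + t *\<^sub>R (v - u)) - h u) / t \<le> h v - h u) (at_right (0::real))"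
    proof -
      have "(h (u + t *\<^sub>R (v - u)) - h u) / t \<le> h v - h u" if t: "0 < t" "t < 1" for t
      proof -
        have e: "u + t *\<^sub>R (v - u) = (1 - t) *\<^sub>R u + t *\<^sub>R v" by (simp add: algebra_simps)
        have "h ((1 - t) *\<^sub>R u + t *\<^sub>R v) \<le> (1 - t) * h u + t * h v - \<rho> / 2 * t * (1 - t) * (norm (u - v))\<^sup>2"
          using c(1) t by (simp add: strongly_convex_def)
        also have "\<dots> \<le> (1 - t) * h u + t * h v" using c(2) t by simp
        finally show ?thesis using t unfolding e by (simp add: field_simps)
      qed
      then show ?thesis unfolding eventually_at_right[OF zero_less_one] by (intro exI[of _ 1]) auto
    qed
    ultimately show ?thesis by (intro tendsto_upperbound) auto
  qed
  show ?thesis using tangent[of v u] tangent[of u v] by (simp add: inner_simps inner_commute)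
qed

section \<open>Operator norms\<close>

text \<open>A supremum of reals only controls its elements if it is bounded, which some bound \<open>B\<close> ensures.\<close>

lemma op_norm_bound:
  assumes K: "op_norm N1 N2 M \<le> K"
    and M: "linear M"
    and B: "\<And>u. N2 (M u) \<le> B * N1 u"
    and s1: "\<And>r u. N1 (r *\<^sub>R u) = \<bar>r\<bar> * N1 u" and s2: "\<And>r u. N2 (r *\<^sub>R u) = \<bar>r\<bar> * N2 u"
    and pos: "\<And>u. 0 \<le> N1 u"
  shows "N2 (M u) \<le> K * N1 u"
proof (cases "N1 u = 0")
  case True
  then show ?thesis using B[of u] by simp
next
  case False
  then have p: "0 < N1 u" using pos[of u] by simp
  let ?v = "u /\<^sub>R N1 u"
  have 1: "N1 ?v = 1" using p by (simp add: s1)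
  have "N2 (M ?v) \<le> op_norm N1 N2 M"
    unfolding op_norm_def
  proof (rule cSUP_upper)
    show "?v \<in> {u. N1 u = 1}" using 1 by simp
    show "bdd_above ((\<lambda>u. N2 (M u)) ` {u. N1 u = 1})"
      using B by (intro bdd_aboveI[of _ B]) (metis (mono_tags) imageE mem_Collect_eq mult.right_neutral)
  qed
  then have "N2 (M ?v) \<le> K" using K by simp
  then have "N2 (M u) / N1 u \<le> K" using p M by (simp add: linear_cmul s2 field_simps)
  then show ?thesis using p by (simp add: field_simps)
qed

section \<open>The logarithmic barrier\<close>

locale barrier =
  fixes P :: "('n::finite, 'd::finite, 'm::finite) bilevel" and R :: reg_consts
  assumes standing: "standing_problem P"
    and regular: "objective_regularity P R"
begin

abbreviation inside :: "(real^'d) set" where "inside \<equiv> interior (feas P)"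
abbreviation a :: "'m \<Rightarrow> real^'d" where "a i \<equiv> Amat P $ i"
abbreviation Hm :: "real^'d \<Rightarrow> real^'d \<Rightarrow> real^'d" where "Hm c \<equiv> hess (phi P) c"

definition slack :: "'m \<Rightarrow> real^'d \<Rightarrow> real" where "slack i y = bvec P $ i - a i \<bullet> y"

lemma mu_pos: "0 < mu P" using standing by (simp add: standing_problem_def)

lemma C2_upper: "C2 (upper P)" and C2_lower: "C2 (lower P)"
  using regular by (auto simp: objective_regularity_def)

lemma feas_iff: "y \<in> feas P \<longleftrightarrow> (\<forall>i. 0 \<le> slack i y)"
  by (simp add: feas_def slack_def matrix_vector_mul_component)

lemma phi_slack: "phi P y = - (\<Sum>i\<in>UNIV. ln (slack i y))"
  by (simp add: phi_def slack_def matrix_vector_mul_component)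

lemma continuous_slack: "continuous_on S (slack i)"
  unfolding slack_def by (intro continuous_intros)

text \<open>A zero row of \<open>A\<close> constrains nothing, and its slack may vanish; the derivatives of the
  barrier involve it only through a factor \<open>a i\<close>.\<close>

lemma inside_iff: "y \<in> inside \<longleftrightarrow> (\<forall>i. a i \<noteq> 0 \<longrightarrow> 0 < slack i y)"
proof
  assume y: "y \<in> inside"
  then obtain e where e: "e > 0" "cball y e \<subseteq> feas P" by (auto simp: mem_interior_cball)
  show "\<forall>i. a i \<noteq> 0 \<longrightarrow> 0 < slack i y"
  proof (intro allI impI)
    fix i assume i: "a i \<noteq> 0"
    have "y + (e / norm (a i)) *\<^sub>R a i \<in> cball y e" using e i by (simp add: dist_norm)
    then have "0 \<le> slack i (y + (e / norm (a i)) *\<^sub>R a i)" using e feas_iff by blast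
    moreover have "e / norm (a i) * (a i \<bullet> a i) > 0" using e i by (simp add: zero_less_mult_iff)
    ultimately show "0 < slack i y" by (simp add: slack_def inner_add_right)
  qed
next
  assume y: "\<forall>i. a i \<noteq> 0 \<longrightarrow> 0 < slack i y"
  obtain y0 where "y0 \<in> inside" using standing by (auto simp: standing_problem_def)
  then have "\<forall>i. 0 \<le> slack i y0" using interior_subset feas_iff by blast
  then have z: "a i = 0 \<Longrightarrow> 0 \<le> slack i y" for i y
    unfolding slack_def by (metis inner_zero_left)
  let ?U = "\<Inter>i\<in>{i. a i \<noteq> 0}. {y. 0 < slack i y}"
  have "open ?U"
    by (intro open_INT ballI open_Collect_less continuous_intros continuous_slack) auto
  moreover have "?U \<subseteq> feas P" using z by (fastforce simp: feas_iff le_less)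
  ultimately have "?U \<subseteq> inside" by (rule interior_maximal[rotated])
  then show "y \<in> inside" using y by auto
qed

lemma convex_inside: "convex inside"
proof -
  have "convex (feas P)"
  proof (rule convexI)
    fix x y :: "real^'d" and u v :: real
    assume "x \<in> feas P" "y \<in> feas P" "0 \<le> u" "0 \<le> v" and uv: "u + v = 1"
    then have s: "0 \<le> u * slack i x + v * slack i y" for i by (simp add: feas_iff)
    have "slack i (u *\<^sub>R x + v *\<^sub>R y) = u * slack i x + v * slack i y" for i
    proof -
      have "bvec P $ i = u * bvec P $ i + v * bvec P $ i"
        using uv by (metis distrib_right mult_1)
      then show ?thesis by (simp add: slack_def inner_simps algebra_simps)
    qed
    then show "u *\<^sub>R x + v *\<^sub>R y \<in> feas P" using s by (simp add: feas_iff)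
  qed
  then show ?thesis by (rule convex_interior)
qed

lemma open_inside: "open inside" by simp

lemma phi_derivative:
  assumes y: "y \<in> inside"
  shows "(phi P has_derivative (\<lambda>u. u \<bullet> (\<Sum>i\<in>UNIV. (1 / slack i y) *\<^sub>R a i))) (at y)"
proof -
  have "((\<lambda>y. ln (slack i y)) has_derivative (\<lambda>u. - (u \<bullet> ((1 / slack i y) *\<^sub>R a i)))) (at y)" for i
  proof (cases "a i = 0")
    case True
    then have "(\<lambda>y. ln (slack i y)) = (\<lambda>y. ln (bvec P $ i))" by (simp add: slack_def fun_eq_iff)
    then show ?thesis using True by simp
  next
    case False
    then have "0 < slack i y" using y inside_iff by blast
    then have "((\<lambda>y. ln (bvec P $ i - a i \<bullet> y)) has_derivative (\<lambda>u. (0 - a i \<bullet> u) * inverse (slack i y))) (at y)"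
      by (auto intro!: derivative_eq_intros simp: slack_def field_simps)
    then show ?thesis by (simp add: slack_def inner_commute divide_inverse mult.commute)
  qed
  then have "((\<lambda>y. - (\<Sum>i\<in>UNIV. ln (slack i y))) has_derivative
      (\<lambda>u. - (\<Sum>i\<in>UNIV. - (u \<bullet> ((1 / slack i y) *\<^sub>R a i))))) (at y)"
    by (intro has_derivative_minus has_derivative_sum)
  moreover have "(\<lambda>y. - (\<Sum>i\<in>UNIV. ln (slack i y))) = phi P" by (simp add: phi_slack fun_eq_iff)
  ultimately show ?thesis by (simp add: inner_sum_right sum_negf)
qed

lemma grad_phi: "y \<in> inside \<Longrightarrow> grad (phi P) y = (\<Sum>i\<in>UNIV. (1 / slack i y) *\<^sub>R a i)"
  by (rule grad_eqI) (rule phi_derivative)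

lemma grad_phi_derivative_sum:
  assumes y: "y \<in> inside"
  shows "(grad (phi P) has_derivative (\<lambda>u. \<Sum>i\<in>UNIV. ((a i \<bullet> u) / (slack i y)\<^sup>2) *\<^sub>R a i)) (at y)"
proof -
  have "((\<lambda>y. (1 / slack i y) *\<^sub>R a i) has_derivative (\<lambda>u. ((a i \<bullet> u) / (slack i y)\<^sup>2) *\<^sub>R a i)) (at y)" for i
  proof (cases "a i = 0")
    case False
    then have s: "0 < slack i y" using y inside_iff by blast
    have "((\<lambda>y. 1 / (bvec P $ i - a i \<bullet> y)) has_derivative (\<lambda>u. (a i \<bullet> u) / (slack i y)\<^sup>2)) (at y)"
      using s by (auto intro!: derivative_eq_intros simp: slack_def field_simps power2_eq_square)
    then show ?thesis unfolding slack_def by (rule has_derivative_scaleR_left)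
  qed simp
  then have "((\<lambda>y. \<Sum>i\<in>UNIV. (1 / slack i y) *\<^sub>R a i) has_derivative
      (\<lambda>u. \<Sum>i\<in>UNIV. ((a i \<bullet> u) / (slack i y)\<^sup>2) *\<^sub>R a i)) (at y)"
    by (intro has_derivative_sum)
  then show ?thesis
    by (rule has_derivative_transform_within_open[OF _ open_inside y]) (simp add: grad_phi)
qed

lemma hess_phi: "y \<in> inside \<Longrightarrow> Hm y u = (\<Sum>i\<in>UNIV. ((a i \<bullet> u) / (slack i y)\<^sup>2) *\<^sub>R a i)"
  by (simp add: hess_def frechet_derivative_at[OF grad_phi_derivative_sum, symmetric])

lemma grad_phi_derivative: "y \<in> inside \<Longrightarrow> (grad (phi P) has_derivative Hm y) (at y)"
  using grad_phi_derivative_sum[of y] by (simp add: hess_phi[of y, symmetric])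

lemma hess_phi_form: "c \<in> inside \<Longrightarrow> Hm c u \<bullet> u = (\<Sum>i\<in>UNIV. ((a i \<bullet> u) / slack i c)\<^sup>2)"
  by (simp add: hess_phi inner_sum_left power_divide power2_eq_square)

text \<open>Leaving the bounded set \<open>Y\<close> in direction \<open>u\<close> violates some constraint, so the Dikin ellipsoid
  is no longer than \<open>Y\<close> itself.\<close>

lemma norm_le_dikin: "\<exists>t>0. \<forall>c\<in>inside. \<forall>u. (norm u)\<^sup>2 \<le> t\<^sup>2 * (Hm c u \<bullet> u)"
proof -
  obtain B where B: "B > 0" "\<And>y. y \<in> feas P \<Longrightarrow> norm y \<le> B"
    using standing compact_imp_bounded bounded_pos by (metis standing_problem_def)
  define t where "t = 2 * B + 1"
  have t: "t > 0" using B by (simp add: t_def)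
  have "(norm u)\<^sup>2 \<le> t\<^sup>2 * (Hm c u \<bullet> u)" if c: "c \<in> inside" for c u
  proof (cases "u = 0")
    case False
    let ?w = "(t / norm u) *\<^sub>R u"
    have cf: "c \<in> feas P" using c interior_subset by blast
    have "c + ?w \<notin> feas P"
    proof
      assume "c + ?w \<in> feas P"
      then have "norm ?w \<le> 2 * B"
        using B(2)[OF cf] B(2)[of "c + ?w"] norm_triangle_ineq4[of "c + ?w" c] by simp
      then show False using t False B(1) by (simp add: t_def)
    qed
    then obtain i where "slack i (c + ?w) < 0" by (auto simp: feas_iff not_le)
    then have i: "slack i c < a i \<bullet> ?w" unfolding slack_def inner_add_right by linarith
    then have "a i \<noteq> 0" using cf by (auto simp: feas_iff not_le[symmetric])
    then have s: "0 < slack i c" using c inside_iff by blast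
    then have "1 \<le> (a i \<bullet> ?w) / slack i c" using i by (simp only: le_divide_eq_1_pos less_imp_le)
    then have "1 \<le> ((a i \<bullet> ?w) / slack i c)\<^sup>2" by (rule one_le_power)
    also have "\<dots> \<le> (\<Sum>i\<in>UNIV. ((a i \<bullet> ?w) / slack i c)\<^sup>2)"
      by (rule member_le_sum) auto
    also have "\<dots> = (t / norm u)\<^sup>2 * (\<Sum>i\<in>UNIV. ((a i \<bullet> u) / slack i c)\<^sup>2)"
      by (simp add: power_mult_distrib power_divide sum_distrib_left)
    also have "\<dots> = (t / norm u)\<^sup>2 * (Hm c u \<bullet> u)" using c by (simp add: hess_phi_form)
    finally show ?thesis using False by (simp add: power_divide field_simps)
  next
    case True
    then show ?thesis by simp
  qed
  then show ?thesis using t by (intro exI[of _ t]) simp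
qed

lemma spd_Hm:
  assumes c: "c \<in> inside" shows "spd (Hm c)"
  unfolding spd_def
proof (intro conjI allI impI)
  show "linear (Hm c)" using grad_phi_derivative[OF c] by (rule has_derivative_linear)
  show "Hm c u \<bullet> v = u \<bullet> Hm c v" for u v
    using c by (simp add: hess_phi inner_sum_left inner_sum_right inner_commute mult.commute)
  fix u :: "real^'d" assume u: "u \<noteq> 0"
  obtain t where "0 < t" "(norm u)\<^sup>2 \<le> t\<^sup>2 * (Hm c u \<bullet> u)" using norm_le_dikin c by blast
  moreover have "0 < (norm u)\<^sup>2" using u by simp
  ultimately show "0 < Hm c u \<bullet> u" by (metis less_le_trans zero_less_mult_pos zero_less_power)
qed

lemma dnorm_N: "c \<in> inside \<Longrightarrow> dnorm P c = spd.N (Hm c)"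
  by (simp add: dnorm_def spd.N_def[OF spd_Hm] fun_eq_iff)

lemma dual_norm_Nd: "c \<in> inside \<Longrightarrow> dual_norm P c = spd.Nd (Hm c)"
  by (simp add: dual_norm_def spd.Nd_def[OF spd_Hm] fun_eq_iff)

lemma norm_le_dnorm: "\<exists>t>0. \<forall>c\<in>inside. \<forall>u. norm u \<le> t * dnorm P c u"
proof -
  obtain t where t: "0 < t" "\<And>c u. c \<in> inside \<Longrightarrow> (norm u)\<^sup>2 \<le> t\<^sup>2 * (Hm c u \<bullet> u)"
    using norm_le_dikin by blast
  have "norm u \<le> t * dnorm P c u" if c: "c \<in> inside" for c u
  proof -
    have "(norm u)\<^sup>2 \<le> (t * dnorm P c u)\<^sup>2"
      using t(2)[OF c] spd.N_sq[OF spd_Hm[OF c]] by (simp add: power_mult_distrib dnorm_N[OF c])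
    moreover have "0 \<le> t * dnorm P c u"
      using t(1) spd.N_nonneg[OF spd_Hm[OF c]] by (simp add: dnorm_N[OF c])
    ultimately show ?thesis by (rule power2_le_imp_le)
  qed
  then show ?thesis using t(1) by (intro exI[of _ t]) simp
qed

lemma slack_ratio_le_dnorm:
  assumes c: "c \<in> inside"
  shows "\<bar>a i \<bullet> u / slack i c\<bar> \<le> dnorm P c u"
proof -
  have "(a i \<bullet> u / slack i c)\<^sup>2 \<le> (\<Sum>i\<in>UNIV. ((a i \<bullet> u) / slack i c)\<^sup>2)" by (rule member_le_sum) auto
  from real_sqrt_le_mono[OF this] show ?thesis by (simp add: dnorm_def hess_phi_form[OF c])
qed

text \<open>Moving a relative distance \<open>r < 1\<close> in the metric at \<open>c\<close> changes each slack by a factor in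
  \<open>[1 - r, 1 + r]\<close>, hence stays inside and changes the metric by at most the square of that factor.\<close>

lemma dikin_ball:
  assumes c: "c \<in> inside" and r: "dnorm P c (y - c) \<le> r" "r < 1"
  shows "y \<in> inside"
    and "Hm y u \<bullet> u \<le> (1 / (1 - r)\<^sup>2) * (Hm c u \<bullet> u)"
    and "Hm c u \<bullet> u \<le> (1 + r)\<^sup>2 * (Hm y u \<bullet> u)"
proof -
  have r0: "0 \<le> r" using r(1) spd.N_nonneg[OF spd_Hm[OF c]] dnorm_N[OF c] by (metis order_trans)
  have s: "0 < slack i c \<and> (1 - r) * slack i c \<le> slack i y \<and> slack i y \<le> (1 + r) * slack i c \<and> 0 < slack i y"
    if i: "a i \<noteq> 0" for i
  proof -
    have p: "0 < slack i c" using c i inside_iff by blast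
    have "\<bar>a i \<bullet> (y - c) / slack i c\<bar> \<le> r" using slack_ratio_le_dnorm[OF c] r(1) by (metis order_trans)
    then have "\<bar>a i \<bullet> (y - c)\<bar> \<le> r * slack i c" using p by (simp add: field_simps)
    moreover have "slack i y = slack i c - a i \<bullet> (y - c)" by (simp add: slack_def inner_diff_right)
    moreover have "0 < (1 - r) * slack i c" using p r by simp
    ultimately show ?thesis using p unfolding abs_le_iff left_diff_distrib distrib_right by linarith
  qed
  show y: "y \<in> inside" unfolding inside_iff using s by simp
  show "Hm y u \<bullet> u \<le> (1 / (1 - r)\<^sup>2) * (Hm c u \<bullet> u)"
    unfolding hess_phi_form[OF c] hess_phi_form[OF y] sum_distrib_left
  proof (rule sum_mono)
    fix i :: 'm
    show "(a i \<bullet> u / slack i y)\<^sup>2 \<le> 1 / (1 - r)\<^sup>2 * (a i \<bullet> u / slack i c)\<^sup>2"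
    proof (cases "a i = 0")
      case False
      then have "(a i \<bullet> u)\<^sup>2 / (slack i y)\<^sup>2 \<le> (a i \<bullet> u)\<^sup>2 / ((1 - r) * slack i c)\<^sup>2"
        using s[OF False] r by (intro divide_left_mono power_mono mult_pos_pos zero_less_power) simp_all
      then show ?thesis by (simp add: power_divide power_mult_distrib)
    qed simp
  qed
  show "Hm c u \<bullet> u \<le> (1 + r)\<^sup>2 * (Hm y u \<bullet> u)"
    unfolding hess_phi_form[OF c] hess_phi_form[OF y] sum_distrib_left
  proof (rule sum_mono)
    fix i :: 'm
    show "(a i \<bullet> u / slack i c)\<^sup>2 \<le> (1 + r)\<^sup>2 * (a i \<bullet> u / slack i y)\<^sup>2"
    proof (cases "a i = 0")
      case False
      have "(a i \<bullet> u)\<^sup>2 * (slack i y)\<^sup>2 \<le> (a i \<bullet> u)\<^sup>2 * ((1 + r) * slack i c)\<^sup>2"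
        using s[OF False] r r0 by (intro mult_left_mono power_mono) simp_all
      then show ?thesis using s[OF False] by (simp add: power_divide power_mult_distrib divide_le_eq le_divide_eq mult_ac)
    qed simp
  qed
qed

lemma dnorm_change_centre:
  assumes c: "c \<in> inside" and r: "dnorm P c (y - c) \<le> r" "r < 1"
  shows "dnorm P y u \<le> dnorm P c u / (1 - r)" and "dnorm P c u \<le> (1 + r) * dnorm P y u"
proof -
  have r0: "0 \<le> r" using r(1) spd.N_nonneg[OF spd_Hm[OF c]] dnorm_N[OF c] by (metis order_trans)
  have "dnorm P y u \<le> sqrt ((1 / (1 - r)\<^sup>2) * (Hm c u \<bullet> u))"
    unfolding dnorm_def using dikin_ball(2)[OF assms] by (rule real_sqrt_le_mono)
  also have "\<dots> = dnorm P c u / (1 - r)" using r by (simp add: dnorm_def real_sqrt_divide)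
  finally show "dnorm P y u \<le> dnorm P c u / (1 - r)" .
  have "dnorm P c u \<le> sqrt ((1 + r)\<^sup>2 * (Hm y u \<bullet> u))"
    unfolding dnorm_def using dikin_ball(3)[OF assms] by (rule real_sqrt_le_mono)
  also have "\<dots> = (1 + r) * dnorm P y u" using r0 by (simp add: dnorm_def real_sqrt_mult)
  finally show "dnorm P c u \<le> (1 + r) * dnorm P y u" .
qed

lemma dikin_tube_iff:
  assumes "c \<in> inside" "r < 1"
  shows "y \<in> dikin_tube P r c \<longleftrightarrow> dnorm P c (y - c) \<le> r"
  using dikin_ball(1)[OF assms(1) _ assms(2)] by (auto simp: dikin_tube_def)

text \<open>Row by row, \<open>(1/s - 1/s') (s' - s) = (s' - s)\<^sup>2 / (s s')\<close> for the slacks \<open>s\<close> at \<open>c\<close> and \<open>s'\<close> at \<open>y\<close>,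
  and \<open>s' \<le> (1 + r) s\<close>.\<close>

lemma grad_phi_monotone:
  assumes c: "c \<in> inside" and y: "y \<in> inside"
  defines "r \<equiv> dnorm P c (c - y)"
  shows "r\<^sup>2 / (1 + r) \<le> (grad (phi P) c - grad (phi P) y) \<bullet> (c - y)"
proof -
  have r0: "0 \<le> r" using spd.N_nonneg[OF spd_Hm[OF c]] dnorm_N[OF c] by (simp add: r_def)
  have "r\<^sup>2 / (1 + r) = (\<Sum>i\<in>UNIV. (a i \<bullet> (c - y) / slack i c)\<^sup>2 / (1 + r))"
    unfolding r_def dnorm_N[OF c] spd.N_sq[OF spd_Hm[OF c]] hess_phi_form[OF c] by (simp add: sum_divide_distrib)
  also have "\<dots> \<le> (\<Sum>i\<in>UNIV. (1 / slack i c - 1 / slack i y) * (a i \<bullet> (c - y)))"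
  proof (rule sum_mono)
    fix i :: 'm
    show "(a i \<bullet> (c - y) / slack i c)\<^sup>2 / (1 + r) \<le> (1 / slack i c - 1 / slack i y) * (a i \<bullet> (c - y))"
    proof (cases "a i = 0")
      case False
      then have p: "0 < slack i c" "0 < slack i y" using c y inside_iff by blast+
      have e: "slack i y = slack i c + a i \<bullet> (c - y)" by (simp add: slack_def inner_diff_right)
      have "\<bar>a i \<bullet> (c - y) / slack i c\<bar> \<le> r" unfolding r_def by (rule slack_ratio_le_dnorm[OF c])
      then have "a i \<bullet> (c - y) \<le> r * slack i c" using p by (simp add: field_simps abs_le_iff)
      then have l: "slack i y \<le> (1 + r) * slack i c" using e by (simp add: algebra_simps)
      have "(a i \<bullet> (c - y) / slack i c)\<^sup>2 / (1 + r) = (a i \<bullet> (c - y))\<^sup>2 / (slack i c * ((1 + r) * slack i c))"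
        by (simp add: power_divide power2_eq_square)
      also have "\<dots> \<le> (a i \<bullet> (c - y))\<^sup>2 / (slack i c * slack i y)"
        using l p r0 by (intro divide_left_mono mult_left_mono mult_pos_pos) auto
      also have "\<dots> = (1 / slack i c - 1 / slack i y) * (a i \<bullet> (c - y))"
      proof -
        have "1 / slack i c - 1 / slack i y = (a i \<bullet> (c - y)) / (slack i c * slack i y)"
          using p e by (simp add: field_simps)
        then show ?thesis by (simp add: power2_eq_square)
      qed
      finally show ?thesis .
    qed simp
  qed
  also have "\<dots> = (grad (phi P) c - grad (phi P) y) \<bullet> (c - y)"
    by (simp add: grad_phi c y inner_diff_left inner_sum_left left_diff_distrib sum_subtractf)
  finally show ?thesis .
qed

section \<open>The barrier objective and its minimiser\<close>

lemma psi_eq: "psi P (x, y) = lower P (x, y) + mu P * phi P y" by (simp add: psi_def)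

lemma psi_derivative:
  assumes "y \<in> inside"
  shows "((\<lambda>y. psi P (x, y)) has_derivative (\<lambda>u. u \<bullet> (grad_y (lower P) x y + mu P *\<^sub>R grad (phi P) y))) (at y)"
proof -
  have "((\<lambda>y. lower P (x, y) + mu P * phi P y) has_derivative
      (\<lambda>u. u \<bullet> snd (grad (lower P) (x, y)) + mu P * (u \<bullet> (\<Sum>i\<in>UNIV. (1 / slack i y) *\<^sub>R a i)))) (at y)"
    by (intro has_derivative_add has_derivative_grad_y has_derivative_mult_right phi_derivative C2_lower assms)
  then show ?thesis
    by (simp add: psi_def grad_y_snd[OF C2_lower] grad_phi[OF assms] inner_simps)
qed

lemma grad_y_psi: "y \<in> inside \<Longrightarrow> grad_y (psi P) x y = grad_y (lower P) x y + mu P *\<^sub>R grad (phi P) y"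
  unfolding grad_y_def[of "psi P"] by (rule grad_eqI) (rule psi_derivative)

lemma has_derivative_grad_y_psi_comp:
  assumes d: "(d has_derivative d') (at x)" and i: "d x \<in> inside"
  shows "((\<lambda>x. grad_y (lower P) x (d x) + mu P *\<^sub>R grad (phi P) (d x)) has_derivative
    (\<lambda>u. hess_xy (lower P) x (d x) u + (hess_yy (lower P) x (d x) (d' u) + mu P *\<^sub>R Hm (d x) (d' u)))) (at x)"
proof -
  have "((\<lambda>x. grad (phi P) (d x)) has_derivative (\<lambda>u. Hm (d x) (d' u))) (at x)"
    by (rule has_derivative_compose[OF d grad_phi_derivative[OF i]])
  then have "((\<lambda>x. grad_y (lower P) x (d x) + mu P *\<^sub>R grad (phi P) (d x)) has_derivative
    (\<lambda>u. (hess_xy (lower P) x (d x) u + hess_yy (lower P) x (d x) (d' u)) + mu P *\<^sub>R Hm (d x) (d' u))) (at x)"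
    by (intro has_derivative_add has_derivative_scaleR_right has_derivative_grad_y_comp C2_lower d)
  then show ?thesis by (simp add: add.assoc)
qed

lemma psi_yy_derivative_expl:
  assumes y: "y \<in> inside"
  shows "((\<lambda>y. grad_y (psi P) x y) has_derivative (\<lambda>u. hess_yy (lower P) x y u + mu P *\<^sub>R Hm y u)) (at y)"
proof -
  have "((\<lambda>y. grad_y (lower P) x y + mu P *\<^sub>R grad (phi P) y) has_derivative
    (\<lambda>u. hess_yy (lower P) x y u + mu P *\<^sub>R Hm y u)) (at y)"
    by (intro has_derivative_add has_derivative_scaleR_right has_derivative_hess_yy C2_lower grad_phi_derivative y)
  then show ?thesis
    by (rule has_derivative_transform_within_open[OF _ open_inside y]) (simp add: grad_y_psi)
qed

lemma hess_yy_psi: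
  "y \<in> inside \<Longrightarrow> hess_yy (psi P) x y u = hess_yy (lower P) x y u + mu P *\<^sub>R Hm y u"
  by (simp add: hess_yy_def[of "psi P"] frechet_derivative_at[OF psi_yy_derivative_expl, symmetric])

lemma psi_yy_derivative:
  "y \<in> inside \<Longrightarrow> ((\<lambda>y. grad_y (psi P) x y) has_derivative hess_yy (psi P) x y) (at y)"
  using psi_yy_derivative_expl[of y x] by (simp add: hess_yy_psi[of y x, symmetric])

lemma hess_xy_psi:
  assumes y: "y \<in> inside" shows "hess_xy (psi P) x y = hess_xy (lower P) x y"
proof -
  have "((\<lambda>x. grad_y (lower P) x y + mu P *\<^sub>R grad (phi P) y) has_derivative hess_xy (lower P) x y) (at x)"
    using has_derivative_add[OF has_derivative_hess_xy[OF C2_lower] has_derivative_const] by simp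
  then have "((\<lambda>x. grad_y (psi P) x y) has_derivative hess_xy (lower P) x y) (at x)"
    by (simp add: grad_y_psi y)
  then show ?thesis unfolding hess_xy_def[of "psi P"] by (simp add: frechet_derivative_at[symmetric])
qed

lemma linear_hess_yy_psi: "y \<in> inside \<Longrightarrow> linear (hess_yy (psi P) x y)"
  using psi_yy_derivative by (rule has_derivative_linear)

lemma linear_hess_xy_psi: "y \<in> inside \<Longrightarrow> linear (hess_xy (psi P) x y)"
  by (simp add: hess_xy_psi linear_hess_xy[OF C2_lower])

lemma hess_yy_psi_symmetric:
  "y \<in> inside \<Longrightarrow> hess_yy (psi P) x y u \<bullet> v = u \<bullet> hess_yy (psi P) x y v"
  by (simp add: hess_yy_psi hess_yy_symmetric[OF C2_lower] spd.sym[OF spd_Hm] inner_simps)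

text \<open>The barrier exceeds any level near the boundary, so a minimiser over the compact set of points
  with slacks at least \<open>t\<close> is global once \<open>t\<close> is small.\<close>

lemma psi_minimiser_exists: "\<exists>c\<in>inside. \<forall>y\<in>inside. psi P (x, c) \<le> psi P (x, y)"
proof -
  obtain y0 where y0: "y0 \<in> inside" using standing by (auto simp: standing_problem_def)
  have cY: "compact (feas P)" using standing by (simp add: standing_problem_def)
  have "\<exists>B. \<forall>y\<in>feas P. \<forall>i. slack i y \<le> B"
  proof -
    have bdd: "bdd_above (slack i ` feas P)" for i
      using compact_imp_bounded[OF compact_continuous_image[OF continuous_slack cY]]
      by (rule bounded_imp_bdd_above)
    define B where "B i = (SUP y\<in>feas P. slack i y)" for i
    have B: "slack i y \<le> B i" if "y \<in> feas P" for i y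
      unfolding B_def using cSUP_upper[OF that, of "slack i"] bdd by simp
    have "slack i y \<le> (\<Sum>i\<in>UNIV. \<bar>B i\<bar>)" if "y \<in> feas P" for i y
      using B[OF that, of i] member_le_sum[of i UNIV "\<lambda>i. \<bar>B i\<bar>"] by force
    then show ?thesis by blast
  qed
  then obtain B0 where B0: "\<And>y i. y \<in> feas P \<Longrightarrow> slack i y \<le> B0" by blast
  define B where "B = max 1 B0"
  have B: "1 \<le> B" "\<And>y i. y \<in> feas P \<Longrightarrow> slack i y \<le> B" using B0 by (auto simp: B_def intro: max.coboundedI2)
  have cg: "continuous_on UNIV (\<lambda>y. lower P (x, y))"
    using has_derivative_continuous[OF has_derivative_grad_y[OF C2_lower]]
    by (intro continuous_at_imp_continuous_on) simp
  obtain m where m: "\<And>y. y \<in> feas P \<Longrightarrow> m \<le> lower P (x, y)"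
  proof -
    have "bdd_below ((\<lambda>y. lower P (x, y)) ` feas P)"
      by (intro bounded_imp_bdd_below compact_imp_bounded compact_continuous_image cY continuous_on_subset[OF cg])
        simp
    then show ?thesis using that by (auto simp: bdd_below_def)
  qed
  \<comment> \<open>if one slack is below \<open>exp (- L)\<close>, its barrier term outweighs all other terms of the objective\<close>
  define lnB where "lnB = (\<Sum>i\<in>(UNIV::'m set). \<bar>ln B\<bar> + \<bar>ln (slack i y0)\<bar>)"
  define L where "L = (psi P (x, y0) - m) / mu P + lnB"
  define t where "t = min (exp (- L)) (Min (insert 1 ((\<lambda>i. slack i y0) ` {i. a i \<noteq> 0})))"
  have t0: "0 < t" using y0 by (auto simp: t_def inside_iff)
  define K where "K = {y \<in> feas P. \<forall>i. a i \<noteq> 0 \<longrightarrow> t \<le> slack i y}"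
  have "K = feas P \<inter> (\<Inter>i\<in>{i. a i \<noteq> 0}. {y. t \<le> slack i y})" by (auto simp: K_def)
  then have cK: "compact K"
    by (simp add: cY compact_Int_closed closed_INT closed_Collect_le continuous_slack)
  have KI: "K \<subseteq> inside" using t0 by (force simp: K_def inside_iff)
  have y0K: "y0 \<in> K"
  proof -
    have "t \<le> slack i y0" if "a i \<noteq> 0" for i
    proof -
      have "Min (insert 1 ((\<lambda>i. slack i y0) ` {i. a i \<noteq> 0})) \<le> slack i y0"
        using that by (intro Min_le) auto
      then show ?thesis by (simp add: t_def)
    qed
    then show ?thesis using y0 interior_subset by (auto simp: K_def)
  qed
  have "continuous_on K (\<lambda>y. psi P (x, y))"
    using has_derivative_continuous[OF psi_derivative] KI
    by (intro continuous_at_imp_continuous_on) blast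
  then obtain c where c: "c \<in> K" "\<And>y. y \<in> K \<Longrightarrow> psi P (x, c) \<le> psi P (x, y)"
    using continuous_attains_inf[OF cK] y0K by (metis empty_iff)
  have "psi P (x, y0) \<le> psi P (x, y)" if y: "y \<in> inside" "y \<notin> K" for y
  proof -
    have yf: "y \<in> feas P" using y interior_subset by blast
    then obtain j where j: "a j \<noteq> 0" "slack j y < t" using y by (auto simp: K_def not_le)
    have bound: "ln (slack i y) \<le> \<bar>ln B\<bar> + \<bar>ln (slack i y0)\<bar>" for i
    proof (cases "a i = 0")
      case True
      then have "slack i y = slack i y0" by (simp add: slack_def)
      then show ?thesis by simp
    next
      case False
      then have "0 < slack i y" using y inside_iff by blast
      then have "ln (slack i y) \<le> ln B" using B(2)[OF yf] B(1) by simp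
      then show ?thesis by linarith
    qed
    have pj: "0 < slack j y" using y j inside_iff by blast
    have "slack j y \<le> exp (- L)" using j by (simp add: t_def)
    then have "ln (slack j y) \<le> - L" using pj by (metis ln_exp ln_mono)
    moreover have "(\<Sum>i\<in>UNIV. ln (slack i y)) = ln (slack j y) + (\<Sum>i\<in>UNIV - {j}. ln (slack i y))"
      by (rule sum.remove) auto
    moreover have "(\<Sum>i\<in>UNIV - {j}. ln (slack i y)) \<le> (\<Sum>i\<in>UNIV - {j}. \<bar>ln B\<bar> + \<bar>ln (slack i y0)\<bar>)"
      using bound by (intro sum_mono)
    ultimately have "(\<Sum>i\<in>UNIV. ln (slack i y)) \<le> - L + (\<Sum>i\<in>UNIV - {j}. \<bar>ln B\<bar> + \<bar>ln (slack i y0)\<bar>)"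
      by linarith
    also have "\<dots> \<le> - L + lnB"
      unfolding lnB_def by (intro add_left_mono sum_mono2) auto
    finally have "(psi P (x, y0) - m) / mu P \<le> phi P y" by (simp add: phi_slack L_def)
    then have "psi P (x, y0) - m \<le> mu P * phi P y" using mu_pos by (simp add: field_simps)
    then show ?thesis using m[OF yf] by (simp add: psi_eq)
  qed
  then have "psi P (x, c) \<le> psi P (x, y)" if "y \<in> inside" for y
    using c(2)[of y] c(2)[OF y0K] that by (cases "y \<in> K") (auto intro: order_trans)
  then show ?thesis using c(1) KI by blast
qed

lemma ystar_inside: "ystar P x \<in> inside"
  and ystar_min: "y \<in> inside \<Longrightarrow> psi P (x, ystar P x) \<le> psi P (x, y)"
proof -
  obtain c where c: "c \<in> inside" "\<And>y. y \<in> inside \<Longrightarrow> psi P (x, c) \<le> psi P (x, y)"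
    using psi_minimiser_exists by blast
  have "is_arg_min (\<lambda>y. psi P (x, y)) (\<lambda>y. y \<in> inside) (ystar P x)"
    unfolding ystar_def arg_min_on_def arg_min_def
    by (rule someI[of _ c]) (use c in \<open>auto simp: is_arg_min_def not_less\<close>)
  then show "ystar P x \<in> inside" and "y \<in> inside \<Longrightarrow> psi P (x, ystar P x) \<le> psi P (x, y)"
    by (auto simp: is_arg_min_def not_less)
qed

lemma interior_minimum_grad:
  assumes "c \<in> inside" "\<And>y. y \<in> inside \<Longrightarrow> h c \<le> h y" "(h has_derivative (\<lambda>u. u \<bullet> D)) (at c)"
  shows "D = (0 :: real^'d)"
proof -
  have "(\<lambda>u. u \<bullet> D) = (\<lambda>u. 0)"
  proof (rule has_derivative_local_min[OF assms(3)])
    show "\<forall>\<^sub>F y in at c. h c \<le> h y"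
      unfolding eventually_at_topological using assms(1,2) open_inside by blast
  qed
  then have "D \<bullet> D = 0" by (rule fun_cong)
  then show ?thesis by simp
qed

lemma grad_y_psi_ystar: "grad_y (psi P) x (ystar P x) = 0"
  using interior_minimum_grad[OF ystar_inside ystar_min psi_derivative[OF ystar_inside]]
  by (simp add: grad_y_psi[OF ystar_inside])

end

context barrier
begin

lemma dnorm_nonneg: "c \<in> inside \<Longrightarrow> 0 \<le> dnorm P c u"
  by (simp add: dnorm_N spd.N_nonneg[OF spd_Hm])

lemma dual_norm_nonneg: "c \<in> inside \<Longrightarrow> 0 \<le> dual_norm P c u"
  by (simp add: dual_norm_Nd spd.Nd_nonneg[OF spd_Hm])

lemma dnorm_scale: "c \<in> inside \<Longrightarrow> dnorm P c (r *\<^sub>R u) = \<bar>r\<bar> * dnorm P c u"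
  by (simp add: dnorm_N spd.N_scale[OF spd_Hm])

lemma dnorm_minus: "c \<in> inside \<Longrightarrow> dnorm P c (- u) = dnorm P c u"
  by (simp add: dnorm_N spd.N_minus[OF spd_Hm])

lemma dnorm_minus_commute: "c \<in> inside \<Longrightarrow> dnorm P c (u - v) = dnorm P c (v - u)"
  using dnorm_minus[of c "u - v"] by simp

lemma dnorm_triangle: "c \<in> inside \<Longrightarrow> dnorm P c (u + v) \<le> dnorm P c u + dnorm P c v"
  by (simp add: dnorm_N spd.N_tri[OF spd_Hm])

lemma dnorm_triangle_diff: "c \<in> inside \<Longrightarrow> dnorm P c (u - v) \<le> dnorm P c u + dnorm P c v"
  by (simp add: dnorm_N spd.N_diff[OF spd_Hm])

lemma dnorm_zero: "c \<in> inside \<Longrightarrow> dnorm P c 0 = 0"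
  by (simp add: dnorm_N spd.N_eq0[OF spd_Hm])

lemma dnorm_sq: "c \<in> inside \<Longrightarrow> (dnorm P c u)\<^sup>2 = Hm c u \<bullet> u"
  by (simp add: dnorm_N spd.N_sq[OF spd_Hm])

lemma dual_norm_scale: "c \<in> inside \<Longrightarrow> dual_norm P c (r *\<^sub>R u) = \<bar>r\<bar> * dual_norm P c u"
  by (simp add: dual_norm_Nd spd.Nd_scale[OF spd_Hm])

lemma dual_norm_triangle: "c \<in> inside \<Longrightarrow> dual_norm P c (u + v) \<le> dual_norm P c u + dual_norm P c v"
  by (simp add: dual_norm_Nd spd.Nd_tri[OF spd_Hm])

lemma dual_norm_triangle_diff: "c \<in> inside \<Longrightarrow> dual_norm P c (u - v) \<le> dual_norm P c u + dual_norm P c v"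
  by (simp add: dual_norm_Nd spd.Nd_diff[OF spd_Hm])

lemma dual_pairing: "c \<in> inside \<Longrightarrow> \<bar>w \<bullet> u\<bar> \<le> dual_norm P c w * dnorm P c u"
  by (simp add: dnorm_N dual_norm_Nd spd.dual_cauchy[OF spd_Hm])

lemma dikin_cauchy: "c \<in> inside \<Longrightarrow> \<bar>Hm c u \<bullet> v\<bar> \<le> dnorm P c u * dnorm P c v"
  by (simp add: dnorm_N spd.cauchy[OF spd_Hm])

lemma dnorm_leI: "c \<in> inside \<Longrightarrow> (\<And>v. u \<bullet> Hm c v \<le> k * dnorm P c v) \<Longrightarrow> dnorm P c u \<le> k"
  using spd.N_leI[OF spd_Hm, of c u k] by (simp add: dnorm_N spd.sym[OF spd_Hm])

lemma dikin_tube_segment: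
  assumes c: "c \<in> inside" and y: "y \<in> dikin_tube P r c" and z: "z \<in> dikin_tube P r c"
    and t: "0 \<le> t" "t \<le> 1"
  shows "y + t *\<^sub>R (z - y) \<in> dikin_tube P r c"
proof -
  have e: "y + t *\<^sub>R (z - y) = (1 - t) *\<^sub>R y + t *\<^sub>R z" by (simp add: algebra_simps)
  have "y + t *\<^sub>R (z - y) \<in> inside"
    unfolding e using convex_inside y z t by (auto simp: dikin_tube_def convex_alt)
  moreover have "dnorm P c (y + t *\<^sub>R (z - y) - c) \<le> r"
  proof -
    have "y + t *\<^sub>R (z - y) - c = (1 - t) *\<^sub>R (y - c) + t *\<^sub>R (z - c)" by (simp add: algebra_simps)
    then have "dnorm P c (y + t *\<^sub>R (z - y) - c) \<le> (1 - t) * dnorm P c (y - c) + t * dnorm P c (z - c)"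
      using dnorm_triangle[OF c, of "(1 - t) *\<^sub>R (y - c)" "t *\<^sub>R (z - c)"] t by (simp add: dnorm_scale[OF c])
    also have "\<dots> \<le> (1 - t) * r + t * r"
      using y z t by (intro add_mono mult_left_mono) (auto simp: dikin_tube_def)
    finally show ?thesis by (simp add: algebra_simps)
  qed
  ultimately show ?thesis by (simp add: dikin_tube_def)
qed

lemma centre_in_tube: "c \<in> inside \<Longrightarrow> 0 \<le> r \<Longrightarrow> c \<in> dikin_tube P r c"
  by (simp add: dikin_tube_def dnorm_zero)

text \<open>Finite dimension provides the boundedness that turns a bound on an operator norm, a supremum of
  reals, into a bound at every vector.\<close>

lemma dual_norm_linear_bound:
  fixes M :: "'k::euclidean_space \<Rightarrow> real^'d"
  assumes c: "c \<in> inside" and M: "linear M"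
  shows "\<exists>B. \<forall>u. dual_norm P c (M u) \<le> B * norm u"
proof -
  obtain K where K: "0 \<le> K" "\<And>w. spd.N (inv (Hm c)) w \<le> K * norm w"
    using spd.N_le_scaled_norm[OF spd.spd_inv[OF spd_Hm[OF c]]] by blast
  obtain B where B: "\<And>u. norm (M u) \<le> B * norm u" using linear_bounded[OF M] by blast
  have "dual_norm P c (M u) \<le> (K * B) * norm u" for u
  proof -
    have "dual_norm P c (M u) \<le> K * norm (M u)"
      using K(2)[of "M u"] by (simp add: dual_norm_def spd.N_def[OF spd.spd_inv[OF spd_Hm[OF c]]])
    also have "\<dots> \<le> K * (B * norm u)" using B K(1) by (intro mult_left_mono)
    finally show ?thesis by (simp add: mult.assoc)
  qed
  then show ?thesis by blast
qed

lemma op_norm_2_dual: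
  fixes M :: "'k::euclidean_space \<Rightarrow> real^'d"
  assumes c: "c \<in> inside" and M: "linear M" and K: "op_norm norm (dual_norm P c) M \<le> K"
  shows "dual_norm P c (M u) \<le> K * norm u"
proof -
  obtain B where B: "\<And>u. dual_norm P c (M u) \<le> B * norm u" using dual_norm_linear_bound[OF c M] by blast
  show ?thesis by (rule op_norm_bound[OF K M B]) (simp_all add: dual_norm_scale[OF c])
qed

lemma op_norm_dikin_dual:
  assumes c: "c \<in> inside" and M: "linear M" and K: "op_norm (dnorm P c) (dual_norm P c) M \<le> K"
  shows "dual_norm P c (M u) \<le> K * dnorm P c u"
proof -
  obtain B where B: "\<And>u. dual_norm P c (M u) \<le> B * norm u" using dual_norm_linear_bound[OF c M] by blast
  obtain t where t: "0 < t" "\<And>u. norm u \<le> t * dnorm P c u" using norm_le_dnorm c by auto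
  have "dual_norm P c (M u) \<le> (\<bar>B\<bar> * t) * dnorm P c u" for u
  proof -
    have "dual_norm P c (M u) \<le> \<bar>B\<bar> * norm u" using B[of u] by (smt (verit) mult_right_mono norm_ge_zero)
    also have "\<dots> \<le> \<bar>B\<bar> * (t * dnorm P c u)" using t by (intro mult_left_mono) auto
    finally show ?thesis by (simp add: mult.assoc)
  qed
  then show ?thesis
    by (rule op_norm_bound[OF K M]) (simp_all add: dual_norm_scale[OF c] dnorm_scale[OF c] dnorm_nonneg[OF c])
qed

lemma op_norm_2_dikin:
  fixes M :: "'k::euclidean_space \<Rightarrow> real^'d"
  assumes c: "c \<in> inside" and M: "linear M" and K: "op_norm norm (dnorm P c) M \<le> K"
  shows "dnorm P c (M u) \<le> K * norm u"
proof -
  obtain k where k: "0 \<le> k" "\<And>w. dnorm P c w \<le> k * norm w"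
    using spd.N_le_scaled_norm[OF spd_Hm[OF c]] by (auto simp: dnorm_N[OF c])
  obtain B where B: "\<And>u. norm (M u) \<le> B * norm u" using linear_bounded[OF M] by blast
  have "dnorm P c (M u) \<le> (k * B) * norm u" for u
  proof -
    have "dnorm P c (M u) \<le> k * norm (M u)" by (rule k(2))
    also have "\<dots> \<le> k * (B * norm u)" using B k(1) by (intro mult_left_mono)
    finally show ?thesis by (simp add: mult.assoc)
  qed
  then show ?thesis by (rule op_norm_bound[OF K M]) (simp_all add: dnorm_scale[OF c])
qed

end

section \<open>Local constants and contraction of the inner loops\<close>

locale dikin_problem = barrier P R
  for P :: "('n::finite, 'd::finite, 'm::finite) bilevel" and R :: reg_consts +
  fixes yl :: "real \<Rightarrow> real^'n \<Rightarrow> real^'d" and C :: dikin_consts and \<eta> lam0 :: real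
  assumes proxy: "proxy_selection P yl"
    and constants: "local_dikin_constants P yl C \<eta> lam0"
    and radius: "radius_condition C \<eta> lam0"
    and lam0_ge: "lam_eta C \<le> lam0"
    and lam0_f1: "2 * d_f1 C / rho_psi C \<le> lam0"
begin

abbreviation \<rho> :: real where "\<rho> \<equiv> rho_psi C"
abbreviation \<l> :: real where "\<l> \<equiv> l_psi1 C"
abbreviation ys :: "real^'n \<Rightarrow> real^'d" where "ys \<equiv> ystar P"

definition \<theta> :: real where "\<theta> = 1 / (1 - \<eta>)\<^sup>2 - 1"

text \<open>The exact and the proxy centre satisfy the same bounds; most estimates are proved for both at
  once through this predicate.\<close>

definition centre :: "real^'n \<Rightarrow> real^'d \<Rightarrow> bool" where
  "centre x c \<longleftrightarrow> c \<in> inside \<and> local_bounds P C x c (dikin_tube P (2 * \<eta>) c)"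

lemma rho_pos: "0 < \<rho>" and lam0_pos: "0 < lam0"
  using constants lam0_ge by (auto simp: local_dikin_constants_def)

lemma eta_pos: "0 < \<eta>" and eta_half: "\<eta> < 1/2"
  using radius by (auto simp: radius_condition_def)

lemma yl_arg_min: "0 < lam \<Longrightarrow> is_arg_min (Lag P lam x) (\<lambda>y. y \<in> inside) (yl lam x)"
  using proxy by (simp add: proxy_selection_def)

lemma yl_inside: "0 < lam \<Longrightarrow> yl lam x \<in> inside"
  using yl_arg_min by (auto simp: is_arg_min_def)

lemma centre_ys: "centre x (ys x)"
  using constants by (simp add: centre_def ystar_inside local_dikin_constants_def)

lemma centre_yl: "lam0 \<le> lam \<Longrightarrow> centre x (yl lam x)"
  using constants lam0_ge lam0_pos by (simp add: centre_def yl_inside local_dikin_constants_def)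

context
  fixes x c y assumes c: "centre x c" and y: "y \<in> dikin_tube P (2 * \<eta>) c"
begin

private lemma inside: "c \<in> inside" "y \<in> inside"
  using c y by (auto simp: centre_def dikin_tube_def)

private lemma lb: "local_bounds P C x c (dikin_tube P (2 * \<eta>) c)" using c by (simp add: centre_def)

lemma psi_yy_lower: "\<rho> * (Hm c u \<bullet> u) \<le> hess_yy (psi P) x y u \<bullet> u"
  and psi_yy_upper: "hess_yy (psi P) x y u \<bullet> u \<le> \<l> * (Hm c u \<bullet> u)"
  using lb y by (auto simp: local_bounds_def loewner_le_def)

lemma psi_xy_bound: "dual_norm P c (hess_xy (psi P) x y u) \<le> \<l> * norm u"
  using lb y by (intro op_norm_2_dual inside linear_hess_xy_psi) (auto simp: local_bounds_def)

lemma f_y_bound: "dual_norm P c (grad_y (upper P) x y) \<le> d_f0 C"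
  using lb y by (auto simp: local_bounds_def)

lemma f_xy_bound: "dual_norm P c (hess_xy (upper P) x y u) \<le> d_f1 C * norm u"
  using lb y by (intro op_norm_2_dual inside linear_hess_xy C2_upper) (auto simp: local_bounds_def)

lemma f_yy_bound: "dual_norm P c (hess_yy (upper P) x y u) \<le> d_f1 C * dnorm P c u"
  using lb y by (intro op_norm_dikin_dual inside linear_hess_yy C2_upper) (auto simp: local_bounds_def)

lemma f_yy_form: "\<bar>hess_yy (upper P) x y u \<bullet> u\<bar> \<le> d_f1 C * (Hm c u \<bullet> u)"
proof -
  have "\<bar>hess_yy (upper P) x y u \<bullet> u\<bar> \<le> dual_norm P c (hess_yy (upper P) x y u) * dnorm P c u"
    by (rule dual_pairing[OF inside(1)])
  also have "\<dots> \<le> (d_f1 C * dnorm P c u) * dnorm P c u"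
    by (intro mult_right_mono f_yy_bound dnorm_nonneg inside)
  finally show ?thesis by (simp add: dnorm_sq[OF inside(1), of u, symmetric] power2_eq_square mult.assoc)
qed

lemma d_f0_nonneg_at: "0 \<le> d_f0 C"
  using f_y_bound dual_norm_nonneg[OF inside(1)] by (meson order_trans)

lemma psi_yy_diff:
  assumes y2: "y2 \<in> dikin_tube P (2 * \<eta>) c"
  shows "dual_norm P c (hess_yy (psi P) x y u - hess_yy (psi P) x y2 u)
    \<le> l_psi2 C * dnorm P c (y - y2) * dnorm P c u"
proof -
  have "y2 \<in> inside" using y2 by (simp add: dikin_tube_def)
  then have "linear (\<lambda>u. hess_yy (psi P) x y u - hess_yy (psi P) x y2 u)"
    by (intro linear_compose_sub linear_hess_yy_psi inside)
  then show ?thesis using lb y y2 by (intro op_norm_dikin_dual inside) (auto simp: local_bounds_def)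
qed

lemma psi_xy_diff:
  assumes y2: "y2 \<in> dikin_tube P (2 * \<eta>) c"
  shows "dual_norm P c (hess_xy (psi P) x y u - hess_xy (psi P) x y2 u)
    \<le> l_psi2 C * dnorm P c (y - y2) * norm u"
proof -
  have "y2 \<in> inside" using y2 by (simp add: dikin_tube_def)
  then have "linear (\<lambda>u. hess_xy (psi P) x y u - hess_xy (psi P) x y2 u)"
    by (intro linear_compose_sub linear_hess_xy_psi inside)
  then show ?thesis using lb y y2 by (intro op_norm_2_dual inside) (auto simp: local_bounds_def)
qed

text \<open>The \<open>x\<close>-gradients vary in \<open>y\<close> at the rate of the mixed Hessian, by symmetry of second
  derivatives.\<close>

lemma grad_x_lipschitz_of_mixed_hessian:
  assumes h: "C2 h" and y2: "y2 \<in> dikin_tube P (2 * \<eta>) c"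
    and k: "\<And>w u. w \<in> dikin_tube P (2 * \<eta>) c \<Longrightarrow> dual_norm P c (hess_xy h x w u) \<le> k * norm u"
  shows "norm (grad_x h x y2 - grad_x h x y) \<le> k * dnorm P c (y2 - y)"
proof -
  let ?d = "grad_x h x y2 - grad_x h x y"
  obtain t where t: "0 < t" "t < 1"
    "grad_x h x (y + (y2 - y)) \<bullet> ?d - grad_x h x y \<bullet> ?d = (y2 - y) \<bullet> hess_xy h x (y + t *\<^sub>R (y2 - y)) ?d"
    using mvt_grad[of "\<lambda>y. grad_x h x y \<bullet> ?d" "\<lambda>y. hess_xy h x y ?d" y "y2 - y"]
      has_derivative_grad_x_y[OF h] by blast
  have w: "y + t *\<^sub>R (y2 - y) \<in> dikin_tube P (2 * \<eta>) c"
    by (rule dikin_tube_segment[OF inside(1) y y2]) (use t in auto)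
  have "(norm ?d)\<^sup>2 = hess_xy h x (y + t *\<^sub>R (y2 - y)) ?d \<bullet> (y2 - y)"
    using t(3) by (simp add: power2_norm_eq_inner inner_diff_left inner_commute)
  also have "\<dots> \<le> dual_norm P c (hess_xy h x (y + t *\<^sub>R (y2 - y)) ?d) * dnorm P c (y2 - y)"
    using dual_pairing[OF inside(1)] by (rule abs_le_D1)
  also have "\<dots> \<le> k * norm ?d * dnorm P c (y2 - y)"
    by (intro mult_right_mono k w dnorm_nonneg inside)
  finally have "norm ?d * norm ?d \<le> (k * dnorm P c (y2 - y)) * norm ?d"
    by (simp add: power2_eq_square mult_ac)
  moreover have "0 \<le> k * dnorm P c (y2 - y)" if "norm ?d = 0"
  proof -
    obtain b :: "real^'n" where b: "b \<in> Basis" using nonempty_Basis by blast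
    have "0 \<le> k * norm b" using k[OF w, of b] dual_norm_nonneg[OF inside(1)] by (rule order_trans[rotated])
    then show ?thesis using b dnorm_nonneg[OF inside(1)] by simp
  qed
  ultimately show ?thesis
    by (cases "norm ?d = 0") (auto simp: mult_le_cancel_right)
qed

end

lemma grad_x_lower_lipschitz:
  assumes "centre x c" "y \<in> dikin_tube P (2 * \<eta>) c" "y2 \<in> dikin_tube P (2 * \<eta>) c"
  shows "norm (grad_x (lower P) x y2 - grad_x (lower P) x y) \<le> \<l> * dnorm P c (y2 - y)"
proof (rule grad_x_lipschitz_of_mixed_hessian[OF assms(1,2) C2_lower assms(3)])
  show "dual_norm P c (hess_xy (lower P) x w u) \<le> \<l> * norm u" if w: "w \<in> dikin_tube P (2 * \<eta>) c" for w u
    using psi_xy_bound[OF assms(1) w, of u] w by (simp add: dikin_tube_def hess_xy_psi)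
qed

lemma grad_x_upper_lipschitz:
  assumes "centre x c" "y \<in> dikin_tube P (2 * \<eta>) c" "y2 \<in> dikin_tube P (2 * \<eta>) c"
  shows "norm (grad_x (upper P) x y2 - grad_x (upper P) x y) \<le> d_f1 C * dnorm P c (y2 - y)"
  by (rule grad_x_lipschitz_of_mixed_hessian[OF assms(1,2) C2_upper assms(3)]) (rule f_xy_bound[OF assms(1)])

lemma d_f0_nonneg: "0 \<le> d_f0 C"
  using d_f0_nonneg_at[OF centre_ys centre_in_tube] ystar_inside eta_pos by (meson less_imp_le mult_nonneg_nonneg zero_le_numeral)

lemma rho_le_l: "\<rho> \<le> \<l>"
proof -
  obtain b :: "real^'d" where b: "b \<in> Basis" using nonempty_Basis by blast
  let ?c = "ys 0"
  have c: "?c \<in> dikin_tube P (2 * \<eta>) ?c" using centre_in_tube[OF ystar_inside] eta_pos by simp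
  have "\<rho> * (Hm ?c b \<bullet> b) \<le> \<l> * (Hm ?c b \<bullet> b)"
    using psi_yy_lower[OF centre_ys c, of b] psi_yy_upper[OF centre_ys c, of b] by linarith
  moreover have "0 < Hm ?c b \<bullet> b" using spd.pos[OF spd_Hm[OF ystar_inside]] b by (metis nonzero_Basis)
  ultimately show ?thesis by simp
qed

lemma l_pos: "0 < \<l>" using rho_le_l rho_pos by linarith

lemma d_f1_nonneg: "0 \<le> d_f1 C"
proof -
  obtain b :: "real^'n" where b: "b \<in> Basis" using nonempty_Basis by blast
  have "0 \<le> d_f1 C * norm b"
    using f_xy_bound[OF centre_ys centre_in_tube[OF ystar_inside], of 0 b]
      dual_norm_nonneg[OF ystar_inside] eta_pos by (smt (verit) mult_nonneg_nonneg)
  then show ?thesis using b by simp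
qed

lemma lam_rho_f1: "lam0 \<le> lam \<Longrightarrow> d_f1 C \<le> lam * \<rho> / 2"
  using lam0_f1 rho_pos by (smt (verit) mult_right_mono pos_divide_le_eq field_sum_of_halves)

text \<open>Since \<open>\<rho> \<le> \<l>\<close>, the radius condition forces \<open>\<theta> \<le> 1/4\<close>, hence \<open>\<eta> \<le> 1/9\<close>; these numbers enter
  all later comparisons of metrics.\<close>

lemma theta_nonneg: "0 \<le> \<theta>" and theta_l: "\<theta> * \<l> \<le> \<rho> / 4"
  and theta_lam: "lam0 \<le> lam \<Longrightarrow> \<theta> * (lam * \<l> + d_f1 C) \<le> (lam * \<rho> / 2) / 4"
  and theta_quarter: "\<theta> \<le> 1/4" and eta_ninth: "\<eta> \<le> 1/9"
proof -
  have e: "0 < 1 - \<eta>" "1 - \<eta> \<le> 1" using eta_pos eta_half by auto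
  then have "(1 - \<eta>)\<^sup>2 \<le> 1" by (simp add: power_le_one)
  then show t0: "0 \<le> \<theta>" using e by (simp add: \<theta>_def)
  show t1: "\<theta> * \<l> \<le> \<rho> / 4" and "lam0 \<le> lam \<Longrightarrow> \<theta> * (lam * \<l> + d_f1 C) \<le> (lam * \<rho> / 2) / 4"
    using radius by (auto simp: radius_condition_def \<theta>_def Let_def)
  have "\<theta> * \<l> \<le> (1/4) * \<l>" using t1 rho_le_l by linarith
  then show t: "\<theta> \<le> 1/4" using l_pos by (simp only: mult_le_cancel_right_pos)
  show "\<eta> \<le> 1/9"
  proof (rule ccontr)
    assume "\<not> \<eta> \<le> 1/9"
    then have "(1 - \<eta>)\<^sup>2 \<le> (8/9)\<^sup>2" using e by (intro power_mono) auto
    then have "1 / (8/9)\<^sup>2 \<le> 1 / (1 - \<eta>)\<^sup>2" using e by (intro divide_left_mono) auto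
    then show False using t by (simp add: \<theta>_def power2_eq_square)
  qed
qed

text \<open>The slacks at \<open>w\<close> and \<open>c\<close> differ by factors in \<open>[1 - \<eta>, 1 + \<eta>]\<close>, and both \<open>(1 + \<eta>)\<^sup>2\<close> and
  \<open>1 / (1 - \<eta>)\<^sup>2\<close> are at most \<open>1 + \<theta>\<close>.\<close>

lemma frozen_metric:
  assumes c: "c \<in> inside" and w: "w \<in> dikin_tube P \<eta> c"
  shows "two_metrics (Hm c) (Hm w) \<theta>"
proof -
  have d: "dnorm P c (w - c) \<le> \<eta>" "\<eta> < 1" using w eta_half by (auto simp: dikin_tube_def)
  have e: "(1 + \<eta>)\<^sup>2 \<le> 1 + \<theta>"
  proof -
    have "(1 + \<eta>) * (1 - \<eta>) = 1 - \<eta> * \<eta>" by (simp add: algebra_simps)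
    moreover have "0 \<le> (1 + \<eta>) * (1 - \<eta>)" using eta_pos eta_half by simp
    moreover have "0 \<le> \<eta> * \<eta>" by simp
    ultimately have "((1 + \<eta>) * (1 - \<eta>))\<^sup>2 \<le> 1" by (intro power_le_one) linarith+
    then have "(1 + \<eta>)\<^sup>2 * (1 - \<eta>)\<^sup>2 \<le> 1" by (simp only: power_mult_distrib)
    then show ?thesis using d by (simp add: \<theta>_def le_divide_eq)
  qed
  have w': "w \<in> inside" using w by (simp add: dikin_tube_def)
  show ?thesis
  proof (intro two_metrics.intro two_metrics_axioms.intro spd_Hm c w' theta_nonneg)
    show "Hm w u \<bullet> u \<le> (1 + \<theta>) * (Hm c u \<bullet> u)" for u
      using dikin_ball(2)[OF c d] by (simp add: \<theta>_def)
    show "Hm c u \<bullet> u \<le> (1 + \<theta>) * (Hm w u \<bullet> u)" for u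
      using dikin_ball(3)[OF c d, of u] mult_right_mono[OF e spd.form_nonneg[OF spd_Hm[OF w'], of u]]
      by linarith
  qed
qed

text \<open>The step map \<open>y \<mapsto> y - \<gamma> H0\<inverse> G y\<close> contracts towards the zero \<open>c\<close> of \<open>G\<close> because its
  derivative does so at every point of the segment from \<open>c\<close>.\<close>

lemma frozen_step_contracts:
  assumes c: "c \<in> inside" and w0: "w0 \<in> dikin_tube P \<eta> c" and w: "w \<in> dikin_tube P \<eta> c"
    and G: "\<And>y. y \<in> dikin_tube P \<eta> c \<Longrightarrow> (G has_derivative M y) (at y)"
    and sym: "\<And>y u v. y \<in> dikin_tube P \<eta> c \<Longrightarrow> M y u \<bullet> v = u \<bullet> M y v"
    and lo: "\<And>y u. y \<in> dikin_tube P \<eta> c \<Longrightarrow> m * (Hm c u \<bullet> u) \<le> M y u \<bullet> u"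
    and hi: "\<And>y u. y \<in> dikin_tube P \<eta> c \<Longrightarrow> M y u \<bullet> u \<le> L * (Hm c u \<bullet> u)"
    and zero: "G c = 0" and m: "0 \<le> m" "\<theta> * L \<le> m / 4" and g: "0 \<le> \<gamma>" "\<gamma> * L \<le> 1"
  shows "dnorm P c (w - \<gamma> *\<^sub>R inv (Hm w0) (G w) - c) \<le> (1 - 3/4 * \<gamma> * m) * dnorm P c (w - c)"
proof -
  interpret two_metrics "Hm c" "Hm w0" \<theta> by (rule frozen_metric[OF c w0])
  define F where "F = (\<lambda>y. y - \<gamma> *\<^sub>R inv (Hm w0) (G y))"
  have dF: "(F has_derivative (\<lambda>u. u - \<gamma> *\<^sub>R inv (Hm w0) (M y u))) (at y)" if "y \<in> dikin_tube P \<eta> c" for y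
    unfolding F_def
    by (intro has_derivative_diff has_derivative_ident has_derivative_scaleR_right
        bounded_linear.has_derivative[OF linear_conv_bounded_linear[THEN iffD1, OF H0.linear_inv]] G that)
  have seg: "c + t *\<^sub>R (w - c) \<in> dikin_tube P \<eta> c" if "0 \<le> t" "t \<le> 1" for t
    by (rule dikin_tube_segment[OF c centre_in_tube[OF c] w that]) (use eta_pos in simp)
  have k: "1 - \<gamma> * m + \<gamma> * \<theta> * L \<le> 1 - 3/4 * \<gamma> * m"
    using mult_left_mono[OF m(2) g(1)] by (simp add: algebra_simps)
  have "H.N (F w - F c) \<le> (1 - 3/4 * \<gamma> * m) * H.N (w - c)"
  proof (rule H.N_leI)
    fix v
    obtain t where t: "0 < t" "t < 1" "(F (c + (w - c)) - F c) \<bullet> Hm c v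
        = (let y = c + t *\<^sub>R (w - c); u = w - c in u - \<gamma> *\<^sub>R inv (Hm w0) (M y u)) \<bullet> Hm c v"
      using mvt_inner[of F "\<lambda>y u. u - \<gamma> *\<^sub>R inv (Hm w0) (M y u)" c "w - c" "Hm c v"] dF seg
      unfolding Let_def by blast
    let ?y = "c + t *\<^sub>R (w - c)"
    have y: "?y \<in> dikin_tube P \<eta> c" using seg t by simp
    have "Hm c (F w - F c) \<bullet> v = Hm c (w - c - \<gamma> *\<^sub>R inv (Hm w0) (M ?y (w - c))) \<bullet> v"
      using t(3) by (simp add: H.sym Let_def)
    also have "\<dots> \<le> H.N (w - c - \<gamma> *\<^sub>R inv (Hm w0) (M ?y (w - c))) * H.N v"
      using H.cauchy by (rule abs_le_D1)
    also have "\<dots> \<le> ((1 - 3/4 * \<gamma> * m) * H.N (w - c)) * H.N v"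
    proof (intro mult_right_mono H.N_nonneg)
      have "H.N (w - c - \<gamma> *\<^sub>R inv (Hm w0) (M ?y (w - c))) \<le> (1 - \<gamma> * m + \<gamma> * \<theta> * L) * H.N (w - c)"
        by (rule gradient_step[OF has_derivative_linear[OF G[OF y]] sym[OF y] lo[OF y] hi[OF y] m(1) g])
      also have "\<dots> \<le> (1 - 3/4 * \<gamma> * m) * H.N (w - c)" using k by (rule mult_right_mono) (rule H.N_nonneg)
      finally show "H.N (w - c - \<gamma> *\<^sub>R inv (Hm w0) (M ?y (w - c))) \<le> (1 - 3/4 * \<gamma> * m) * H.N (w - c)" .
    qed
    finally show "Hm c (F w - F c) \<bullet> v \<le> (1 - 3/4 * \<gamma> * m) * H.N (w - c) * H.N v" .
  qed
  moreover have "F c = c" using linear_0[OF H0.linear_inv] by (simp add: F_def zero)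
  ultimately show ?thesis by (simp add: dnorm_N[OF c]) (simp add: F_def)
qed

lemma z_step_contracts:
  assumes w0: "w0 \<in> tube P \<eta> x" and w: "w \<in> tube P \<eta> x" and g: "0 \<le> \<gamma>" "\<gamma> * \<l> \<le> 1"
  shows "dnorm P (ys x) (w - \<gamma> *\<^sub>R inv (Hm w0) (grad_y (psi P) x w) - ys x)
    \<le> (1 - 3/4 * \<gamma> * \<rho>) * dnorm P (ys x) (w - ys x)"
proof (rule frozen_step_contracts[OF ystar_inside w0 w, where M = "hess_yy (psi P) x" and L = \<l>])
  fix y u v assume y: "y \<in> tube P \<eta> x"
  then have i: "y \<in> inside" and y2: "y \<in> tube P (2 * \<eta>) x"
    using eta_pos by (auto simp: dikin_tube_def)
  show "(grad_y (psi P) x has_derivative hess_yy (psi P) x y) (at y)" by (rule psi_yy_derivative[OF i])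
  show "hess_yy (psi P) x y u \<bullet> v = u \<bullet> hess_yy (psi P) x y v" by (rule hess_yy_psi_symmetric[OF i])
  show "\<rho> * (Hm (ys x) u \<bullet> u) \<le> hess_yy (psi P) x y u \<bullet> u" by (rule psi_yy_lower[OF centre_ys y2])
  show "hess_yy (psi P) x y u \<bullet> u \<le> \<l> * (Hm (ys x) u \<bullet> u)" by (rule psi_yy_upper[OF centre_ys y2])
qed (use grad_y_psi_ystar rho_pos theta_l g in auto)

definition penalised_grad :: "real \<Rightarrow> real^'n \<Rightarrow> real^'d \<Rightarrow> real^'d" where
  "penalised_grad lam x y = grad_y (upper P) x y + lam *\<^sub>R grad_y (psi P) x y"

lemma penalised_grad_yl:
  assumes lam: "0 < lam"
  shows "penalised_grad lam x (yl lam x) = 0"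
proof (rule interior_minimum_grad[OF yl_inside[OF lam]])
  show "Lag P lam x (yl lam x) \<le> Lag P lam x y" if "y \<in> inside" for y
    using yl_arg_min[OF lam, of x] that by (auto simp: is_arg_min_def not_less)
  have "((\<lambda>y. upper P (x, y) + lam * (psi P (x, y) - psi_min P x)) has_derivative
    (\<lambda>u. u \<bullet> grad_y (upper P) x (yl lam x) + lam * ((u \<bullet> grad_y (psi P) x (yl lam x)) - 0))) (at (yl lam x))"
    using has_derivative_grad_y[OF C2_upper] psi_derivative[OF yl_inside[OF lam]]
    by (intro has_derivative_add has_derivative_mult_right has_derivative_diff has_derivative_const)
      (simp_all add: grad_y_snd[OF C2_upper] grad_y_psi yl_inside[OF lam])
  then show "(Lag P lam x has_derivative (\<lambda>u. u \<bullet> penalised_grad lam x (yl lam x))) (at (yl lam x))"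
    by (simp add: Lag_def[abs_def] penalised_grad_def inner_simps)
qed

text \<open>The upper objective may destroy up to half of the curvature \<open>lam \<rho>\<close>, which leaves \<open>m = lam \<rho> / 2\<close>.\<close>

lemma y_step_contracts:
  assumes lam: "lam0 \<le> lam"
    and w0: "w0 \<in> dikin_tube P \<eta> (yl lam x)" and w: "w \<in> dikin_tube P \<eta> (yl lam x)"
    and g: "0 \<le> \<alpha>" "\<alpha> * (lam * \<l> + d_f1 C) \<le> 1"
  shows "dnorm P (yl lam x) (w - \<alpha> *\<^sub>R inv (Hm w0) (penalised_grad lam x w) - yl lam x)
    \<le> (1 - 3/8 * (\<alpha> * lam) * \<rho>) * dnorm P (yl lam x) (w - yl lam x)"
proof -
  have lp: "0 < lam" using lam lam0_pos by linarith
  have cc: "centre x (yl lam x)" by (rule centre_yl[OF lam])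
  have "dnorm P (yl lam x) (w - \<alpha> *\<^sub>R inv (Hm w0) (penalised_grad lam x w) - yl lam x)
    \<le> (1 - 3/4 * \<alpha> * (lam * \<rho> / 2)) * dnorm P (yl lam x) (w - yl lam x)"
  proof (rule frozen_step_contracts[OF yl_inside[OF lp] w0 w,
        where M = "\<lambda>y u. hess_yy (upper P) x y u + lam *\<^sub>R hess_yy (psi P) x y u" and L = "lam * \<l> + d_f1 C"])
    fix y u v assume y: "y \<in> dikin_tube P \<eta> (yl lam x)"
    then have i: "y \<in> inside" and y2: "y \<in> dikin_tube P (2 * \<eta>) (yl lam x)"
      using eta_pos by (auto simp: dikin_tube_def)
    show "(penalised_grad lam x has_derivative (\<lambda>u. hess_yy (upper P) x y u + lam *\<^sub>R hess_yy (psi P) x y u)) (at y)"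
      unfolding penalised_grad_def[abs_def]
      by (intro has_derivative_add has_derivative_scaleR_right psi_yy_derivative[OF i] has_derivative_hess_yy C2_upper)
    show "(hess_yy (upper P) x y u + lam *\<^sub>R hess_yy (psi P) x y u) \<bullet> v
      = u \<bullet> (hess_yy (upper P) x y v + lam *\<^sub>R hess_yy (psi P) x y v)"
      by (simp add: inner_simps hess_yy_symmetric[OF C2_upper] hess_yy_psi_symmetric[OF i])
    have f: "\<bar>hess_yy (upper P) x y u \<bullet> u\<bar> \<le> d_f1 C * (Hm (yl lam x) u \<bullet> u)" by (rule f_yy_form[OF cc y2])
    have n: "0 \<le> Hm (yl lam x) u \<bullet> u" by (rule spd.form_nonneg[OF spd_Hm[OF yl_inside[OF lp]]])
    have "d_f1 C * (Hm (yl lam x) u \<bullet> u) \<le> (lam * \<rho> / 2) * (Hm (yl lam x) u \<bullet> u)"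
      using lam_rho_f1[OF lam] n by (rule mult_right_mono)
    then show "lam * \<rho> / 2 * (Hm (yl lam x) u \<bullet> u) \<le> (hess_yy (upper P) x y u + lam *\<^sub>R hess_yy (psi P) x y u) \<bullet> u"
      using abs_le_D2[OF f] mult_left_mono[OF psi_yy_lower[OF cc y2, of u], of lam] lp
      unfolding inner_add_left inner_scaleR_left by argo
    show "(hess_yy (upper P) x y u + lam *\<^sub>R hess_yy (psi P) x y u) \<bullet> u \<le> (lam * \<l> + d_f1 C) * (Hm (yl lam x) u \<bullet> u)"
      using abs_le_D1[OF f] mult_left_mono[OF psi_yy_upper[OF cc y2, of u], of lam] lp
      unfolding inner_add_left inner_scaleR_left distrib_right by (simp only: mult.assoc) linarith
  qed (use penalised_grad_yl[OF lp] rho_pos lp theta_lam[OF lam] g in auto)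
  then show ?thesis by (simp add: mult_ac)
qed

end

section \<open>Sensitivity of the two centres\<close>

lemma derivative_le_rate:
  assumes "(g has_real_derivative D) (at 0)" and "\<And>t. 0 < t \<Longrightarrow> g t - g 0 \<le> B * t"
  shows "D \<le> B"
proof -
  have "((\<lambda>t. (g t - g 0) / t) \<longlongrightarrow> D) (at_right 0)"
    using has_field_derivative_at_within[OF assms(1), of "{0<..}"] by (simp add: has_field_derivative_iff)
  moreover have "eventually (\<lambda>t. (g t - g 0) / t \<le> B) (at_right 0)"
    unfolding eventually_at_right[OF zero_less_one]
    by (intro exI[of _ 1]) (auto simp: divide_le_eq assms(2))
  ultimately show ?thesis by (intro tendsto_upperbound) auto
qed

lemma le_of_square_le:
  fixes x k :: real
  assumes "x * x \<le> k * x" "0 \<le> x" "0 \<le> k"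
  shows "x \<le> k"
  using assms by (cases "x = 0") auto

lemma scaled_sum_zero:
  fixes w v :: "'a::real_vector"
  assumes "w + r *\<^sub>R v = 0" "r \<noteq> 0"
  shows "v = - ((1 / r) *\<^sub>R w)"
proof -
  have "r *\<^sub>R v = - w" using assms(1) by (simp add: add_eq_0_iff)
  then have "(1 / r) *\<^sub>R (r *\<^sub>R v) = (1 / r) *\<^sub>R (- w)" by simp
  then show ?thesis using assms(2) by simp
qed

context dikin_problem
begin

abbreviation J :: "real^'n \<Rightarrow> real^'n \<Rightarrow> real^'d" where "J x \<equiv> frechet_derivative ys (at x)"
abbreviation Jl :: "real \<Rightarrow> real^'n \<Rightarrow> real^'n \<Rightarrow> real^'d" where "Jl lam x \<equiv> frechet_derivative (yl lam) (at x)"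

lemma ys_derivative: "(ys has_derivative J x) (at x)"
  using constants by (auto simp: local_dikin_constants_def frechet_derivative_works[symmetric])

lemma yl_derivative: "lam0 \<le> lam \<Longrightarrow> (yl lam has_derivative Jl lam x) (at x)"
  using constants by (auto simp: local_dikin_constants_def frechet_derivative_works[symmetric])

lemma ys_lipschitz: "dnorm P (ys x1) (ys x2 - ys x1) \<le> l_star0 C * norm (x2 - x1)"
  using constants by (auto simp: local_dikin_constants_def)

lemma yl_lipschitz: "lam0 \<le> lam1 \<Longrightarrow> lam0 \<le> lam2 \<Longrightarrow> dnorm P (yl lam1 x1) (yl lam2 x2 - yl lam1 x1)
    \<le> 2 * d_f0 C / \<rho> * \<bar>1 / lam2 - 1 / lam1\<bar> + l_lam0 C * norm (x2 - x1)"
  using constants by (auto simp: local_dikin_constants_def)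

lemma l_star0_ge1: "1 \<le> l_star0 C" and l_star1_ge1: "1 \<le> l_star1 C"
  using constants by (auto simp: local_dikin_constants_def)

text \<open>A Lipschitz constant of the map bounds its difference quotients, tested against \<open>Hm c v\<close>.\<close>

lemma derivative_dnorm_bound:
  fixes d :: "real^'n \<Rightarrow> real^'d"
  assumes c: "c \<in> inside" and d: "(d has_derivative d') (at x)"
    and L: "\<And>x'. dnorm P c (d x' - d x) \<le> L * norm (x' - x)"
  shows "dnorm P c (d' u) \<le> L * norm u"
proof (rule dnorm_leI[OF c])
  fix v
  have "((\<lambda>t. x + t *\<^sub>R u) has_derivative (\<lambda>s. s *\<^sub>R u)) (at 0)" by (auto intro!: derivative_eq_intros)
  from has_derivative_inner_left[OF has_derivative_compose[OF this, of d d'], of "Hm c v"] d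
  have "((\<lambda>t. d (x + t *\<^sub>R u) \<bullet> Hm c v) has_derivative (\<lambda>s. d' (s *\<^sub>R u) \<bullet> Hm c v)) (at 0)" by simp
  moreover have "(\<lambda>s. d' (s *\<^sub>R u) \<bullet> Hm c v) = (*) (d' u \<bullet> Hm c v)"
    using linear_cmul[OF has_derivative_linear[OF d]] by (auto simp: fun_eq_iff)
  ultimately have "((\<lambda>t. d (x + t *\<^sub>R u) \<bullet> Hm c v) has_real_derivative d' u \<bullet> Hm c v) (at 0)"
    by (simp add: has_field_derivative_def)
  then show "d' u \<bullet> Hm c v \<le> L * norm u * dnorm P c v"
  proof (rule derivative_le_rate)
    fix t :: real assume t: "0 < t"
    have "d (x + t *\<^sub>R u) \<bullet> Hm c v - d (x + 0 *\<^sub>R u) \<bullet> Hm c v = Hm c (d (x + t *\<^sub>R u) - d x) \<bullet> v"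
      by (simp add: spd.sym[OF spd_Hm[OF c]] inner_diff_left)
    also have "\<dots> \<le> dnorm P c (d (x + t *\<^sub>R u) - d x) * dnorm P c v"
      using dikin_cauchy[OF c] by (rule abs_le_D1)
    also have "\<dots> \<le> (L * norm ((x + t *\<^sub>R u) - x)) * dnorm P c v"
      by (intro mult_right_mono L dnorm_nonneg c)
    finally show "d (x + t *\<^sub>R u) \<bullet> Hm c v - d (x + 0 *\<^sub>R u) \<bullet> Hm c v \<le> L * norm u * dnorm P c v * t"
      using t by (simp add: mult_ac)
  qed
qed

lemma J_bound: "dnorm P (ys x) (J x u) \<le> l_star0 C * norm u"
  by (rule derivative_dnorm_bound[OF ystar_inside ys_derivative ys_lipschitz])

lemma Jl_bound:
  assumes "lam0 \<le> lam" shows "dnorm P (yl lam x) (Jl lam x u) \<le> l_lam0 C * norm u"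
proof (rule derivative_dnorm_bound[OF _ yl_derivative[OF assms]])
  show "yl lam x \<in> inside" using assms lam0_pos by (intro yl_inside) linarith
  show "dnorm P (yl lam x) (yl lam x' - yl lam x) \<le> l_lam0 C * norm (x' - x)" for x'
    using yl_lipschitz[OF assms assms, of x x'] by simp
qed

lemma l_lam0_nonneg: "0 \<le> l_lam0 C"
proof -
  obtain b :: "real^'n" where b: "b \<in> Basis" using nonempty_Basis by blast
  have "0 \<le> l_lam0 C * norm b"
    using Jl_bound[OF order_refl, of 0 b] dnorm_nonneg[OF yl_inside[OF lam0_pos]] by (meson order_trans)
  then show ?thesis using b by simp
qed

lemma first_order_remainder:
  fixes d :: "real^'n \<Rightarrow> real^'d"
  assumes c: "c \<in> inside" and d: "\<And>x. (d has_derivative d' x) (at x)"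
    and L: "\<And>x'. op_norm norm (dnorm P c) (\<lambda>u. d' x' u - d' x u) \<le> L * norm (x' - x)"
  shows "dnorm P c (d x' - d x - d' x (x' - x)) \<le> \<bar>L\<bar> * (norm (x' - x))\<^sup>2"
proof (rule dnorm_leI[OF c])
  fix v
  let ?u = "x' - x"
  obtain t where t: "0 < t" "t < 1" "(d (x + ?u) - d x) \<bullet> Hm c v = d' (x + t *\<^sub>R ?u) ?u \<bullet> Hm c v"
    using mvt_inner[of d d' x ?u "Hm c v"] d by blast
  have lin: "linear (\<lambda>u. d' (x + t *\<^sub>R ?u) u - d' x u)"
    by (intro linear_compose_sub has_derivative_linear[OF d])
  have "(d x' - d x - d' x ?u) \<bullet> Hm c v = (d' (x + t *\<^sub>R ?u) ?u - d' x ?u) \<bullet> Hm c v"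
    using t(3) by (simp add: inner_diff_left)
  also have "\<dots> \<le> dnorm P c (d' (x + t *\<^sub>R ?u) ?u - d' x ?u) * dnorm P c v"
    using dikin_cauchy[OF c, of "d' (x + t *\<^sub>R ?u) ?u - d' x ?u" v]
    by (simp add: spd.sym[OF spd_Hm[OF c]] abs_le_iff)
  also have "\<dots> \<le> (\<bar>L\<bar> * (norm ?u)\<^sup>2) * dnorm P c v"
  proof (intro mult_right_mono dnorm_nonneg c)
    have "dnorm P c (d' (x + t *\<^sub>R ?u) ?u - d' x ?u) \<le> (L * norm ((x + t *\<^sub>R ?u) - x)) * norm ?u"
      using op_norm_2_dikin[OF c lin L] .
    also have "\<dots> = (L * t) * (norm ?u)\<^sup>2" using t by (simp add: power2_eq_square)
    also have "\<dots> \<le> \<bar>L\<bar> * (norm ?u)\<^sup>2"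
    proof (rule mult_right_mono)
      have "L * t \<le> \<bar>L\<bar> * t" using t by (intro mult_right_mono) auto
      also have "\<dots> \<le> \<bar>L\<bar> * 1" using t by (intro mult_left_mono) auto
      finally show "L * t \<le> \<bar>L\<bar>" by simp
    qed simp
    finally show "dnorm P c (d' (x + t *\<^sub>R ?u) ?u - d' x ?u) \<le> \<bar>L\<bar> * (norm ?u)\<^sup>2" .
  qed
  finally show "(d x' - d x - d' x ?u) \<bullet> Hm c v \<le> \<bar>L\<bar> * (norm ?u)\<^sup>2 * dnorm P c v" .
qed

lemma ys_first_order: "dnorm P (ys x) (ys x' - ys x - J x (x' - x)) \<le> \<bar>l_star1 C\<bar> * (norm (x' - x))\<^sup>2"
  using constants by (intro first_order_remainder ystar_inside ys_derivative) (auto simp: local_dikin_constants_def)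

lemma yl_first_order:
  assumes "lam0 \<le> lam"
  shows "dnorm P (yl lam x) (yl lam x' - yl lam x - Jl lam x (x' - x)) \<le> \<bar>l_lam1 C\<bar> * (norm (x' - x))\<^sup>2"
  using constants assms lam0_pos
  by (intro first_order_remainder yl_inside yl_derivative) (auto simp: local_dikin_constants_def)

text \<open>Large multipliers, for which the proxy centre lies well inside the neighbourhood of the exact
  one.\<close>

definition large :: "real \<Rightarrow> bool" where
  "large lam \<longleftrightarrow> lam0 \<le> lam \<and> 8 * d_f0 C \<le> \<eta> * mu P * lam"

text \<open>The proxy centre is within \<open>K0 / lam\<close> of the exact centre; \<open>K1 / lam\<close> and \<open>K2 / lam\<close> below play the same
  role for the Jacobians and for the gradient estimate.\<close>

definition K0 :: real where "K0 = 4 * d_f0 C / mu P"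

lemma K0_nonneg: "0 \<le> K0" using d_f0_nonneg mu_pos by (simp add: K0_def)

text \<open>Stationarity of both centres gives
  \<open>lam \<mu> (\<nabla>\<phi> yl - \<nabla>\<phi> ys) \<bullet> (yl - ys) \<le> d_f0 r\<close> with \<open>r\<close> the distance in the metric at \<open>yl\<close>, and
  the left side is at least \<open>lam \<mu> r\<^sup>2 / (1 + r)\<close>.\<close>

lemma yl_near_ys:
  assumes "large lam"
  shows "dnorm P (ys x) (yl lam x - ys x) \<le> K0 / lam" and "dnorm P (ys x) (yl lam x - ys x) \<le> \<eta> / 2"
    and "dnorm P (yl lam x) (ys x - yl lam x) \<le> \<eta> / 2"
proof -
  have lam: "lam0 \<le> lam" "8 * d_f0 C \<le> \<eta> * mu P * lam" using assms by (auto simp: large_def)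
  have lp: "0 < lam" using lam lam0_pos by linarith
  define c where "c = yl lam x"
  define y where "y = ys x"
  define r where "r = dnorm P c (c - y)"
  have ci: "c \<in> inside" and yi: "y \<in> inside" using yl_inside[OF lp] ystar_inside by (auto simp: c_def y_def)
  have cc: "centre x c" unfolding c_def by (rule centre_yl[OF lam(1)])
  have r0: "0 \<le> r" unfolding r_def by (rule dnorm_nonneg[OF ci])
  have s1: "grad_y (upper P) x c + lam *\<^sub>R (grad_y (lower P) x c + mu P *\<^sub>R grad (phi P) c) = 0"
    using penalised_grad_yl[OF lp, of x] by (simp add: penalised_grad_def grad_y_psi ci flip: c_def)
  have s2: "grad_y (lower P) x y + mu P *\<^sub>R grad (phi P) y = 0"
    using grad_y_psi_ystar[of x] by (simp add: grad_y_psi yi flip: y_def)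
  have mono: "0 \<le> (grad_y (lower P) x c - grad_y (lower P) x y) \<bullet> (c - y)"
    unfolding grad_y_snd[OF C2_lower]
    using regular by (intro strongly_convex_monotone[where \<rho> = "rho_g R" and h = "\<lambda>y. lower P (x, y)"]
        has_derivative_grad_y C2_lower) (auto simp: objective_regularity_def)
  have eq: "lam * (mu P * ((grad (phi P) c - grad (phi P) y) \<bullet> (c - y)))
    = - (grad_y (upper P) x c \<bullet> (c - y)) - lam * ((grad_y (lower P) x c - grad_y (lower P) x y) \<bullet> (c - y))"
  proof -
    have "(grad_y (upper P) x c + lam *\<^sub>R (grad_y (lower P) x c + mu P *\<^sub>R grad (phi P) c)
      - lam *\<^sub>R (grad_y (lower P) x y + mu P *\<^sub>R grad (phi P) y)) \<bullet> (c - y) = 0" using s1 s2 by simp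
    then show ?thesis by (simp add: inner_add_left inner_diff_left) (simp add: algebra_simps)
  qed
  have "lam * (mu P * (r\<^sup>2 / (1 + r))) \<le> lam * (mu P * ((grad (phi P) c - grad (phi P) y) \<bullet> (c - y)))"
    using grad_phi_monotone[OF ci yi] mu_pos lp unfolding r_def by (intro mult_left_mono) auto
  also have "\<dots> \<le> - (grad_y (upper P) x c \<bullet> (c - y))" using eq mono lp by simp
  also have "\<dots> \<le> dual_norm P c (grad_y (upper P) x c) * r"
    using dual_pairing[OF ci, of "grad_y (upper P) x c" "c - y"] by (simp add: r_def abs_le_iff)
  also have "\<dots> \<le> d_f0 C * r"
    using f_y_bound[OF cc centre_in_tube[OF ci]] eta_pos r0 by (intro mult_right_mono) auto
  finally have key: "lam * mu P * (r * r) \<le> d_f0 C * r * (1 + r)"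
    using r0 by (simp add: power2_eq_square field_simps)
  have lm: "0 < lam * mu P" using lp mu_pos by simp
  have b: "8 * d_f0 C \<le> \<eta> * (lam * mu P)" using lam(2) by (simp add: mult_ac)
  have small: "8 * d_f0 C \<le> lam * mu P"
    using b lm eta_ninth mult_right_mono[of \<eta> 1 "lam * mu P"] by linarith
  have r1: "lam * mu P * r \<le> 2 * d_f0 C"
  proof (cases "r = 0")
    case True then show ?thesis using d_f0_nonneg by simp
  next
    case False
    then have "r * (lam * mu P * r) \<le> r * (d_f0 C * (1 + r))" using key by (simp add: mult_ac)
    then have "lam * mu P * r \<le> d_f0 C * (1 + r)" using r0 False by simp
    moreover have "8 * d_f0 C * r \<le> lam * mu P * r" using small r0 by (rule mult_right_mono)
    ultimately show ?thesis using d_f0_nonneg by (simp add: algebra_simps)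
  qed
  then have r2: "r \<le> 2 * d_f0 C / (lam * mu P)" using lm by (simp add: pos_le_divide_eq mult.commute)
  have r3: "r \<le> \<eta> / 4"
  proof -
    have "4 * (r * (lam * mu P)) \<le> \<eta> * (lam * mu P)" using r1 b by (simp add: mult_ac)
    then have "(4 * r) * (lam * mu P) \<le> \<eta> * (lam * mu P)" by (simp add: mult.assoc)
    then have "4 * r \<le> \<eta>" using lm by (simp only: mult_le_cancel_right_pos)
    then show ?thesis by simp
  qed
  have re: "dnorm P c (y - c) = r" unfolding r_def by (rule dnorm_minus_commute[OF ci])
  have half: "r \<le> 1/2" using r3 eta_ninth by simp
  have "dnorm P y (c - y) \<le> r / (1 - r)"
    using dnorm_change_centre(1)[OF ci, of y r "c - y"] re half by (simp add: r_def)
  also have "\<dots> \<le> r / (1/2)" using half r0 by (intro divide_left_mono) auto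
  finally have d: "dnorm P y (c - y) \<le> 2 * r" by simp
  have "2 * r \<le> 2 * (2 * d_f0 C / (lam * mu P))" using r2 by simp
  also have "\<dots> = K0 / lam" by (simp add: K0_def)
  finally have "2 * r \<le> K0 / lam" .
  with d show "dnorm P (ys x) (yl lam x - ys x) \<le> K0 / lam" by (simp add: c_def y_def)
  show "dnorm P (ys x) (yl lam x - ys x) \<le> \<eta> / 2" using d r3 by (simp add: c_def y_def)
  show "dnorm P (yl lam x) (ys x - yl lam x) \<le> \<eta> / 2" using re r3 eta_pos by (simp add: c_def y_def)
qed

lemma yl_in_tube:
  assumes "large lam" shows "yl lam x \<in> tube P (2 * \<eta>) x"
proof -
  have "0 < lam" using assms lam0_pos by (auto simp: large_def)
  then show ?thesis using yl_near_ys(2)[OF assms, of x] eta_pos yl_inside by (auto simp: dikin_tube_def)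
qed

lemma zero_derivative: "((\<lambda>x. 0) has_derivative D) (at x) \<Longrightarrow> D u = 0"
  using has_derivative_unique[OF has_derivative_const] by (metis (mono_tags))

text \<open>Implicit differentiation of the stationarity condition \<open>grad_y (psi P) x (ys x) = 0\<close>, and below of its
  penalised counterpart.\<close>

lemma J_equation: "hess_xy (psi P) x (ys x) u + hess_yy (psi P) x (ys x) (J x u) = 0"
proof -
  have "(\<lambda>x. grad_y (lower P) x (ys x) + mu P *\<^sub>R grad (phi P) (ys x)) = (\<lambda>x. 0)"
    using grad_y_psi_ystar by (simp add: grad_y_psi ystar_inside fun_eq_iff)
  then have "((\<lambda>x. 0) has_derivative (\<lambda>u. hess_xy (lower P) x (ys x) u + (hess_yy (lower P) x (ys x) (J x u)
      + mu P *\<^sub>R Hm (ys x) (J x u)))) (at x)"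
    using has_derivative_grad_y_psi_comp[OF ys_derivative ystar_inside, of x] by simp
  from zero_derivative[OF this] show ?thesis
    by (simp add: hess_yy_psi hess_xy_psi ystar_inside)
qed

lemma Jl_equation:
  fixes x u
  assumes lam: "lam0 \<le> lam"
  defines "c \<equiv> yl lam x" and "v \<equiv> Jl lam x u"
  shows "hess_yy (psi P) x c v = - hess_xy (psi P) x c u - (1 / lam) *\<^sub>R (hess_xy (upper P) x c u + hess_yy (upper P) x c v)"
proof -
  have lp: "0 < lam" using lam lam0_pos by linarith
  have ci: "c \<in> inside" using yl_inside[OF lp] by (simp add: c_def)
  have "(\<lambda>x. grad_y (upper P) x (yl lam x)
      + lam *\<^sub>R (grad_y (lower P) x (yl lam x) + mu P *\<^sub>R grad (phi P) (yl lam x))) = (\<lambda>x. 0)"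
    using penalised_grad_yl[OF lp] by (simp add: penalised_grad_def grad_y_psi yl_inside[OF lp] fun_eq_iff)
  moreover have "((\<lambda>x. grad_y (upper P) x (yl lam x)
      + lam *\<^sub>R (grad_y (lower P) x (yl lam x) + mu P *\<^sub>R grad (phi P) (yl lam x))) has_derivative
     (\<lambda>u. (hess_xy (upper P) x (yl lam x) u + hess_yy (upper P) x (yl lam x) (Jl lam x u))
      + lam *\<^sub>R (hess_xy (lower P) x (yl lam x) u + (hess_yy (lower P) x (yl lam x) (Jl lam x u)
      + mu P *\<^sub>R Hm (yl lam x) (Jl lam x u))))) (at x)"
    by (intro has_derivative_add has_derivative_scaleR_right
        has_derivative_grad_y_comp[OF C2_upper yl_derivative[OF lam]]
        has_derivative_grad_y_psi_comp[OF yl_derivative[OF lam] yl_inside[OF lp]])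
  ultimately have "(hess_xy (upper P) x c u + hess_yy (upper P) x c v)
      + lam *\<^sub>R (hess_xy (lower P) x c u + (hess_yy (lower P) x c v + mu P *\<^sub>R Hm c v)) = 0"
    using zero_derivative[of _ x u] unfolding c_def v_def by simp
  then have e: "(hess_xy (upper P) x c u + hess_yy (upper P) x c v)
      + lam *\<^sub>R (hess_xy (psi P) x c u + hess_yy (psi P) x c v) = 0"
    by (simp add: hess_yy_psi hess_xy_psi ci)
  have "hess_yy (psi P) x c v = (hess_xy (psi P) x c u + hess_yy (psi P) x c v) - hess_xy (psi P) x c u" by simp
  also have "hess_xy (psi P) x c u + hess_yy (psi P) x c v
    = - ((1 / lam) *\<^sub>R (hess_xy (upper P) x c u + hess_yy (upper P) x c v))"
    using scaled_sum_zero[OF e] lp by simp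
  finally show ?thesis by simp
qed

definition K1 :: real where "K1 = (\<bar>l_psi2 C\<bar> * K0 + d_f1 C) * (1 + 2 * l_lam0 C) / \<rho>"

lemma K1_nonneg: "0 \<le> K1"
  using K0_nonneg d_f1_nonneg l_lam0_nonneg rho_pos by (simp add: K1_def)

text \<open>Both Jacobians solve linear systems whose coefficients differ by \<open>O(1/lam)\<close>.\<close>

lemma Jl_near_J:
  assumes lg: "large lam"
  shows "dnorm P (ys x) (Jl lam x u - J x u) \<le> K1 / lam * norm u"
proof -
  have lam: "lam0 \<le> lam" using lg by (simp add: large_def)
  have lp: "0 < lam" using lam lam0_pos by linarith
  define c where "c = ys x"
  define k where "k = yl lam x"
  define v where "v = Jl lam x u"
  define e where "e = v - J x u"
  define d where "d = dnorm P c (k - c)"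
  have ci: "c \<in> inside" by (simp add: c_def ystar_inside)
  have ki: "k \<in> inside" by (simp add: k_def yl_inside[OF lp])
  have cc: "centre x c" by (simp add: c_def centre_ys)
  have ct: "c \<in> dikin_tube P (2 * \<eta>) c" using centre_in_tube[OF ci] eta_pos by simp
  have kt: "k \<in> dikin_tube P (2 * \<eta>) c" using yl_in_tube[OF lg] by (simp add: c_def k_def)
  have d: "0 \<le> d" "d \<le> K0 / lam" using yl_near_ys(1)[OF lg, of x] dnorm_nonneg[OF ci] by (auto simp: d_def c_def k_def)
  have d': "dnorm P c (c - k) = d" unfolding d_def by (rule dnorm_minus_commute[OF ci])
  have kl: "0 \<le> K0 / lam" using K0_nonneg lp by simp
  have vb: "dnorm P c v \<le> 2 * l_lam0 C * norm u"
  proof -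
    have "dnorm P c v \<le> dnorm P k v / (1 - \<eta> / 2)"
      unfolding c_def k_def
      by (rule dnorm_change_centre(1)[OF yl_inside[OF lp] yl_near_ys(3)[OF lg]]) (use eta_ninth in simp)
    also have "\<dots> \<le> dnorm P k v / (1/2)"
      using eta_ninth dnorm_nonneg[OF ki] by (intro divide_left_mono) auto
    also have "\<dots> \<le> 2 * (l_lam0 C * norm u)" using Jl_bound[OF lam, of x u] by (simp add: k_def v_def)
    finally show ?thesis by simp
  qed
  have vn: "0 \<le> dnorm P c v" "0 \<le> dnorm P c e" by (auto intro: dnorm_nonneg ci)
  define w1 where "w1 = hess_yy (psi P) x c v - hess_yy (psi P) x k v"
  define w2 where "w2 = hess_xy (psi P) x c u - hess_xy (psi P) x k u"
  define w3 where "w3 = hess_xy (upper P) x k u + hess_yy (upper P) x k v"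
  have eq: "hess_yy (psi P) x c e = w1 + w2 - (1 / lam) *\<^sub>R w3"
  proof -
    have "hess_yy (psi P) x c e = hess_yy (psi P) x c v - hess_yy (psi P) x c (J x u)"
      unfolding e_def by (rule linear_diff[OF linear_hess_yy_psi[OF ci]])
    moreover have "hess_yy (psi P) x c (J x u) = - hess_xy (psi P) x c u"
      using J_equation[of x u] by (simp add: c_def add_eq_0_iff)
    moreover have "hess_yy (psi P) x k v = - hess_xy (psi P) x k u - (1 / lam) *\<^sub>R w3"
      unfolding k_def v_def w3_def by (rule Jl_equation[OF lam])
    ultimately show ?thesis by (simp add: w1_def w2_def)
  qed
  have b1: "dual_norm P c w1 \<le> \<bar>l_psi2 C\<bar> * (K0 / lam) * (2 * l_lam0 C * norm u)"
  proof -
    have "dual_norm P c w1 \<le> l_psi2 C * dnorm P c (c - k) * dnorm P c v"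
      unfolding w1_def by (rule psi_yy_diff[OF cc ct kt])
    also have "\<dots> \<le> \<bar>l_psi2 C\<bar> * (K0 / lam) * (2 * l_lam0 C * norm u)"
      unfolding d' using d vb vn kl by (intro mult_mono mult_nonneg_nonneg) simp_all
    finally show ?thesis .
  qed
  have b2: "dual_norm P c w2 \<le> \<bar>l_psi2 C\<bar> * (K0 / lam) * norm u"
  proof -
    have "dual_norm P c w2 \<le> l_psi2 C * dnorm P c (c - k) * norm u"
      unfolding w2_def by (rule psi_xy_diff[OF cc ct kt])
    also have "\<dots> \<le> \<bar>l_psi2 C\<bar> * (K0 / lam) * norm u"
      unfolding d' using d by (intro mult_right_mono mult_mono) simp_all
    finally show ?thesis .
  qed
  have b3: "dual_norm P c w3 \<le> d_f1 C * norm u + d_f1 C * (2 * l_lam0 C * norm u)"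
  proof -
    have "dual_norm P c w3 \<le> dual_norm P c (hess_xy (upper P) x k u) + dual_norm P c (hess_yy (upper P) x k v)"
      unfolding w3_def by (rule dual_norm_triangle[OF ci])
    also have "\<dots> \<le> d_f1 C * norm u + d_f1 C * dnorm P c v"
      by (intro add_mono f_xy_bound[OF cc kt] f_yy_bound[OF cc kt])
    also have "\<dots> \<le> d_f1 C * norm u + d_f1 C * (2 * l_lam0 C * norm u)"
      using vb d_f1_nonneg by (intro add_left_mono mult_left_mono)
    finally show ?thesis .
  qed
  have "dual_norm P c (w1 + w2 - (1 / lam) *\<^sub>R w3) \<le> dual_norm P c w1 + dual_norm P c w2 + (1 / lam) * dual_norm P c w3"
    using dual_norm_triangle_diff[OF ci, of "w1 + w2" "(1 / lam) *\<^sub>R w3"] dual_norm_triangle[OF ci, of w1 w2]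
      dual_norm_scale[OF ci, of "1 / lam" w3] lp by simp
  also have "\<dots> \<le> \<bar>l_psi2 C\<bar> * (K0 / lam) * (2 * l_lam0 C * norm u) + \<bar>l_psi2 C\<bar> * (K0 / lam) * norm u
      + (1 / lam) * (d_f1 C * norm u + d_f1 C * (2 * l_lam0 C * norm u))"
    using lp by (intro add_mono mult_left_mono b1 b2 b3) auto
  also have "\<dots> = \<rho> * (K1 / lam * norm u)"
    using rho_pos lp by (simp add: K1_def field_simps)
  finally have bound: "dual_norm P c (hess_yy (psi P) x c e) \<le> \<rho> * (K1 / lam * norm u)" by (simp add: eq)
  have "\<rho> * (dnorm P c e)\<^sup>2 \<le> hess_yy (psi P) x c e \<bullet> e"
    using psi_yy_lower[OF cc ct, of e] by (simp add: dnorm_sq[OF ci])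
  also have "\<dots> \<le> dual_norm P c (hess_yy (psi P) x c e) * dnorm P c e"
    using dual_pairing[OF ci] by (rule abs_le_D1)
  also have "\<dots> \<le> \<rho> * (K1 / lam * norm u) * dnorm P c e" by (intro mult_right_mono bound vn)
  finally have "\<rho> * (dnorm P c e * dnorm P c e) \<le> \<rho> * ((K1 / lam * norm u) * dnorm P c e)"
    by (simp only: power2_eq_square mult.assoc)
  then have "dnorm P c e * dnorm P c e \<le> (K1 / lam * norm u) * dnorm P c e"
    using rho_pos by (simp only: mult_le_cancel_left_pos)
  then have "dnorm P c e \<le> K1 / lam * norm u"
    by (rule le_of_square_le) (use vn(2) K1_nonneg lp in simp_all)
  then show ?thesis by (simp add: c_def e_def v_def)
qed

text \<open>The step-ratio condition compares \<open>\<xi> / T\<close> with \<open>l_star0\<close> but not with \<open>l_lam0\<close>. The drift of the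
  proxy centre is therefore measured by \<open>l_star0\<close>, which the closeness of the Jacobians permits once
  \<open>lam\<close> is large.\<close>

lemma Jl_bound_star:
  assumes lg: "large lam" and K: "2 * K1 \<le> lam"
  shows "dnorm P (yl lam x) (Jl lam x u) \<le> 2 * l_star0 C * norm u"
proof -
  have lam: "lam0 \<le> lam" using lg by (simp add: large_def)
  have lp: "0 < lam" using lam lam0_pos by linarith
  have "dnorm P (ys x) (Jl lam x u) \<le> dnorm P (ys x) (J x u) + dnorm P (ys x) (Jl lam x u - J x u)"
    using dnorm_triangle[OF ystar_inside, of x "J x u" "Jl lam x u - J x u"] by simp
  also have "\<dots> \<le> l_star0 C * norm u + 1/2 * norm u"
  proof (intro add_mono J_bound)
    have "K1 / lam \<le> 1/2" using K lp by (simp add: divide_le_eq)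
    then have "K1 / lam * norm u \<le> 1/2 * norm u" by (rule mult_right_mono) simp
    then show "dnorm P (ys x) (Jl lam x u - J x u) \<le> 1/2 * norm u" using Jl_near_J[OF lg, of x u] by linarith
  qed
  also have "\<dots> \<le> 3/2 * (l_star0 C * norm u)"
    using mult_right_mono[OF l_star0_ge1, of "norm u"] by simp
  finally have 1: "dnorm P (ys x) (Jl lam x u) \<le> 3/2 * (l_star0 C * norm u)" .
  have "dnorm P (yl lam x) (Jl lam x u) \<le> dnorm P (ys x) (Jl lam x u) / (1 - \<eta> / 2)"
    by (rule dnorm_change_centre(1)[OF ystar_inside yl_near_ys(2)[OF lg]]) (use eta_ninth in simp)
  also have "\<dots> \<le> dnorm P (ys x) (Jl lam x u) / (3/4)"
    using eta_ninth dnorm_nonneg[OF ystar_inside] by (intro divide_left_mono) auto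
  finally show ?thesis using 1 by simp
qed

lemma Fmu_derivative:
  "(Fmu P has_derivative (\<lambda>u. u \<bullet> grad_x (upper P) x (ys x) + J x u \<bullet> grad_y (upper P) x (ys x))) (at x)"
proof -
  have "((\<lambda>x. (x, ys x)) has_derivative (\<lambda>u. (u, J x u))) (at x)"
    by (intro has_derivative_Pair has_derivative_ident ys_derivative)
  from has_derivative_compose[OF this C2_grad[OF C2_upper]]
  show ?thesis by (simp add: Fmu_def[abs_def] inner_prod_def grad_x_fst[OF C2_upper] grad_y_snd[OF C2_upper])
qed

lemma Fmu_grad: "(Fmu P has_derivative (\<lambda>u. u \<bullet> grad (Fmu P) x)) (at x)"
  by (rule has_derivative_grad) (use Fmu_derivative in \<open>auto simp: differentiable_def\<close>)

lemma grad_Fmu: "grad (Fmu P) x \<bullet> u = grad_x (upper P) x (ys x) \<bullet> u + grad_y (upper P) x (ys x) \<bullet> J x u"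
proof -
  have "(\<lambda>u. u \<bullet> grad (Fmu P) x) = (\<lambda>u. u \<bullet> grad_x (upper P) x (ys x) + J x u \<bullet> grad_y (upper P) x (ys x))"
    by (rule has_derivative_unique[OF Fmu_grad Fmu_derivative])
  from fun_cong[OF this, of u] show ?thesis by (simp add: inner_commute)
qed

text \<open>The gradient of the penalty function, evaluated with an estimate \<open>y\<close> of the proxy centre and an
  estimate \<open>z\<close> of the exact one.\<close>

definition grad_est :: "real \<Rightarrow> real^'n \<Rightarrow> real^'d \<Rightarrow> real^'d \<Rightarrow> real^'n" where
  "grad_est lam x y z = grad_x (upper P) x y + lam *\<^sub>R (grad_x (lower P) x y - grad_x (lower P) x z)"

definition K2 :: real where "K2 = (1 + l_star0 C) * (d_f1 C * K0 + \<bar>l_psi2 C\<bar> * K0\<^sup>2)"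

lemma K2_nonneg: "0 \<le> K2"
  using K0_nonneg d_f1_nonneg l_star0_ge1 by (simp add: K2_def)

text \<open>At the exact centres, \<open>lam (\<nabla>x g(yl) - \<nabla>x g(ys))\<close> expands to first order into
  \<open>lam \<nabla>xy \<psi> (yl - ys) = - lam J \<nabla>yy \<psi> (yl - ys) = J \<nabla>y f\<close>, which is the implicit part of the gradient
  of \<open>Fmu\<close>; the second-order terms carry the factor \<open>lam (K0 / lam)\<^sup>2\<close>.\<close>

lemma bias_at_centres:
  assumes lg: "large lam"
  shows "norm (grad_est lam x (yl lam x) (ys x) - grad (Fmu P) x) \<le> K2 / lam"
proof -
  have lam: "lam0 \<le> lam" using lg by (simp add: large_def)
  have lp: "0 < lam" using lam lam0_pos by linarith
  define c where "c = ys x"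
  define k where "k = yl lam x"
  define w where "w = k - c"
  define d where "d = dnorm P c w"
  have ci: "c \<in> inside" by (simp add: c_def ystar_inside)
  have ki: "k \<in> inside" by (simp add: k_def yl_inside[OF lp])
  have cc: "centre x c" by (simp add: c_def centre_ys)
  have ct: "c \<in> dikin_tube P (2 * \<eta>) c" using centre_in_tube[OF ci] eta_pos by simp
  have kt: "k \<in> dikin_tube P (2 * \<eta>) c" using yl_in_tube[OF lg] by (simp add: c_def k_def)
  have d: "0 \<le> d" "d \<le> K0 / lam" using yl_near_ys(1)[OF lg, of x] dnorm_nonneg[OF ci] by (auto simp: d_def w_def c_def k_def)
  have seg: "c + t *\<^sub>R w \<in> dikin_tube P (2 * \<eta>) c" if "0 \<le> t" "t \<le> 1" for t
    unfolding w_def by (rule dikin_tube_segment[OF ci ct kt that])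
  have seg_i: "c + t *\<^sub>R w \<in> inside" if "0 \<le> t" "t \<le> 1" for t
    using seg[OF that] by (simp add: dikin_tube_def)
  have seg_d: "dnorm P c (c + t *\<^sub>R w - c) \<le> d" if "0 \<le> t" "t \<le> 1" for t
    using that d(1) by (simp add: dnorm_scale[OF ci] d_def[symmetric] mult_left_le_one_le)
  define q where "q = grad_est lam x k c - grad (Fmu P) x"
  define v where "v = J x q"
  have vb: "dnorm P c v \<le> l_star0 C * norm q" using J_bound by (simp add: c_def v_def)
  have vn: "0 \<le> dnorm P c v" by (rule dnorm_nonneg[OF ci])
  have kw: "c + w = k" by (simp add: w_def)
  have e0: "(grad_x (upper P) x k - grad_x (upper P) x c) \<bullet> q \<le> d_f1 C * d * norm q"
  proof -
    have "(grad_x (upper P) x k - grad_x (upper P) x c) \<bullet> q \<le> norm (grad_x (upper P) x k - grad_x (upper P) x c) * norm q"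
      by (rule norm_cauchy_schwarz)
    also have "\<dots> \<le> (d_f1 C * dnorm P c (k - c)) * norm q"
      by (intro mult_right_mono grad_x_upper_lipschitz[OF cc ct kt]) simp
    finally show ?thesis by (simp add: d_def w_def)
  qed
  obtain t1 where t1: "0 < t1" "t1 < 1"
    "grad_x (lower P) x (c + w) \<bullet> q - grad_x (lower P) x c \<bullet> q = w \<bullet> hess_xy (lower P) x (c + t1 *\<^sub>R w) q"
    using mvt_grad[of "\<lambda>y. grad_x (lower P) x y \<bullet> q" "\<lambda>y. hess_xy (lower P) x y q" c w]
      has_derivative_grad_x_y[OF C2_lower] by blast
  define y1 where "y1 = c + t1 *\<^sub>R w"
  have y1: "y1 \<in> dikin_tube P (2 * \<eta>) c" "y1 \<in> inside" "dnorm P c (y1 - c) \<le> d"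
    using t1 seg[of t1] seg_i[of t1] seg_d[of t1] by (auto simp: y1_def)
  have e1: "(grad_x (lower P) x k - grad_x (lower P) x c) \<bullet> q \<le> hess_xy (psi P) x c q \<bullet> w + \<bar>l_psi2 C\<bar> * d * norm q * d"
  proof -
    have "(grad_x (lower P) x k - grad_x (lower P) x c) \<bullet> q = hess_xy (psi P) x y1 q \<bullet> w"
      using t1(3) y1(2) unfolding kw y1_def[symmetric] by (simp add: hess_xy_psi inner_diff_left inner_commute[of w])
    also have "\<dots> = hess_xy (psi P) x c q \<bullet> w + (hess_xy (psi P) x y1 q - hess_xy (psi P) x c q) \<bullet> w"
      by (simp add: inner_diff_left)
    also have "\<dots> \<le> hess_xy (psi P) x c q \<bullet> w + dual_norm P c (hess_xy (psi P) x y1 q - hess_xy (psi P) x c q) * d"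
      using dual_pairing[OF ci, of "hess_xy (psi P) x y1 q - hess_xy (psi P) x c q" w] by (simp add: d_def abs_le_iff)
    also have "\<dots> \<le> hess_xy (psi P) x c q \<bullet> w + (\<bar>l_psi2 C\<bar> * d * norm q) * d"
    proof (intro add_left_mono mult_right_mono d)
      have "dual_norm P c (hess_xy (psi P) x y1 q - hess_xy (psi P) x c q) \<le> l_psi2 C * dnorm P c (y1 - c) * norm q"
        by (rule psi_xy_diff[OF cc y1(1) ct])
      also have "\<dots> \<le> \<bar>l_psi2 C\<bar> * d * norm q"
        using y1(3) dnorm_nonneg[OF ci] by (intro mult_right_mono mult_mono) auto
      finally show "dual_norm P c (hess_xy (psi P) x y1 q - hess_xy (psi P) x c q) \<le> \<bar>l_psi2 C\<bar> * d * norm q" .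
    qed
    finally show ?thesis .
  qed
  obtain t2 where t2: "0 < t2" "t2 < 1"
    "(grad_y (psi P) x (c + w) - grad_y (psi P) x c) \<bullet> v = hess_yy (psi P) x (c + t2 *\<^sub>R w) w \<bullet> v"
    using mvt_inner[of "grad_y (psi P) x" "hess_yy (psi P) x" c w v] psi_yy_derivative seg_i by blast
  define y2 where "y2 = c + t2 *\<^sub>R w"
  have y2: "y2 \<in> dikin_tube P (2 * \<eta>) c" "dnorm P c (y2 - c) \<le> d"
    using t2 seg[of t2] seg_d[of t2] by (auto simp: y2_def)
  have gk: "grad_y (psi P) x k = - (1 / lam) *\<^sub>R grad_y (upper P) x k"
  proof -
    have "(1 / lam) *\<^sub>R (grad_y (upper P) x k + lam *\<^sub>R grad_y (psi P) x k) = 0"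
      using penalised_grad_yl[OF lp, of x] by (simp add: penalised_grad_def k_def)
    then show ?thesis using lp by (simp add: scaleR_add_right add_eq_0_iff)
  qed
  have e2: "hess_xy (psi P) x c q \<bullet> w \<le> (1 / lam) * (grad_y (upper P) x k \<bullet> v) + \<bar>l_psi2 C\<bar> * d * d * dnorm P c v"
  proof -
    have "hess_xy (psi P) x c q \<bullet> w = - (hess_yy (psi P) x c w \<bullet> v)"
      using J_equation[of x q] hess_yy_psi_symmetric[OF ci, of x v w]
      by (simp add: c_def v_def add_eq_0_iff2 inner_commute)
    also have "\<dots> = - (hess_yy (psi P) x y2 w \<bullet> v) + (hess_yy (psi P) x y2 w - hess_yy (psi P) x c w) \<bullet> v"
      by (simp add: inner_diff_left)
    also have "hess_yy (psi P) x y2 w \<bullet> v = - (1 / lam) * (grad_y (upper P) x k \<bullet> v)"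
      using t2(3) grad_y_psi_ystar[of x] unfolding kw y2_def[symmetric] c_def[symmetric] by (simp add: gk)
    also have "(hess_yy (psi P) x y2 w - hess_yy (psi P) x c w) \<bullet> v
      \<le> dual_norm P c (hess_yy (psi P) x y2 w - hess_yy (psi P) x c w) * dnorm P c v"
      using dual_pairing[OF ci] by (rule abs_le_D1)
    also have "\<dots> \<le> (\<bar>l_psi2 C\<bar> * d * d) * dnorm P c v"
    proof (intro mult_right_mono vn)
      have "dual_norm P c (hess_yy (psi P) x y2 w - hess_yy (psi P) x c w) \<le> l_psi2 C * dnorm P c (y2 - c) * dnorm P c w"
        by (rule psi_yy_diff[OF cc y2(1) ct])
      also have "\<dots> \<le> \<bar>l_psi2 C\<bar> * d * d"
        unfolding d_def[symmetric] using y2(2) d(1) dnorm_nonneg[OF ci] by (intro mult_right_mono mult_mono) auto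
      finally show "dual_norm P c (hess_yy (psi P) x y2 w - hess_yy (psi P) x c w) \<le> \<bar>l_psi2 C\<bar> * d * d" .
    qed
    finally show ?thesis by simp
  qed
  obtain t3 where t3: "0 < t3" "t3 < 1"
    "(grad_y (upper P) x (c + w) - grad_y (upper P) x c) \<bullet> v = hess_yy (upper P) x (c + t3 *\<^sub>R w) w \<bullet> v"
    using mvt_inner[of "grad_y (upper P) x" "hess_yy (upper P) x" c w v] has_derivative_hess_yy[OF C2_upper] by blast
  have e3: "(grad_y (upper P) x k - grad_y (upper P) x c) \<bullet> v \<le> d_f1 C * d * dnorm P c v"
  proof -
    have y3: "c + t3 *\<^sub>R w \<in> dikin_tube P (2 * \<eta>) c" using seg t3 by simp
    have "(grad_y (upper P) x k - grad_y (upper P) x c) \<bullet> v \<le> dual_norm P c (hess_yy (upper P) x (c + t3 *\<^sub>R w) w) * dnorm P c v"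
      using t3(3) abs_le_D1[OF dual_pairing[OF ci]] by (simp add: kw)
    also have "\<dots> \<le> (d_f1 C * dnorm P c w) * dnorm P c v"
      by (intro mult_right_mono f_yy_bound[OF cc y3] vn)
    finally show ?thesis by (simp add: d_def)
  qed
  have "(norm q)\<^sup>2 = q \<bullet> q" by (simp add: power2_norm_eq_inner)
  also have "\<dots> = (grad_x (upper P) x k - grad_x (upper P) x c) \<bullet> q
      + lam * ((grad_x (lower P) x k - grad_x (lower P) x c) \<bullet> q) - grad_y (upper P) x c \<bullet> v"
  proof -
    have "q \<bullet> q = grad_est lam x k c \<bullet> q - grad (Fmu P) x \<bullet> q" by (subst (2) q_def) (simp add: inner_diff_right inner_commute)
    then show ?thesis unfolding grad_Fmu by (simp add: grad_est_def inner_simps c_def v_def)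
  qed
  also have "\<dots> \<le> d_f1 C * d * norm q + lam * ((1 / lam) * (grad_y (upper P) x k \<bullet> v) + \<bar>l_psi2 C\<bar> * d * d * dnorm P c v
      + \<bar>l_psi2 C\<bar> * d * norm q * d) - grad_y (upper P) x c \<bullet> v"
    using e0 e1 e2 lp by (intro diff_right_mono add_mono mult_left_mono) auto
  also have "\<dots> = d_f1 C * d * norm q + (grad_y (upper P) x k - grad_y (upper P) x c) \<bullet> v
      + lam * \<bar>l_psi2 C\<bar> * d\<^sup>2 * (dnorm P c v + norm q)"
    using lp by (simp add: inner_diff_left power2_eq_square algebra_simps)
  also have "\<dots> \<le> d_f1 C * d * norm q + d_f1 C * d * dnorm P c v + lam * \<bar>l_psi2 C\<bar> * d\<^sup>2 * (dnorm P c v + norm q)"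
    using e3 by simp
  also have "\<dots> = (d_f1 C * d + lam * \<bar>l_psi2 C\<bar> * d\<^sup>2) * (dnorm P c v + norm q)"
    by (simp add: algebra_simps)
  also have "\<dots> \<le> (d_f1 C * (K0 / lam) + lam * \<bar>l_psi2 C\<bar> * (K0 / lam)\<^sup>2) * (l_star0 C * norm q + norm q)"
    using d d_f1_nonneg lp vb vn K0_nonneg by (intro mult_mono add_mono mult_left_mono power_mono) auto
  also have "\<dots> = K2 / lam * norm q"
    using lp by (simp add: K2_def power2_eq_square field_simps)
  finally have "norm q * norm q \<le> K2 / lam * norm q" by (simp add: power2_eq_square)
  then have "norm q \<le> K2 / lam"
    by (rule le_of_square_le) (use K2_nonneg lp in simp_all)
  then show ?thesis by (simp add: q_def c_def k_def)
qed

text \<open>Away from the centres the estimate changes at the rate \<open>lam \<l>\<close> in either tracker, because the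
  \<open>x\<close>-gradient of the lower objective is Lipschitz in the local metrics; the change of the \<open>x\<close>-gradient of
  the upper objective is smaller, as \<open>d_f1 \<le> lam \<l>\<close>.\<close>

lemma bias_bound:
  assumes lg: "large lam" and y: "y \<in> dikin_tube P \<eta> (yl lam x)" and z: "z \<in> tube P \<eta> x"
  shows "norm (grad_est lam x y z - grad (Fmu P) x)
    \<le> K2 / lam + 2 * lam * \<l> * dnorm P (yl lam x) (y - yl lam x) + lam * \<l> * dnorm P (ys x) (z - ys x)"
proof -
  have lam: "lam0 \<le> lam" using lg by (simp add: large_def)
  have lp: "0 < lam" using lam lam0_pos by linarith
  let ?k = "yl lam x" and ?c = "ys x"
  let ?r = "dnorm P ?k (y - ?k)" and ?p = "dnorm P ?c (z - ?c)"
  have rn: "0 \<le> ?r" by (rule dnorm_nonneg[OF yl_inside[OF lp]])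
  have kt: "?k \<in> dikin_tube P (2 * \<eta>) ?k" "?c \<in> tube P (2 * \<eta>) x"
    using centre_in_tube[OF yl_inside[OF lp]] centre_in_tube[OF ystar_inside] eta_pos by auto
  have yt: "y \<in> dikin_tube P (2 * \<eta>) ?k" "z \<in> tube P (2 * \<eta>) x"
    using y z eta_pos by (auto simp: dikin_tube_def)
  have 1: "norm (grad_x (upper P) x y - grad_x (upper P) x ?k) \<le> d_f1 C * ?r"
    by (rule grad_x_upper_lipschitz[OF centre_yl[OF lam] kt(1) yt(1)])
  have 2: "norm (grad_x (lower P) x y - grad_x (lower P) x ?k) \<le> \<l> * ?r"
    by (rule grad_x_lower_lipschitz[OF centre_yl[OF lam] kt(1) yt(1)])
  have 3: "norm (grad_x (lower P) x z - grad_x (lower P) x ?c) \<le> \<l> * ?p"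
    by (rule grad_x_lower_lipschitz[OF centre_ys kt(2) yt(2)])
  have "d_f1 C \<le> lam * \<l>"
    using lam_rho_f1[OF lam] mult_left_mono[OF rho_le_l, of lam] lp rho_pos mult_pos_pos[OF lp rho_pos] by linarith
  then have 4: "d_f1 C * ?r \<le> lam * \<l> * ?r" using rn by (rule mult_right_mono)
  have "grad_est lam x y z - grad (Fmu P) x = (grad_est lam x ?k ?c - grad (Fmu P) x)
      + ((grad_x (upper P) x y - grad_x (upper P) x ?k)
      + (lam *\<^sub>R (grad_x (lower P) x y - grad_x (lower P) x ?k) - lam *\<^sub>R (grad_x (lower P) x z - grad_x (lower P) x ?c)))"
    by (simp add: grad_est_def algebra_simps)
  then have "norm (grad_est lam x y z - grad (Fmu P) x) \<le> norm (grad_est lam x ?k ?c - grad (Fmu P) x)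
      + (norm (grad_x (upper P) x y - grad_x (upper P) x ?k)
      + (norm (lam *\<^sub>R (grad_x (lower P) x y - grad_x (lower P) x ?k))
        + norm (lam *\<^sub>R (grad_x (lower P) x z - grad_x (lower P) x ?c))))"
    by (metis (no_types, lifting) norm_triangle_mono norm_triangle_ineq norm_triangle_ineq4 order_refl)
  also have "\<dots> \<le> K2 / lam + (lam * \<l> * ?r + (lam * (\<l> * ?r) + lam * (\<l> * ?p)))"
    using bias_at_centres[OF lg, of x] 1 2 3 4 lp by (intro add_mono) (auto intro: order_trans)
  finally show ?thesis by (simp add: mult_ac)
qed

end

section \<open>One outer iteration\<close>

text \<open>\<open>1 - (1 - u)\<^sup>n\<close> is concave in \<open>u\<close> and vanishes at \<open>0\<close>. The frozen metric degrades the contraction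
  rate by a constant factor \<open>s\<close>; this turns the loss in the rate into the same loss in the total
  contraction of an inner loop, in which the closure conditions are stated.\<close>

lemma power_interpolation:
  fixes s u :: real
  assumes "0 \<le> s" "s \<le> 1" "0 \<le> u" "u \<le> 1"
  shows "(1 - s * u) ^ n \<le> 1 - s * (1 - (1 - u) ^ n)"
proof (induction n)
  case (Suc n)
  define v where "v = (1 - u) ^ n"
  have v: "v \<le> 1" using assms by (simp add: v_def power_le_one)
  have su: "0 \<le> s * u" "s * u \<le> 1" using assms by (auto simp: mult_le_one)
  have "(1 - s * u) ^ Suc n \<le> (1 - s * u) * (1 - s * (1 - v))"
    using mult_left_mono[OF Suc, of "1 - s * u"] su by (simp add: v_def)
  also have "\<dots> = 1 - s * (1 - (1 - u) * v) - s * u * ((1 - s) * (1 - v))" by (simp add: algebra_simps)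
  also have "\<dots> \<le> 1 - s * (1 - (1 - u) * v)" using su assms v by simp
  finally show ?case by (simp add: v_def)
qed simp

lemma one_minus_power_le:
  fixes u :: real
  assumes "u \<le> 1" shows "1 - (1 - u) ^ n \<le> real n * u"
  using Bernoulli_inequality[of "- u" n] assms by simp

lemma power_le_inverse:
  fixes u :: real
  assumes "0 \<le> u" "u \<le> 1" shows "(1 - u) ^ n * (1 + real n * u) \<le> 1"
proof -
  have "(1 - u) ^ n * (1 + real n * u) \<le> (1 - u) ^ n * (1 + u) ^ n"
    using Bernoulli_inequality[of u n] assms by (intro mult_left_mono) auto
  also have "\<dots> = (1 - u * u) ^ n" by (simp add: power_mult_distrib[symmetric] algebra_simps)
  also have "\<dots> \<le> 1" using assms by (intro power_le_one) (auto simp: mult_le_one)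
  finally show ?thesis .
qed

text \<open>The multipliers and step sizes enter only through the barrier-aware and tube-closure
  conditions.\<close>

locale schedule = dikin_problem P R yl C \<eta> lam0
  for P :: "('n::finite, 'd::finite, 'm::finite) bilevel" and R :: reg_consts
    and yl :: "real \<Rightarrow> real^'n \<Rightarrow> real^'d" and C :: dikin_consts and \<eta> lam0 :: real +
  fixes T :: nat and \<xi> c\<xi> bfx bfy :: real and \<alpha> \<gamma> lam :: "nat \<Rightarrow> real"
  assumes T: "1 \<le> T" and xi: "0 < \<xi>" and cxi: "c\<xi> \<le> 1 / 1000"
    and alpha_pos: "0 < \<alpha> k" and lam_0: "lam 0 = lam0"
    and aware: "barrier_aware R C \<eta> T \<xi> c\<xi> \<alpha> \<gamma> lam"
    and closure: "tube_closure R C \<eta> T \<xi> bfx bfy \<alpha> \<gamma> lam"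
begin

definition \<beta> :: "nat \<Rightarrow> real" where "\<beta> k = \<alpha> k * lam k"
definition \<Gamma>z :: "nat \<Rightarrow> real" where "\<Gamma>z k = 1 - (1 - \<rho> * \<gamma> k) ^ T"
definition \<Gamma>y :: "nat \<Rightarrow> real" where "\<Gamma>y k = 1 - (1 - 7/8 * \<rho> * \<beta> k) ^ T"
definition \<sigma>b :: real where "\<sigma>b = d_f0 C + bfy"

lemma lam_mono: "lam k \<le> lam (Suc k)"
  using aware by (simp add: barrier_aware_def)

lemma lam_ge: "lam0 \<le> lam k"
  by (induction k) (use lam_0 lam_mono order_trans in \<open>auto intro: order_trans\<close>)

lemma lam_pos: "0 < lam k" using lam_ge[of k] lam0_pos by linarith

lemma beta_pos: "0 < \<beta> k" using alpha_pos lam_pos by (simp add: \<beta>_def)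

lemma beta_gamma: "\<beta> k \<le> \<gamma> k" and gamma_l: "\<gamma> k * \<l> \<le> 1/4" and gamma_T: "real T * \<rho> * \<gamma> k \<le> 1/4"
proof -
  have 1: "\<beta> k \<le> \<gamma> k" "\<gamma> k \<le> 1 / (4 * \<l>)" "\<gamma> k \<le> 1 / (4 * real T * \<rho>)"
    using aware by (auto simp: barrier_aware_def \<beta>_def)
  then show "\<beta> k \<le> \<gamma> k" by simp
  show "\<gamma> k * \<l> \<le> 1/4" using 1(2) l_pos by (simp add: field_simps)
  show "real T * \<rho> * \<gamma> k \<le> 1/4" using 1(3) rho_pos T by (simp add: field_simps)
qed

lemma gamma_pos: "0 < \<gamma> k" using beta_gamma[of k] beta_pos[of k] by linarith

lemma beta_T: "real T * \<rho> * \<beta> k \<le> 1/4"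
proof -
  have "real T * \<rho> * \<beta> k \<le> real T * \<rho> * \<gamma> k"
    using rho_pos by (intro mult_left_mono beta_gamma) simp
  then show ?thesis using gamma_T[of k] by linarith
qed

lemma gamma_rho: "0 \<le> \<rho> * \<gamma> k" "\<rho> * \<gamma> k \<le> 1/4"
proof -
  show "0 \<le> \<rho> * \<gamma> k" using rho_pos gamma_pos[of k] by simp
  then have "1 * (\<rho> * \<gamma> k) \<le> real T * (\<rho> * \<gamma> k)" using T by (intro mult_right_mono) auto
  then show "\<rho> * \<gamma> k \<le> 1/4" using gamma_T[of k] by (simp add: mult.assoc)
qed

lemma beta_rho: "0 \<le> \<rho> * \<beta> k" "\<rho> * \<beta> k \<le> 1/4"
proof -
  have "\<rho> * \<beta> k \<le> \<rho> * \<gamma> k" using rho_pos by (intro mult_left_mono beta_gamma) simp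
  then show "\<rho> * \<beta> k \<le> 1/4" using gamma_rho[of k] by linarith
  show "0 \<le> \<rho> * \<beta> k" using rho_pos beta_pos[of k] by simp
qed

lemma alpha_smooth: "\<alpha> k * (lam k * \<l> + d_f1 C) \<le> 1"
proof -
  have "\<beta> k * \<l> \<le> 1/4" using mult_right_mono[OF beta_gamma[of k], of \<l>] gamma_l[of k] l_pos by linarith
  moreover have "\<alpha> k * d_f1 C \<le> \<alpha> k * (lam k * \<rho> / 2)"
    using lam_rho_f1[OF lam_ge[of k]] alpha_pos[of k] by (intro mult_left_mono) auto
  moreover have "\<alpha> k * (lam k * \<rho> / 2) = \<rho> * \<beta> k / 2" by (simp add: \<beta>_def)
  ultimately show ?thesis using beta_rho[of k] by (simp add: \<beta>_def algebra_simps)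
qed

lemma closure_noise: "real T * \<alpha> k * \<sigma>b \<le> \<eta> / 8 * \<Gamma>y k"
  and closure_z: "l_star0 C * \<xi> * \<beta> k * (bfx / lam0 + 2 * l_g0 R) \<le> \<eta> / 8 * \<Gamma>z k"
  and closure_y: "(real T * d_f0 C / (8 * lam0) + \<xi> * l_lam0 C * (bfx / lam0 + 2 * l_g0 R)) * \<beta> k \<le> \<eta> / 8 * \<Gamma>y k"
  using closure by (auto simp: tube_closure_def Let_def \<beta>_def \<Gamma>z_def \<Gamma>y_def \<sigma>b_def lam_0)

lemma Gammaz_bounds: "0 \<le> \<Gamma>z k" "\<Gamma>z k \<le> 1" "\<Gamma>z k \<le> real T * \<rho> * \<gamma> k"
  using one_minus_power_le[of "\<rho> * \<gamma> k" T] gamma_rho[of k]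
  by (auto simp: \<Gamma>z_def mult.assoc power_le_one)

lemma Gammay_bounds: "0 \<le> \<Gamma>y k" "\<Gamma>y k \<le> 1" "\<Gamma>y k \<le> 7/8 * (real T * \<rho> * \<beta> k)"
  using one_minus_power_le[of "7/8 * \<rho> * \<beta> k" T] beta_rho[of k]
  by (auto simp: \<Gamma>y_def mult.assoc power_le_one)

text \<open>The contraction rates of single inner steps for \<open>z\<close> and \<open>y\<close>.\<close>

definition qz :: "nat \<Rightarrow> real" where "qz k = 3/4 * \<gamma> k * \<rho>"
definition qy :: "nat \<Rightarrow> real" where "qy k = 3/8 * \<beta> k * \<rho>"

lemma qz: "0 \<le> qz k" "qz k \<le> 1" using gamma_rho[of k] by (auto simp: qz_def mult_ac)
lemma qy: "0 \<le> qy k" "qy k \<le> 1" using beta_rho[of k] by (auto simp: qy_def mult_ac)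

lemma qz_power: "(1 - qz k) ^ T \<le> 1 - 3/4 * \<Gamma>z k"
  using power_interpolation[of "3/4" "\<rho> * \<gamma> k" T] gamma_rho[of k] by (simp add: qz_def \<Gamma>z_def mult_ac)

lemma qy_power: "(1 - qy k) ^ T \<le> 1 - 3/7 * \<Gamma>y k"
  using power_interpolation[of "3/7" "7/8 * \<rho> * \<beta> k" T] beta_rho[of k] by (simp add: qy_def \<Gamma>y_def mult_ac)

text \<open>A bound for the distance that the proxy centre moves because \<open>lam\<close> grows.\<close>

definition lam_drift :: "nat \<Rightarrow> real" where
  "lam_drift k = 2 * d_f0 C / \<rho> * \<bar>1 / lam (Suc k) - 1 / lam k\<bar>"

lemma lam_rel: "lam (Suc k) - lam k \<le> (real T * \<rho> * \<beta> k / 16) * lam k"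
  using aware lam_pos[of k] by (simp add: barrier_aware_def \<beta>_def divide_le_eq)

lemma lam_drift_nonneg: "0 \<le> lam_drift k"
  using d_f0_nonneg rho_pos by (simp add: lam_drift_def)

lemma lam_drift_eq: "lam_drift k = 2 * d_f0 C / \<rho> * ((lam (Suc k) - lam k) / (lam k * lam (Suc k)))"
proof -
  have "1 / lam k - 1 / lam (Suc k) = (lam (Suc k) - lam k) / (lam k * lam (Suc k))"
    using lam_pos[of k] lam_pos[of "Suc k"] by (simp add: field_simps)
  moreover have "0 \<le> (lam (Suc k) - lam k) / (lam k * lam (Suc k))"
    using lam_mono[of k] lam_pos[of k] lam_pos[of "Suc k"] by simp
  ultimately show ?thesis by (simp add: lam_drift_def)
qed

lemma lam_drift_le: "lam_drift k \<le> real T * d_f0 C / (8 * lam0) * \<beta> k"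
proof -
  have l: "0 < lam k" "0 < lam (Suc k)" by (rule lam_pos)+
  have "(lam (Suc k) - lam k) / (lam k * lam (Suc k)) \<le> (real T * \<rho> * \<beta> k / 16) * lam k / (lam k * lam (Suc k))"
    using lam_rel l by (intro divide_right_mono) auto
  also have "\<dots> = (real T * \<rho> * \<beta> k / 16) / lam (Suc k)" using l by simp
  also have "\<dots> \<le> (real T * \<rho> * \<beta> k / 16) / lam0"
    using lam_ge[of "Suc k"] lam0_pos beta_pos[of k] rho_pos by (intro divide_left_mono) auto
  finally have "lam_drift k \<le> 2 * d_f0 C / \<rho> * ((real T * \<rho> * \<beta> k / 16) / lam0)"
    unfolding lam_drift_eq using d_f0_nonneg rho_pos by (intro mult_left_mono) auto
  then show ?thesis using rho_pos by (simp add: field_simps)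
qed

end

text \<open>The data of one outer iteration along one trajectory: \<open>g t\<close> and \<open>h\<close> are the sampled gradients,
  and their bounds are only available while the iterates are in the neighbourhoods.\<close>

locale iteration = schedule P R yl C \<eta> lam0 T \<xi> c\<xi> bfx bfy \<alpha> \<gamma> lam
  for P :: "('n::finite, 'd::finite, 'm::finite) bilevel" and R :: reg_consts
    and yl :: "real \<Rightarrow> real^'n \<Rightarrow> real^'d" and C :: dikin_consts and \<eta> lam0 :: real
    and T :: nat and \<xi> c\<xi> bfx bfy :: real and \<alpha> \<gamma> lam :: "nat \<Rightarrow> real" +
  fixes k :: nat and x x' :: "real^'n" and zt yt g :: "nat \<Rightarrow> real^'d" and h :: "real^'n"
  assumes z0: "zt 0 \<in> tube P \<eta> x" and y0: "yt 0 \<in> dikin_tube P \<eta> (yl (lam k) x)"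
    and z_step: "t < T \<Longrightarrow> zt (Suc t) = zt t - \<gamma> k *\<^sub>R inv (Hm (zt 0)) (grad_y (psi P) x (zt t))"
    and y_step: "t < T \<Longrightarrow> yt (Suc t) = yt t - \<alpha> k *\<^sub>R inv (Hm (yt 0)) (g t + lam k *\<^sub>R grad_y (psi P) x (yt t))"
    and x_step: "x' = x - (\<xi> * \<alpha> k) *\<^sub>R (h + lam k *\<^sub>R (grad_x (lower P) x (yt T) - grad_x (lower P) x (zt T)))"
    and g_bound: "t < T \<Longrightarrow> zt t \<in> tube P \<eta> x \<Longrightarrow> yt t \<in> dikin_tube P \<eta> (yl (lam k) x) \<Longrightarrow>
        dual_norm P (yl (lam k) x) (g t) \<le> bfy"
    and h_bound: "zt T \<in> tube P \<eta> x \<Longrightarrow> yt T \<in> dikin_tube P \<eta> (yl (lam k) x) \<Longrightarrow> norm h \<le> bfx"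
begin

abbreviation c where "c \<equiv> ys x"
abbreviation c' where "c' \<equiv> ys x'"
abbreviation m where "m \<equiv> yl (lam k) x"
abbreviation m' where "m' \<equiv> yl (lam (Suc k)) x'"

lemma c_in: "c \<in> inside" and c'_in: "c' \<in> inside" and m_in: "m \<in> inside" and m'_in: "m' \<in> inside"
  by (auto intro: ystar_inside yl_inside lam_pos)

lemma eta1: "\<eta> < 1" using eta_half by simp

lemma z_track: "t \<le> T \<Longrightarrow> zt t \<in> tube P \<eta> x \<and> dnorm P c (zt t - c) \<le> (1 - qz k) ^ t * dnorm P c (zt 0 - c)"
proof (induction t)
  case (Suc t)
  then have IH: "zt t \<in> tube P \<eta> x" "dnorm P c (zt t - c) \<le> (1 - qz k) ^ t * dnorm P c (zt 0 - c)" by auto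
  have "dnorm P c (zt (Suc t) - c) \<le> (1 - 3/4 * \<gamma> k * \<rho>) * dnorm P c (zt t - c)"
    using z_step_contracts[OF z0 IH(1), of "\<gamma> k"] z_step[of t] Suc.prems gamma_pos[of k] gamma_l[of k] by simp
  also have "\<dots> = (1 - qz k) * dnorm P c (zt t - c)" by (simp add: qz_def)
  finally have 1: "dnorm P c (zt (Suc t) - c) \<le> (1 - qz k) * dnorm P c (zt t - c)" .
  also have "\<dots> \<le> 1 * dnorm P c (zt t - c)" using qz dnorm_nonneg[OF c_in] by (intro mult_right_mono) auto
  also have "\<dots> \<le> \<eta>" using IH(1) by (simp add: dikin_tube_def)
  finally have "zt (Suc t) \<in> tube P \<eta> x" by (simp add: dikin_tube_iff[OF c_in eta1])
  moreover have "dnorm P c (zt (Suc t) - c) \<le> (1 - qz k) ^ Suc t * dnorm P c (zt 0 - c)"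
    using 1 mult_left_mono[OF IH(2), of "1 - qz k"] qz[of k] by simp
  ultimately show ?case by simp
qed (use z0 in simp)

text \<open>A \<open>y\<close>-step is a deterministic step \<open>det_step\<close>, taken relative to the centre, minus preconditioned
  noise.\<close>

definition noise :: "nat \<Rightarrow> real^'d" where "noise t = g t - grad_y (upper P) x (yt t)"
definition det_step :: "nat \<Rightarrow> real^'d" where
  "det_step t = yt t - \<alpha> k *\<^sub>R inv (Hm (yt 0)) (penalised_grad (lam k) x (yt t)) - m"

lemma metrics: "two_metrics (Hm m) (Hm (yt 0)) \<theta>" by (rule frozen_metric[OF m_in y0])

lemma y_step_split: "t < T \<Longrightarrow> yt (Suc t) - m = det_step t - \<alpha> k *\<^sub>R inv (Hm (yt 0)) (noise t)"
proof -
  interpret two_metrics "Hm m" "Hm (yt 0)" \<theta> by (rule metrics)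
  assume t: "t < T"
  have "g t + lam k *\<^sub>R grad_y (psi P) x (yt t) = penalised_grad (lam k) x (yt t) + noise t"
    by (simp add: penalised_grad_def noise_def)
  then show ?thesis
    using y_step[OF t] linear_add[OF H0.linear_inv] by (simp add: det_step_def scaleR_add_right)
qed

lemma noise_bound:
  assumes t: "t < T" and y: "yt t \<in> dikin_tube P \<eta> m"
  shows "dual_norm P m (noise t) \<le> \<sigma>b" and "dnorm P m (inv (Hm (yt 0)) (noise t)) \<le> 5/4 * \<sigma>b"
proof -
  interpret two_metrics "Hm m" "Hm (yt 0)" \<theta> by (rule metrics)
  have y2: "yt t \<in> dikin_tube P (2 * \<eta>) m" using y eta_pos by (auto simp: dikin_tube_def)
  have "dual_norm P m (noise t) \<le> dual_norm P m (g t) + dual_norm P m (grad_y (upper P) x (yt t))"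
    unfolding noise_def by (rule dual_norm_triangle_diff[OF m_in])
  also have "\<dots> \<le> bfy + d_f0 C"
    using g_bound[OF t _ y] z_track[of t] t f_y_bound[OF centre_yl[OF lam_ge] y2] by (intro add_mono) auto
  finally show 1: "dual_norm P m (noise t) \<le> \<sigma>b" by (simp add: \<sigma>b_def)
  have "dnorm P m (inv (Hm (yt 0)) (noise t)) \<le> (1 + \<theta>) * dual_norm P m (noise t)"
    using N_inv0 by (simp add: dnorm_N[OF m_in] dual_norm_Nd[OF m_in])
  also have "\<dots> \<le> 5/4 * \<sigma>b"
    using 1 theta_quarter theta_nonneg dual_norm_nonneg[OF m_in] by (intro mult_mono) (auto intro: order_trans)
  finally show "dnorm P m (inv (Hm (yt 0)) (noise t)) \<le> 5/4 * \<sigma>b" .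
qed

lemma sigma_nonneg: "0 \<le> \<sigma>b"
  using noise_bound(1)[of 0] T y0 dual_norm_nonneg[OF m_in, of "noise 0"] by simp

lemma det_step_bound:
  assumes y: "yt t \<in> dikin_tube P \<eta> m"
  shows "dnorm P m (det_step t) \<le> (1 - qy k) * dnorm P m (yt t - m)"
  using y_step_contracts[OF lam_ge y0 y less_imp_le[OF alpha_pos] alpha_smooth]
  by (simp add: det_step_def qy_def \<beta>_def mult_ac)

text \<open>The noise of one step is no larger than what the contraction removes at the boundary of the
  neighbourhood: \<open>5/4 * 1/8 * 7/8 \<le> 3/8\<close>.\<close>

lemma noise_step: "\<alpha> k * (5/4 * \<sigma>b) \<le> qy k * \<eta>"
proof -
  have "\<eta> / 8 * \<Gamma>y k \<le> \<eta> / 8 * (7/8 * (real T * \<rho> * \<beta> k))"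
    using eta_pos by (intro mult_left_mono Gammay_bounds(3)) simp
  then have "real T * (\<alpha> k * \<sigma>b) \<le> \<eta> / 8 * (7/8 * (real T * \<rho> * \<beta> k))"
    using closure_noise[of k] by (simp only: mult.assoc)
  also have "\<dots> = real T * (7/64 * (\<eta> * \<rho> * \<beta> k))" by simp
  finally have "\<alpha> k * \<sigma>b \<le> 7/64 * (\<eta> * \<rho> * \<beta> k)" using T by (simp only: mult_le_cancel_left_pos of_nat_0_less_iff)
  moreover have "0 \<le> \<eta> * \<rho> * \<beta> k" using eta_pos rho_pos beta_pos[of k] by simp
  ultimately have "5/4 * (\<alpha> k * \<sigma>b) \<le> 3/8 * (\<eta> * \<rho> * \<beta> k)" by linarith
  then show ?thesis by (simp add: qy_def mult_ac)
qed

lemma y_track: "t \<le> T \<Longrightarrow> yt t \<in> dikin_tube P \<eta> m \<and>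
  dnorm P m (yt t - m) \<le> (1 - qy k) ^ t * \<eta> + real t * (\<alpha> k * (5/4 * \<sigma>b))"
proof (induction t)
  case 0
  then show ?case using y0 by (simp add: dikin_tube_def)
next
  case (Suc t)
  define s where "s = \<alpha> k * (5/4 * \<sigma>b)"
  have s: "0 \<le> s" using alpha_pos[of k] sigma_nonneg by (simp add: s_def)
  have t: "t < T" using Suc.prems by simp
  have IH: "yt t \<in> dikin_tube P \<eta> m" "dnorm P m (yt t - m) \<le> (1 - qy k) ^ t * \<eta> + real t * s"
    using Suc by (auto simp: s_def)
  have "dnorm P m (yt (Suc t) - m) \<le> dnorm P m (det_step t) + dnorm P m (\<alpha> k *\<^sub>R inv (Hm (yt 0)) (noise t))"
    unfolding y_step_split[OF t] by (rule dnorm_triangle_diff[OF m_in])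
  also have "\<dots> \<le> (1 - qy k) * dnorm P m (yt t - m) + s"
    using det_step_bound[OF IH(1)] noise_bound(2)[OF t IH(1)] alpha_pos[of k]
    by (intro add_mono) (auto simp: dnorm_scale[OF m_in] s_def)
  finally have 1: "dnorm P m (yt (Suc t) - m) \<le> (1 - qy k) * dnorm P m (yt t - m) + s" .
  also have "\<dots> \<le> (1 - qy k) * \<eta> + qy k * \<eta>"
    using IH(1) qy[of k] noise_step by (intro add_mono mult_left_mono) (auto simp: dikin_tube_def s_def)
  also have "\<dots> = \<eta>" by (simp add: algebra_simps)
  finally have "yt (Suc t) \<in> dikin_tube P \<eta> m" by (simp add: dikin_tube_iff[OF m_in eta1])
  moreover have "(1 - qy k) * dnorm P m (yt t - m) + s \<le> (1 - qy k) ^ Suc t * \<eta> + real (Suc t) * s"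
  proof -
    have "(1 - qy k) * dnorm P m (yt t - m) \<le> (1 - qy k) * ((1 - qy k) ^ t * \<eta> + real t * s)"
      using IH(2) qy[of k] by (intro mult_left_mono) auto
    also have "\<dots> = (1 - qy k) ^ Suc t * \<eta> + (1 - qy k) * (real t * s)" by (simp add: algebra_simps)
    also have "\<dots> \<le> (1 - qy k) ^ Suc t * \<eta> + 1 * (real t * s)"
      using qy[of k] s by (intro add_left_mono mult_right_mono) auto
    finally show ?thesis by (simp add: algebra_simps)
  qed
  ultimately show ?case using 1 by (auto simp: s_def intro: order_trans)
qed

lemma z_end: "zt T \<in> tube P \<eta> x" and y_end: "yt T \<in> dikin_tube P \<eta> m"
  using z_track[of T] y_track[of T] by auto

lemma bfx_nonneg: "0 \<le> bfx" using h_bound[OF z_end y_end] norm_ge_zero order_trans by blast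

definition shift :: real where "shift = \<xi> * \<beta> k * (bfx / lam0 + 2 * l_g0 R)"

lemma x_shift: "norm (x' - x) \<le> shift"
proof -
  have g2: "norm (grad_x (lower P) x (yt T) - grad_x (lower P) x (zt T)) \<le> 2 * l_g0 R"
  proof -
    have "norm (grad_x (lower P) x y) \<le> l_g0 R" for y using regular by (simp add: objective_regularity_def)
    from this[of "yt T"] this[of "zt T"] show ?thesis
      using norm_triangle_ineq4[of "grad_x (lower P) x (yt T)" "grad_x (lower P) x (zt T)"] by linarith
  qed
  have "norm (x' - x) = \<xi> * \<alpha> k * norm (h + lam k *\<^sub>R (grad_x (lower P) x (yt T) - grad_x (lower P) x (zt T)))"
    unfolding x_step using xi alpha_pos[of k] by simp
  also have "\<dots> \<le> \<xi> * \<alpha> k * (bfx + lam k * (2 * l_g0 R))"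
  proof (rule mult_left_mono)
    have "norm (h + lam k *\<^sub>R (grad_x (lower P) x (yt T) - grad_x (lower P) x (zt T)))
      \<le> norm h + lam k * norm (grad_x (lower P) x (yt T) - grad_x (lower P) x (zt T))"
      using norm_triangle_ineq[of h] lam_pos[of k] by (smt (verit) norm_scaleR)
    also have "\<dots> \<le> bfx + lam k * (2 * l_g0 R)"
      using h_bound[OF z_end y_end] g2 lam_pos[of k] by (intro add_mono mult_left_mono) auto
    finally show "norm (h + lam k *\<^sub>R (grad_x (lower P) x (yt T) - grad_x (lower P) x (zt T)))
      \<le> bfx + lam k * (2 * l_g0 R)" .
  qed (use xi alpha_pos[of k] in simp)
  also have "\<dots> \<le> \<xi> * \<alpha> k * (lam k * (bfx / lam0) + lam k * (2 * l_g0 R))"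
  proof (intro mult_left_mono add_right_mono)
    have "bfx * lam0 \<le> bfx * lam k" using lam_ge bfx_nonneg by (rule mult_left_mono)
    then show "bfx \<le> lam k * (bfx / lam0)" using lam0_pos by (simp add: field_simps)
  qed (use xi alpha_pos[of k] in simp)
  also have "\<dots> = shift" by (simp add: shift_def \<beta>_def algebra_simps)
  finally show ?thesis .
qed

lemma c_drift: "dnorm P c (c' - c) \<le> \<eta> / 8 * \<Gamma>z k"
proof -
  have "dnorm P c (c' - c) \<le> l_star0 C * norm (x' - x)" by (rule ys_lipschitz)
  also have "\<dots> \<le> l_star0 C * shift" using x_shift l_star0_ge1 by (intro mult_left_mono) auto
  also have "\<dots> \<le> \<eta> / 8 * \<Gamma>z k" using closure_z[of k] by (simp add: shift_def mult_ac)
  finally show ?thesis .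
qed

lemma m_drift_sum: "lam_drift k + l_lam0 C * norm (x' - x) \<le> \<eta> / 8 * \<Gamma>y k"
proof -
  have "lam_drift k + l_lam0 C * norm (x' - x) \<le> real T * d_f0 C / (8 * lam0) * \<beta> k + l_lam0 C * shift"
    using x_shift l_lam0_nonneg lam_drift_le by (intro add_mono mult_left_mono) auto
  also have "\<dots> \<le> \<eta> / 8 * \<Gamma>y k" using closure_y[of k] by (simp add: shift_def algebra_simps)
  finally show ?thesis .
qed

lemma m_drift: "dnorm P m (m' - m) \<le> \<eta> / 8 * \<Gamma>y k"
  using yl_lipschitz[OF lam_ge lam_ge, of k x "Suc k" x'] m_drift_sum by (simp add: lam_drift_def)

lemma eta_Gz: "\<eta> / 8 * \<Gamma>z k \<le> 1/72" and eta_Gy: "\<eta> / 8 * \<Gamma>y k \<le> 1/72"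
proof -
  have "\<eta> / 8 * \<Gamma>z k \<le> (1/72) * 1" "\<eta> / 8 * \<Gamma>y k \<le> (1/72) * 1"
    using eta_ninth eta_pos Gammaz_bounds[of k] Gammay_bounds[of k] by (intro mult_mono; simp)+
  then show "\<eta> / 8 * \<Gamma>z k \<le> 1/72" "\<eta> / 8 * \<Gamma>y k \<le> 1/72" by auto
qed

text \<open>The inner loop has to leave a quarter of \<open>\<eta> G\<close> free: an eighth pays for the distance to the new
  centre, and the rest for the change of the metric.\<close>

lemma tube_moves:
  assumes c: "c1 \<in> inside" and d: "dnorm P c1 (c2 - c1) \<le> \<eta> / 8 * G" and G: "0 \<le> G" "G \<le> 1"
    and w: "dnorm P c1 (w - c1) \<le> \<eta> - 1/4 * \<eta> * G"
  shows "w \<in> dikin_tube P \<eta> c2"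
proof -
  have e: "0 < \<eta>" "\<eta> \<le> 1/9" using eta_pos eta_ninth by auto
  have dl: "\<eta> / 8 * G \<le> 1/72" using mult_mono[of "\<eta> / 8" "1/72" G 1] e G by simp
  have d1: "\<eta> / 8 * G < 1" using dl by linarith
  have c2: "c2 \<in> inside" by (rule dikin_ball(1)[OF c d d1])
  have "dnorm P c2 (w - c2) \<le> dnorm P c1 (w - c2) / (1 - \<eta> / 8 * G)"
    by (rule dnorm_change_centre(1)[OF c d d1])
  also have "\<dots> \<le> \<eta>"
  proof -
    have "dnorm P c1 (w - c2) \<le> dnorm P c1 (w - c1) + dnorm P c1 (c2 - c1)"
      using dnorm_triangle_diff[OF c, of "w - c1" "c2 - c1"] by simp
    also have "\<dots> \<le> \<eta> - 1/8 * (\<eta> * G)" using w d by simp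
    also have "\<dots> \<le> \<eta> - \<eta> * (1/8 * (\<eta> * G))"
      using mult_right_mono[of \<eta> 1 "1/8 * (\<eta> * G)"] e G by simp
    also have "\<dots> = \<eta> * (1 - \<eta> / 8 * G)" by (simp add: algebra_simps)
    finally have "dnorm P c1 (w - c2) \<le> \<eta> * (1 - \<eta> / 8 * G)" .
    moreover have "0 < 1 - \<eta> / 8 * G" using d1 by linarith
    ultimately show ?thesis by (simp only: pos_divide_le_eq)
  qed
  finally show ?thesis by (simp add: dikin_tube_iff[OF c2 eta1])
qed

lemma next_z: "zt T \<in> tube P \<eta> x'"
proof (rule tube_moves[OF c_in c_drift Gammaz_bounds(1,2)])
  have "dnorm P c (zt T - c) \<le> (1 - qz k) ^ T * dnorm P c (zt 0 - c)" using z_track[of T] by simp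
  also have "\<dots> \<le> (1 - 3/4 * \<Gamma>z k) * \<eta>"
    using qz_power[of k] z0 Gammaz_bounds[of k] dnorm_nonneg[OF c_in] by (intro mult_mono) (auto simp: dikin_tube_def)
  finally have "dnorm P c (zt T - c) \<le> (1 - 3/4 * \<Gamma>z k) * \<eta>" .
  then show "dnorm P c (zt T - c) \<le> \<eta> - 1/4 * \<eta> * \<Gamma>z k"
    using mult_nonneg_nonneg[OF less_imp_le[OF eta_pos] Gammaz_bounds(1)[of k]] by (simp add: algebra_simps)
qed

lemma next_y: "yt T \<in> dikin_tube P \<eta> m'"
proof (rule tube_moves[OF m_in m_drift Gammay_bounds(1,2)])
  have "(1 - qy k) ^ T * \<eta> \<le> (1 - 3/7 * \<Gamma>y k) * \<eta>"
    using qy_power[of k] eta_pos by (intro mult_right_mono) auto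
  moreover have "real T * (\<alpha> k * (5/4 * \<sigma>b)) \<le> 5/4 * (\<eta> / 8 * \<Gamma>y k)"
    using closure_noise[of k] by (simp add: mult_ac)
  moreover have "dnorm P m (yt T - m) \<le> (1 - qy k) ^ T * \<eta> + real T * (\<alpha> k * (5/4 * \<sigma>b))"
    using y_track[of T] by simp
  ultimately show "dnorm P m (yt T - m) \<le> \<eta> - 1/4 * \<eta> * \<Gamma>y k"
    using mult_nonneg_nonneg[OF less_imp_le[OF eta_pos] Gammay_bounds(1)[of k]] by (simp add: algebra_simps)
qed

text \<open>Up to the factor \<open>- 2 \<alpha>\<close>, the part of the squared distance that is linear in the noise; a vector determined by the past
  is paired with the current noise, so its mean vanishes.\<close>

definition cross :: "nat \<Rightarrow> real" where "cross t = inv (Hm (yt 0)) (Hm m (det_step t)) \<bullet> noise t"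

text \<open>The squared distance splits into the deterministic contraction, a cross term that is linear in
  the noise, and a term of order \<open>\<alpha>\<^sup>2\<close>.\<close>

lemma y_track_sq:
  "t \<le> T \<Longrightarrow> (dnorm P m (yt t - m))\<^sup>2 \<le> (1 - qy k) ^ (2 * t) * (dnorm P m (yt 0 - m))\<^sup>2
    + real t * (\<alpha> k * (5/4 * \<sigma>b))\<^sup>2 - 2 * \<alpha> k * (\<Sum>i<t. (1 - qy k) ^ (2 * (t - 1 - i)) * cross i)"
proof (induction t)
  case (Suc t)
  interpret two_metrics "Hm m" "Hm (yt 0)" \<theta> by (rule metrics)
  have t: "t < T" using Suc.prems by simp
  have yt: "yt t \<in> dikin_tube P \<eta> m" using y_track[of t] t by simp
  define u where "u = det_step t"
  define v where "v = inv (Hm (yt 0)) (noise t)"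
  define S where "S = (\<Sum>i<t. (1 - qy k) ^ (2 * (t - 1 - i)) * cross i)"
  define E where "E = (\<alpha> k * (5/4 * \<sigma>b))\<^sup>2"
  have p: "0 \<le> (1 - qy k)\<^sup>2" "(1 - qy k)\<^sup>2 \<le> 1" using qy[of k] by (auto simp: power_le_one)
  have "yt (Suc t) - m = u + (- (\<alpha> k *\<^sub>R v))" unfolding y_step_split[OF t] by (simp add: u_def v_def)
  then have "(dnorm P m (yt (Suc t) - m))\<^sup>2 = (H.N u)\<^sup>2 + 2 * (Hm m u \<bullet> (- (\<alpha> k *\<^sub>R v))) + (H.N (- (\<alpha> k *\<^sub>R v)))\<^sup>2"
    using H.N_sum_sq[of u "- (\<alpha> k *\<^sub>R v)"] by (simp add: dnorm_N[OF m_in])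
  also have "\<dots> = (dnorm P m u)\<^sup>2 - 2 * \<alpha> k * cross t + (\<alpha> k * dnorm P m v)\<^sup>2"
  proof -
    have "Hm m u \<bullet> v = cross t" unfolding cross_def u_def v_def
      using spd.sym[OF H0.spd_inv] by simp
    then show ?thesis by (simp add: dnorm_N[OF m_in] H.N_minus H.N_scale power_mult_distrib)
  qed
  also have "\<dots> \<le> (1 - qy k)\<^sup>2 * (dnorm P m (yt t - m))\<^sup>2 - 2 * \<alpha> k * cross t + E"
  proof -
    have "(dnorm P m u)\<^sup>2 \<le> ((1 - qy k) * dnorm P m (yt t - m))\<^sup>2"
      unfolding u_def using det_step_bound[OF yt] dnorm_nonneg[OF m_in] by (intro power_mono)
    moreover have "(\<alpha> k * dnorm P m v)\<^sup>2 \<le> E"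
      unfolding v_def E_def using noise_bound(2)[OF t yt] alpha_pos[of k] dnorm_nonneg[OF m_in]
      by (intro power_mono mult_left_mono) auto
    ultimately show ?thesis by (simp add: power_mult_distrib)
  qed
  also have "\<dots> \<le> (1 - qy k)\<^sup>2 * ((1 - qy k) ^ (2 * t) * (dnorm P m (yt 0 - m))\<^sup>2 + real t * E - 2 * \<alpha> k * S)
      - 2 * \<alpha> k * cross t + E"
    using Suc.IH t p by (intro add_right_mono diff_right_mono mult_left_mono) (auto simp: E_def S_def)
  also have "\<dots> = (1 - qy k) ^ (2 * Suc t) * (dnorm P m (yt 0 - m))\<^sup>2 + ((1 - qy k)\<^sup>2 * (real t * E) + E)
      - 2 * \<alpha> k * ((1 - qy k)\<^sup>2 * S + cross t)"
    by (simp add: power2_eq_square algebra_simps)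
  also have "\<dots> \<le> (1 - qy k) ^ (2 * Suc t) * (dnorm P m (yt 0 - m))\<^sup>2 + real (Suc t) * E
      - 2 * \<alpha> k * ((1 - qy k)\<^sup>2 * S + cross t)"
    using mult_right_mono[OF p(2), of "real t * E"] by (simp add: E_def algebra_simps)
  also have "(1 - qy k)\<^sup>2 * S + cross t = (\<Sum>i<Suc t. (1 - qy k) ^ (2 * (Suc t - 1 - i)) * cross i)"
  proof -
    have "(1 - qy k)\<^sup>2 * S = (\<Sum>i<t. (1 - qy k) ^ (2 * (t - i)) * cross i)"
      unfolding S_def sum_distrib_left
    proof (rule sum.cong)
      fix i assume "i \<in> {..<t}"
      then have "2 * (t - i) = 2 + 2 * (t - 1 - i)" by auto
      then show "(1 - qy k)\<^sup>2 * ((1 - qy k) ^ (2 * (t - 1 - i)) * cross i) = (1 - qy k) ^ (2 * (t - i)) * cross i"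
        by (simp only: power_add mult.assoc)
    qed simp
    then show ?thesis by simp
  qed
  finally show ?case by (simp add: E_def)
qed simp

lemma cross_bound: "t < T \<Longrightarrow> \<bar>cross t\<bar> \<le> 5/4 * \<sigma>b"
proof -
  assume t: "t < T"
  interpret two_metrics "Hm m" "Hm (yt 0)" \<theta> by (rule metrics)
  have yt: "yt t \<in> dikin_tube P \<eta> m" using y_track[of t] t by simp
  have "cross t = Hm m (det_step t) \<bullet> inv (Hm (yt 0)) (noise t)"
    unfolding cross_def using spd.sym[OF H0.spd_inv] by simp
  then have "\<bar>cross t\<bar> \<le> dnorm P m (det_step t) * dnorm P m (inv (Hm (yt 0)) (noise t))"
    using dikin_cauchy[OF m_in] by metis
  also have "\<dots> \<le> 1 * (5/4 * \<sigma>b)"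
  proof (intro mult_mono)
    have "dnorm P m (det_step t) \<le> (1 - qy k) * dnorm P m (yt t - m)" by (rule det_step_bound[OF yt])
    also have "\<dots> \<le> 1 * 1"
      using yt eta1 qy[of k] dnorm_nonneg[OF m_in] by (intro mult_mono) (auto simp: dikin_tube_def)
    finally show "dnorm P m (det_step t) \<le> 1" by simp
  qed (use noise_bound(2)[OF t yt] dnorm_nonneg[OF m_in] in auto)
  finally show ?thesis by simp
qed

end

section \<open>The potential decreases up to noise\<close>

text \<open>The bookkeeping of one step. \<open>P\<close>, \<open>R\<close> are the tracking errors after the inner loops, \<open>a\<close>,
  \<open>b\<close> their squares before and \<open>a'\<close>, \<open>b'\<close> after the outer step, \<open>G\<close> and \<open>Q\<close> the norms of the true and
  the estimated gradient. The weight \<open>A\<close> makes the contraction of the trackers, \<open>A \<tau> = 20 s \<Lambda>\<^sup>2\<close>, dominate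
  the bias \<open>s (\<Lambda> P + 2 \<Lambda> R)\<^sup>2 / 2\<close> that they cause, while \<open>A l \<le> \<Lambda> / 50\<close> keeps the drift of their
  targets below the decrease \<open>s Q\<^sup>2 / 2\<close>.\<close>

lemma potential_step:
  fixes s \<tau> \<tau>g A A' D1 D2 P R Q G E a b a' b' F F' gq N1 N2 N3 \<Delta> L KD l \<Lambda> kb nx_max \<omega> ry Ey :: real
  assumes s: "0 < s" and tau: "0 \<le> \<tau>" "\<tau> \<le> \<tau>g" "\<tau>g \<le> 1/4"
    and A: "0 \<le> A" "0 \<le> A'" "A' \<le> (1 + \<tau> / 16) * A"
    and D: "0 \<le> D1" "D1 \<le> 1 + \<tau>g / 16" "0 \<le> D2" "D2 \<le> 1 + \<tau> / 16"
    and nn: "0 \<le> P" "0 \<le> R" "0 \<le> Q" "0 \<le> \<Delta>" "0 \<le> KD" "0 \<le> L" "0 \<le> l" "0 \<le> \<Lambda>" "0 \<le> \<omega>" "0 \<le> E"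
    and hz: "(1 + \<tau>g) * P\<^sup>2 \<le> a"
    and hy: "ry * (R\<^sup>2 - Ey) \<le> b" "1 + 3/5 * \<tau> \<le> ry"
    and weight: "A * \<tau> = 20 * s * \<Lambda>\<^sup>2" and ratio: "A * l \<le> \<Lambda> / 50"
    and a': "a' \<le> D1 * (P\<^sup>2 + 2 * s * l * P * Q + 2 * s * N2 + KD * \<Delta>)"
    and b': "b' \<le> D2 * (R\<^sup>2 + 2 * s * (2 * l) * R * Q + 2 * s * N3 + KD * \<Delta> + 8 * \<omega>)"
    and d: "\<Delta> \<le> 2 * s\<^sup>2 * (Q\<^sup>2 + nx_max\<^sup>2)"
    and F: "F' \<le> F - s * gq - s * N1 + L * \<Delta>" and gq: "G\<^sup>2 / 2 + Q\<^sup>2 / 2 - E\<^sup>2 / 2 \<le> gq"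
    and E: "E \<le> kb + 2 * \<Lambda> * R + \<Lambda> * P"
    and small: "2 * s * (L + 4 * A * KD) \<le> 1/4"
  shows "F' + A' * (a' + b') - (F + A * (a + b)) + s * G\<^sup>2 / 2
    \<le> 3/2 * s * kb\<^sup>2 + 2 * s\<^sup>2 * (L + 4 * A * KD) * nx_max\<^sup>2 + 16 * A * \<omega> + A * ry * Ey
      - s * N1 + A' * D1 * 2 * s * N2 + A' * D2 * 2 * s * N3"
proof -
  define X where "X = \<Lambda> * P"
  define Y where "Y = \<Lambda> * R"
  have XY: "0 \<le> X" "0 \<le> Y" using nn by (auto simp: X_def Y_def)
  have AD: "A' * D1 \<le> A * (1 + \<tau>g / 7)" "A' * D2 \<le> A * (1 + \<tau> / 7)"
  proof -
    have q: "(1 + \<tau> / 16) * (1 + t / 16) \<le> 1 + t / 7" if "\<tau> \<le> t" "t \<le> 1/4" for t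
    proof -
      have "\<tau> * t \<le> (1/4) * t" using that tau by (intro mult_right_mono) auto
      then show ?thesis using that tau by (simp add: algebra_simps)
    qed
    have "A' * D1 \<le> ((1 + \<tau> / 16) * A) * (1 + \<tau>g / 16)" using A D tau by (intro mult_mono) auto
    also have "\<dots> = A * ((1 + \<tau> / 16) * (1 + \<tau>g / 16))" by simp
    also have "\<dots> \<le> A * (1 + \<tau>g / 7)" using A(1) q tau by (intro mult_left_mono) auto
    finally show "A' * D1 \<le> A * (1 + \<tau>g / 7)" .
    have "A' * D2 \<le> ((1 + \<tau> / 16) * A) * (1 + \<tau> / 16)" using A D tau by (intro mult_mono) auto
    also have "\<dots> = A * ((1 + \<tau> / 16) * (1 + \<tau> / 16))" by simp
    also have "\<dots> \<le> A * (1 + \<tau> / 7)" using A(1) q tau by (intro mult_left_mono) auto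
    finally show "A' * D2 \<le> A * (1 + \<tau> / 7)" .
  qed
  have AD2: "A' * D1 \<le> 2 * A" "A' * D2 \<le> 2 * A"
  proof -
    have "A * (1 + \<tau>g / 7) \<le> A * 2" "A * (1 + \<tau> / 7) \<le> A * 2" using A(1) tau by (intro mult_left_mono; simp)+
    then show "A' * D1 \<le> 2 * A" "A' * D2 \<le> 2 * A" using AD by auto
  qed
  have AD0: "0 \<le> A' * D1" "0 \<le> A' * D2" using A D by auto
  have sX: "s * X\<^sup>2 = A * \<tau> / 20 * P\<^sup>2" "s * Y\<^sup>2 = A * \<tau> / 20 * R\<^sup>2"
    by (simp_all add: weight X_def Y_def power_mult_distrib)
  have z1: "A' * D1 * P\<^sup>2 - A * a \<le> - 10 * (s * X\<^sup>2)"
  proof -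
    have "A' * D1 * P\<^sup>2 \<le> A * (1 + \<tau>g / 7) * P\<^sup>2" using AD by (intro mult_right_mono) auto
    moreover have "A * ((1 + \<tau>g) * P\<^sup>2) \<le> A * a" using hz A(1) by (intro mult_left_mono)
    moreover have "(1/2) * \<tau> * (A * P\<^sup>2) \<le> (6/7) * \<tau>g * (A * P\<^sup>2)" using tau A by (intro mult_right_mono) auto
    ultimately show ?thesis unfolding sX by (simp add: algebra_simps)
  qed
  have y1: "A' * D2 * R\<^sup>2 - A * b \<le> - 9 * (s * Y\<^sup>2) + A * ry * Ey"
  proof -
    have "A' * D2 * R\<^sup>2 \<le> A * (1 + \<tau> / 7) * R\<^sup>2" using AD by (intro mult_right_mono) auto
    moreover have "A * (ry * (R\<^sup>2 - Ey)) \<le> A * b" using hy A(1) by (intro mult_left_mono)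
    moreover have "(1 + 3/5 * \<tau>) * (A * R\<^sup>2) \<le> ry * (A * R\<^sup>2)" using hy A by (intro mult_right_mono) auto
    moreover have "0 \<le> \<tau> * (A * R\<^sup>2)" using tau A by simp
    ultimately show ?thesis unfolding sX by (simp add: algebra_simps)
  qed
  have sq: "X * Q \<le> (X\<^sup>2 + Q\<^sup>2) / 2" "Y * Q \<le> (Y\<^sup>2 + Q\<^sup>2) / 2"
    using sum_squares_bound[of X Q] sum_squares_bound[of Y Q] by auto
  have z2: "A' * D1 * (2 * s * l * P * Q) \<le> s * (4/100 * (X\<^sup>2 + Q\<^sup>2))"
  proof -
    have "A' * D1 * (2 * s * l * P * Q) \<le> 2 * A * (2 * s * l * P * Q)" using AD2 s nn by (intro mult_right_mono) auto
    also have "\<dots> = (A * l) * (4 * s * P * Q)" by simp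
    also have "\<dots> \<le> \<Lambda> / 50 * (4 * s * P * Q)" using ratio s nn by (intro mult_right_mono) auto
    also have "\<dots> = s * (8/100 * (X * Q))" by (simp add: X_def)
    also have "\<dots> \<le> s * (8/100 * ((X\<^sup>2 + Q\<^sup>2) / 2))" using sq s by (intro mult_left_mono) auto
    also have "\<dots> = s * (4/100 * (X\<^sup>2 + Q\<^sup>2))" by simp
    finally show ?thesis .
  qed
  have y2: "A' * D2 * (2 * s * (2 * l) * R * Q) \<le> s * (8/100 * (Y\<^sup>2 + Q\<^sup>2))"
  proof -
    have "A' * D2 * (2 * s * (2 * l) * R * Q) \<le> 2 * A * (2 * s * (2 * l) * R * Q)" using AD2 s nn by (intro mult_right_mono) auto
    also have "\<dots> = (A * l) * (8 * s * R * Q)" by simp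
    also have "\<dots> \<le> \<Lambda> / 50 * (8 * s * R * Q)" using ratio s nn by (intro mult_right_mono) auto
    also have "\<dots> = s * (16/100 * (Y * Q))" by (simp add: Y_def)
    also have "\<dots> \<le> s * (16/100 * ((Y\<^sup>2 + Q\<^sup>2) / 2))" using sq s by (intro mult_left_mono) auto
    also have "\<dots> = s * (8/100 * (Y\<^sup>2 + Q\<^sup>2))" by simp
    finally show ?thesis .
  qed
  have o2: "A' * D2 * (8 * \<omega>) \<le> 16 * A * \<omega>"
    using mult_right_mono[OF AD2(2), of "8 * \<omega>"] nn by simp
  have D3: "L * \<Delta> + A' * D1 * (KD * \<Delta>) + A' * D2 * (KD * \<Delta>) \<le> s * (Q\<^sup>2 / 4) + 2 * s\<^sup>2 * (L + 4 * A * KD) * nx_max\<^sup>2"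
  proof -
    have "A' * D1 * (KD * \<Delta>) \<le> 2 * A * (KD * \<Delta>)" "A' * D2 * (KD * \<Delta>) \<le> 2 * A * (KD * \<Delta>)"
      using AD2 nn by (intro mult_right_mono; simp)+
    then have "L * \<Delta> + A' * D1 * (KD * \<Delta>) + A' * D2 * (KD * \<Delta>) \<le> (L + 4 * A * KD) * \<Delta>"
      by (simp add: algebra_simps)
    also have "\<dots> \<le> (L + 4 * A * KD) * (2 * s\<^sup>2 * (Q\<^sup>2 + nx_max\<^sup>2))" using d nn A by (intro mult_left_mono) auto
    also have "\<dots> = s * ((2 * s * (L + 4 * A * KD)) * Q\<^sup>2) + 2 * s\<^sup>2 * (L + 4 * A * KD) * nx_max\<^sup>2"
      by (simp add: power2_eq_square algebra_simps)
    also have "s * ((2 * s * (L + 4 * A * KD)) * Q\<^sup>2) \<le> s * ((1/4) * Q\<^sup>2)"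
      using small s by (intro mult_left_mono mult_right_mono) auto
    finally show ?thesis by simp
  qed
  have E2: "E\<^sup>2 \<le> 3 * kb\<^sup>2 + 12 * Y\<^sup>2 + 3 * X\<^sup>2"
  proof -
    have "E\<^sup>2 \<le> (kb + 2 * Y + X)\<^sup>2" using E nn by (intro power_mono) (auto simp: X_def Y_def mult_ac)
    also have "\<dots> \<le> 3 * (kb\<^sup>2 + (2 * Y)\<^sup>2 + X\<^sup>2)"
      using sum_squares_bound[of kb "2 * Y"] sum_squares_bound[of kb X] sum_squares_bound[of "2 * Y" X]
      by (simp add: power2_eq_square algebra_simps)
    finally show ?thesis by (simp add: power_mult_distrib)
  qed
  have F2: "F' - F + s * G\<^sup>2 / 2 \<le> s * (- Q\<^sup>2 / 2 + 3/2 * kb\<^sup>2 + 6 * Y\<^sup>2 + 3/2 * X\<^sup>2) - s * N1 + L * \<Delta>"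
  proof -
    have "G\<^sup>2 / 2 + Q\<^sup>2 / 2 - (3 * kb\<^sup>2 + 12 * Y\<^sup>2 + 3 * X\<^sup>2) / 2 \<le> gq"
      using gq E2 by argo
    from mult_left_mono[OF this less_imp_le[OF s]]
    have "s * (G\<^sup>2 / 2 + Q\<^sup>2 / 2 - (3 * kb\<^sup>2 + 12 * Y\<^sup>2 + 3 * X\<^sup>2) / 2) \<le> s * gq" .
    then show ?thesis using F by (simp add: algebra_simps add_divide_distrib)
  qed
  have aa: "A' * a' \<le> A' * D1 * P\<^sup>2 + A' * D1 * (2 * s * l * P * Q) + A' * D1 * 2 * s * N2 + A' * D1 * (KD * \<Delta>)"
    using mult_left_mono[OF a' A(2)] by (simp add: algebra_simps)
  have bb: "A' * b' \<le> A' * D2 * R\<^sup>2 + A' * D2 * (2 * s * (2 * l) * R * Q) + A' * D2 * 2 * s * N3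
      + A' * D2 * (KD * \<Delta>) + A' * D2 * (8 * \<omega>)"
    using mult_left_mono[OF b' A(2)] by (simp add: algebra_simps)
  have nnS: "0 \<le> s * Q\<^sup>2" "0 \<le> s * X\<^sup>2" "0 \<le> s * Y\<^sup>2" using s by auto
  have "F' + A' * (a' + b') - (F + A * (a + b)) + s * G\<^sup>2 / 2
    = (F' - F + s * G\<^sup>2 / 2) + (A' * a' - A * a) + (A' * b' - A * b)" by (simp add: algebra_simps)
  also have "\<dots> \<le> (s * (- Q\<^sup>2 / 2 + 3/2 * kb\<^sup>2 + 6 * Y\<^sup>2 + 3/2 * X\<^sup>2) - s * N1)
      + (- 10 * (s * X\<^sup>2) + s * (4/100 * (X\<^sup>2 + Q\<^sup>2)) + A' * D1 * 2 * s * N2)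
      + (- 9 * (s * Y\<^sup>2) + A * ry * Ey + s * (8/100 * (Y\<^sup>2 + Q\<^sup>2)) + A' * D2 * 2 * s * N3 + 16 * A * \<omega>)
      + (s * (Q\<^sup>2 / 4) + 2 * s\<^sup>2 * (L + 4 * A * KD) * nx_max\<^sup>2)"
    using F2 aa bb z1 y1 z2 y2 o2 D3 by linarith
  also have "\<dots> = 3/2 * s * kb\<^sup>2 + 2 * s\<^sup>2 * (L + 4 * A * KD) * nx_max\<^sup>2 + 16 * A * \<omega> + A * ry * Ey
      - s * N1 + A' * D1 * 2 * s * N2 + A' * D2 * 2 * s * N3
      - (13/100 * (s * Q\<^sup>2) + 846/100 * (s * X\<^sup>2) + 292/100 * (s * Y\<^sup>2))"
    by (simp add: algebra_simps)
  also have "\<dots> \<le> 3/2 * s * kb\<^sup>2 + 2 * s\<^sup>2 * (L + 4 * A * KD) * nx_max\<^sup>2 + 16 * A * \<omega> + A * ry * Ey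
      - s * N1 + A' * D1 * 2 * s * N2 + A' * D2 * 2 * s * N3"
    using nnS by simp
  finally show ?thesis .
qed

lemma inverse_square_le:
  fixes d :: real
  assumes "0 \<le> d" "d \<le> 1/4" shows "1 / (1 - d)\<^sup>2 \<le> 1 + 4 * d"
proof -
  have "0 \<le> d * (2 - 7 * d + 4 * d\<^sup>2)" using assms by (intro mult_nonneg_nonneg) auto
  then have "1 \<le> (1 + 4 * d) * (1 - d)\<^sup>2" by (simp add: power2_eq_square algebra_simps)
  moreover have "0 < (1 - d)\<^sup>2" using assms by simp
  ultimately show ?thesis by (simp only: pos_divide_le_eq)
qed

context barrier
begin

text \<open>Only the first-order part \<open>J n\<close> of the response of the target to the noise \<open>n\<close> has mean zero; the
  rest is of second order in the step.\<close>

lemma tracking_after_drift: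
  assumes c: "c \<in> inside" and e: "dnorm P c (w - c) \<le> 1" and J: "linear J"
    and l: "\<And>u. dnorm P c (J u) \<le> l * norm u"
    and D: "D = - (s *\<^sub>R (q + n))" and s: "0 \<le> s"
    and rem: "dnorm P c (v - c - J D) \<le> K * (norm D)\<^sup>2" and lip: "dnorm P c (v - c) \<le> M * norm D"
  shows "(dnorm P c (w - v))\<^sup>2 \<le> (dnorm P c (w - c))\<^sup>2 + 2 * s * l * dnorm P c (w - c) * norm q
    + 2 * s * (Hm c (w - c) \<bullet> J n) + (2 * K + M\<^sup>2) * (norm D)\<^sup>2"
proof -
  interpret H: spd "Hm c" by (rule spd_Hm[OF c])
  define p where "p = dnorm P c (w - c)"
  define r where "r = v - c - J D"
  have p0: "0 \<le> p" "p \<le> 1" using e dnorm_nonneg[OF c] by (auto simp: p_def)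
  have "(dnorm P c (w - v))\<^sup>2 = (dnorm P c ((w - c) + (- (v - c))))\<^sup>2" by simp
  also have "\<dots> = p\<^sup>2 + 2 * (Hm c (w - c) \<bullet> (- (v - c))) + (dnorm P c (v - c))\<^sup>2"
    unfolding p_def dnorm_N[OF c] by (subst H.N_sum_sq) (simp only: H.N_minus)
  also have "Hm c (w - c) \<bullet> (- (v - c)) = - (Hm c (w - c) \<bullet> J D) - Hm c (w - c) \<bullet> r"
    by (simp add: r_def inner_simps)
  also have "Hm c (w - c) \<bullet> J D = - s * (Hm c (w - c) \<bullet> J q) - s * (Hm c (w - c) \<bullet> J n)"
  proof -
    have "J D = - (s *\<^sub>R (J q + J n))"
      unfolding D by (simp only: linear_neg[OF J] linear_cmul[OF J] linear_add[OF J])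
    then have "Hm c (w - c) \<bullet> J D = - (s * (Hm c (w - c) \<bullet> J q + Hm c (w - c) \<bullet> J n))"
      by (simp only: inner_minus_right inner_scaleR_right inner_add_right)
    then show ?thesis by (simp add: algebra_simps)
  qed
  finally have eq: "(dnorm P c (w - v))\<^sup>2 = p\<^sup>2 + 2 * s * (Hm c (w - c) \<bullet> J q) + 2 * s * (Hm c (w - c) \<bullet> J n)
      - 2 * (Hm c (w - c) \<bullet> r) + (dnorm P c (v - c))\<^sup>2" by (simp add: algebra_simps)
  have "Hm c (w - c) \<bullet> J q \<le> p * dnorm P c (J q)"
    unfolding p_def using dikin_cauchy[OF c] by (rule abs_le_D1)
  also have "\<dots> \<le> p * (l * norm q)" using l p0 by (intro mult_left_mono)
  finally have 1: "2 * s * (Hm c (w - c) \<bullet> J q) \<le> 2 * s * (p * (l * norm q))"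
    using s by (intro mult_left_mono) auto
  have "- (Hm c (w - c) \<bullet> r) \<le> p * dnorm P c r"
    unfolding p_def using dikin_cauchy[OF c, of "w - c" r] by (simp add: abs_le_iff)
  also have "\<dots> \<le> 1 * (K * (norm D)\<^sup>2)"
    using p0 rem dnorm_nonneg[OF c] by (intro mult_mono) (auto simp: r_def)
  finally have 2: "- (Hm c (w - c) \<bullet> r) \<le> K * (norm D)\<^sup>2" by simp
  have 3: "(dnorm P c (v - c))\<^sup>2 \<le> M\<^sup>2 * (norm D)\<^sup>2"
    using power_mono[OF lip dnorm_nonneg[OF c], of 2] by (simp add: power_mult_distrib)
  show ?thesis using eq 1 2 3 by (simp add: p_def algebra_simps)
qed

end

context dikin_problem
begin

lemma grad_Fmu_lipschitz: "norm (grad (Fmu P) x2 - grad (Fmu P) x1) \<le> L_F C * norm (x2 - x1)"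
  using constants by (auto simp: local_dikin_constants_def)

text \<open>With the mean value theorem in place of an integral the quadratic term comes without the factor
  \<open>1/2\<close>.\<close>

lemma descent: "Fmu P x' \<le> Fmu P x + grad (Fmu P) x \<bullet> (x' - x) + \<bar>L_F C\<bar> * (norm (x' - x))\<^sup>2"
proof -
  obtain t where t: "0 < t" "t < 1" "Fmu P (x + (x' - x)) - Fmu P x = (x' - x) \<bullet> grad (Fmu P) (x + t *\<^sub>R (x' - x))"
    using mvt_grad[of "Fmu P" "grad (Fmu P)" x "x' - x"] Fmu_grad by blast
  have "(x' - x) \<bullet> (grad (Fmu P) (x + t *\<^sub>R (x' - x)) - grad (Fmu P) x)
    \<le> norm (x' - x) * norm (grad (Fmu P) (x + t *\<^sub>R (x' - x)) - grad (Fmu P) x)" by (rule norm_cauchy_schwarz)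
  also have "\<dots> \<le> norm (x' - x) * (\<bar>L_F C\<bar> * norm (x' - x))"
  proof (intro mult_left_mono norm_ge_zero)
    have "norm (grad (Fmu P) (x + t *\<^sub>R (x' - x)) - grad (Fmu P) x) \<le> L_F C * norm (t *\<^sub>R (x' - x))"
      using grad_Fmu_lipschitz[of "x + t *\<^sub>R (x' - x)" x] by simp
    also have "\<dots> \<le> \<bar>L_F C\<bar> * norm (x' - x)" using t by (intro mult_mono) (auto simp: mult_left_le_one_le)
    finally show "norm (grad (Fmu P) (x + t *\<^sub>R (x' - x)) - grad (Fmu P) x) \<le> \<bar>L_F C\<bar> * norm (x' - x)" .
  qed
  finally show ?thesis using t(3) by (simp add: inner_diff_right inner_commute power2_eq_square mult_ac)
qed

end

context schedule
begin

text \<open>\<open>\<kappa> lam\<close> is the weight of the squared tracking errors in the potential. The factor \<open>20\<close> is large enough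
  for the contraction of the trackers to absorb their bias and, by the step-ratio condition, small
  enough for the drift of the centres to be absorbed by the descent. \<open>KD\<close> collects the coefficients of
  the squared step length, \<open>Dz\<close>, \<open>Dy\<close> are the factors for the change of the metrics, and \<open>ry\<close> is the
  inverse of the contraction of the squared \<open>y\<close>-error.\<close>

definition \<kappa> :: real where "\<kappa> = 20 * \<xi> * \<l>\<^sup>2 / (real T * \<rho>)"
definition KD :: real where
  "KD = 2 * \<bar>l_star1 C\<bar> + (l_star0 C)\<^sup>2 + 2 * \<bar>l_lam1 C\<bar> + (l_lam0 C)\<^sup>2"
definition Dz :: "nat \<Rightarrow> real" where "Dz k = 1 / (1 - \<eta> / 8 * \<Gamma>z k)\<^sup>2"
definition Dy :: "nat \<Rightarrow> real" where "Dy k = 1 / (1 - \<eta> / 8 * \<Gamma>y k)\<^sup>2"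
definition ry :: "nat \<Rightarrow> real" where "ry k = 1 / (1 - qy k) ^ (2 * T)"
definition nx_max :: real where "nx_max = bfx + l_f0 R"

text \<open>From here on \<open>lam\<close> is large and the step is small.\<close>

definition advanced :: "nat \<Rightarrow> bool" where
  "advanced k \<longleftrightarrow> large (lam k) \<and> 2 * K1 \<le> lam k \<and>
     2 * (\<xi> * \<alpha> k) * (\<bar>L_F C\<bar> + 4 * (\<kappa> * lam k) * KD) \<le> 1/4"

text \<open>The deterministic error of one step: bias of the penalty, second-order terms of the noise in \<open>x\<close>,
  growth of \<open>lam\<close>, and second-order terms of the noise in \<open>y\<close>.\<close>

definition err :: "nat \<Rightarrow> real" where
  "err k = 3/2 * (\<xi> * \<alpha> k) * (K2 / lam k)\<^sup>2
    + 2 * (\<xi> * \<alpha> k)\<^sup>2 * (\<bar>L_F C\<bar> + 4 * (\<kappa> * lam k) * KD) * nx_max\<^sup>2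
    + 16 * (\<kappa> * lam k) * lam_drift k
    + (\<kappa> * lam k) * ry k * (real T * (\<alpha> k * (5/4 * \<sigma>b))\<^sup>2)"

lemma kappa_pos: "0 < \<kappa>" using xi l_pos T rho_pos by (simp add: \<kappa>_def)
lemma KD_nonneg: "0 \<le> KD" by (simp add: KD_def)

text \<open>One factor \<open>l_star0 \<ge> 1\<close> of the step-ratio condition is given away.\<close>

lemma step_ratio: "\<xi> * \<l> * l_star0 C \<le> real T * \<rho> / 1000"
proof -
  define Mx where "Mx = max (\<l> * (l_star0 C)\<^sup>2) (l_star1 C * sqrt (max ((l_g0 R)\<^sup>2) ((l_f0 R)\<^sup>2)))"
  have l1: "1 \<le> l_star0 C" by (rule l_star0_ge1)
  have p: "0 < \<l> * (l_star0 C)\<^sup>2" using l_pos l1 by simp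
  then have M: "0 < Mx" unfolding Mx_def by (rule less_le_trans) simp
  have "\<xi> / real T \<le> c\<xi> * \<rho> / Mx" using aware by (simp add: barrier_aware_def Let_def Mx_def)
  then have "\<xi> / real T * Mx \<le> c\<xi> * \<rho>" using M by (simp only: pos_le_divide_eq)
  moreover have "\<xi> / real T * (\<l> * (l_star0 C)\<^sup>2) \<le> \<xi> / real T * Mx"
    using xi T by (intro mult_left_mono) (auto simp: Mx_def)
  moreover have "c\<xi> * \<rho> \<le> 1/1000 * \<rho>" using cxi rho_pos by (intro mult_right_mono) auto
  ultimately have "\<xi> / real T * (\<l> * (l_star0 C)\<^sup>2) \<le> 1/1000 * \<rho>" by linarith
  then have 1: "\<xi> * (\<l> * (l_star0 C)\<^sup>2) \<le> real T * \<rho> / 1000" using T by (simp add: field_simps)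
  have "\<xi> * \<l> * (l_star0 C * 1) \<le> \<xi> * \<l> * (l_star0 C * l_star0 C)"
    using l1 xi l_pos by (intro mult_left_mono) auto
  then show ?thesis using 1 by (simp add: power2_eq_square mult.assoc)
qed

lemma D_le: "0 \<le> Dz k" "Dz k \<le> 1 + real T * \<rho> * \<gamma> k / 16" "0 \<le> Dy k" "Dy k \<le> 1 + real T * \<rho> * \<beta> k / 16"
proof -
  have e: "0 \<le> \<eta> / 8 * G \<and> \<eta> / 8 * G \<le> 1/72 * G" if "0 \<le> G" for G
    using that eta_pos eta_ninth mult_right_mono[of "\<eta> / 8" "1/72" G] by simp
  have z: "0 \<le> \<eta> / 8 * \<Gamma>z k" "\<eta> / 8 * \<Gamma>z k \<le> 1/72 * (real T * \<rho> * \<gamma> k)"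
    using e[OF Gammaz_bounds(1)] Gammaz_bounds(3)[of k] by (auto intro: order_trans)
  have y: "0 \<le> \<eta> / 8 * \<Gamma>y k" "\<eta> / 8 * \<Gamma>y k \<le> 1/72 * (real T * \<rho> * \<beta> k)"
    using e[OF Gammay_bounds(1), of k] Gammay_bounds(3)[of k] beta_pos[of k] rho_pos by (auto simp: field_simps intro: order_trans)
  show "0 \<le> Dz k" "0 \<le> Dy k" by (auto simp: Dz_def Dy_def)
  have "Dz k \<le> 1 + 4 * (\<eta> / 8 * \<Gamma>z k)" unfolding Dz_def
    by (rule inverse_square_le) (use z gamma_T[of k] in linarith)+
  moreover have "0 \<le> real T * \<rho> * \<gamma> k" using gamma_pos[of k] rho_pos by simp
  ultimately show "Dz k \<le> 1 + real T * \<rho> * \<gamma> k / 16" using z by linarith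
  have "Dy k \<le> 1 + 4 * (\<eta> / 8 * \<Gamma>y k)" unfolding Dy_def
    by (rule inverse_square_le) (use y beta_T[of k] in linarith)+
  moreover have "0 \<le> real T * \<rho> * \<beta> k" using beta_pos[of k] rho_pos by simp
  ultimately show "Dy k \<le> 1 + real T * \<rho> * \<beta> k / 16" using y by linarith
qed

lemma ry_bounds: "1 + 3/5 * (real T * \<rho> * \<beta> k) \<le> ry k" "ry k \<le> 2" "0 < (1 - qy k) ^ (2 * T)"
proof -
  have q: "0 \<le> qy k" "qy k \<le> 1/8" using beta_rho[of k] by (auto simp: qy_def mult_ac)
  have b: "0 \<le> real T * \<rho> * \<beta> k" using beta_pos[of k] rho_pos by simp
  show p: "0 < (1 - qy k) ^ (2 * T)" using q by simp
  have "(1 - qy k) ^ (2 * T) * (1 + real (2 * T) * qy k) \<le> 1" using q by (intro power_le_inverse) auto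
  then have "1 + real (2 * T) * qy k \<le> ry k" using p by (simp add: ry_def pos_le_divide_eq mult.commute)
  moreover have "real (2 * T) * qy k = 3/4 * (real T * \<rho> * \<beta> k)" by (simp add: qy_def)
  ultimately show "1 + 3/5 * (real T * \<rho> * \<beta> k) \<le> ry k" using b by linarith
  have "1 - (1 - qy k) ^ (2 * T) \<le> real (2 * T) * qy k" using q by (intro one_minus_power_le) auto
  then have "1/2 \<le> (1 - qy k) ^ (2 * T)" using beta_T[of k] \<open>real (2 * T) * qy k = _\<close> by linarith
  then show "ry k \<le> 2" using p by (simp add: ry_def divide_le_eq)
qed

end

context iteration
begin

definition nx :: "real^'n" where "nx = h - grad_x (upper P) x (yt T)"
definition q :: "real^'n" where "q = grad_est (lam k) x (yt T) (zt T)"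
definition noise_f :: real where "noise_f = grad (Fmu P) x \<bullet> nx"
definition noise_z :: real where "noise_z = Hm c (zt T - c) \<bullet> J x nx"
definition noise_y :: real where "noise_y = Hm m (yt T - m) \<bullet> Jl (lam k) x nx"

lemma x_move: "x' - x = - ((\<xi> * \<alpha> k) *\<^sub>R (q + nx))"
  unfolding x_step by (simp add: q_def nx_def grad_est_def algebra_simps)

lemma nx_bound: "norm nx \<le> nx_max"
proof -
  have "norm nx \<le> norm h + norm (grad_x (upper P) x (yt T))" unfolding nx_def by (rule norm_triangle_ineq4)
  also have "\<dots> \<le> bfx + l_f0 R"
    using h_bound[OF z_end y_end] regular by (intro add_mono) (auto simp: objective_regularity_def)
  finally show ?thesis by (simp add: nx_max_def)
qed

lemma x_move_sq: "(norm (x' - x))\<^sup>2 \<le> 2 * (\<xi> * \<alpha> k)\<^sup>2 * ((norm q)\<^sup>2 + nx_max\<^sup>2)"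
proof -
  have "(norm (x' - x))\<^sup>2 = (\<xi> * \<alpha> k)\<^sup>2 * (norm (q + nx))\<^sup>2"
    unfolding x_move by (simp add: power_mult_distrib)
  also have "\<dots> \<le> (\<xi> * \<alpha> k)\<^sup>2 * (2 * ((norm q)\<^sup>2 + nx_max\<^sup>2))"
  proof (rule mult_left_mono)
    have "(norm (q + nx))\<^sup>2 \<le> (norm q + nx_max)\<^sup>2"
      using norm_triangle_ineq[of q nx] nx_bound by (intro power_mono) auto
    also have "\<dots> \<le> 2 * ((norm q)\<^sup>2 + nx_max\<^sup>2)"
      using sum_squares_bound[of "norm q" nx_max] by (simp add: power2_eq_square algebra_simps)
    finally show "(norm (q + nx))\<^sup>2 \<le> 2 * ((norm q)\<^sup>2 + nx_max\<^sup>2)" .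
  qed simp
  finally show ?thesis by (simp add: algebra_simps)
qed

lemma z_err_le: "dnorm P c (zt T - c) \<le> 1" and y_err_le: "dnorm P m (yt T - m) \<le> 1"
  using z_end y_end eta1 by (auto simp: dikin_tube_def)

lemma moved_le: "dnorm P c2 (w - c2) ^ 2 \<le> 1 / (1 - d)\<^sup>2 * (dnorm P c1 (w - c2))\<^sup>2"
  if "c1 \<in> inside" "dnorm P c1 (c2 - c1) \<le> d" "d < 1"
proof -
  have "dnorm P c2 (w - c2) \<le> dnorm P c1 (w - c2) / (1 - d)" by (rule dnorm_change_centre(1)[OF that])
  moreover have "0 \<le> dnorm P c2 (w - c2)" using dikin_ball(1)[OF that] by (rule dnorm_nonneg)
  ultimately have "(dnorm P c2 (w - c2))\<^sup>2 \<le> (dnorm P c1 (w - c2) / (1 - d))\<^sup>2" by (rule power_mono)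
  then show ?thesis by (simp add: power_divide)
qed

lemma z_next_sq: "(dnorm P c' (zt T - c'))\<^sup>2 \<le> Dz k * ((dnorm P c (zt T - c))\<^sup>2
    + 2 * (\<xi> * \<alpha> k) * l_star0 C * dnorm P c (zt T - c) * norm q + 2 * (\<xi> * \<alpha> k) * noise_z + KD * (norm (x' - x))\<^sup>2)"
proof -
  have "(dnorm P c' (zt T - c'))\<^sup>2 \<le> Dz k * (dnorm P c (zt T - c'))\<^sup>2"
    unfolding Dz_def by (rule moved_le[OF c_in c_drift]) (use eta_Gz in linarith)
  also have "(dnorm P c (zt T - c'))\<^sup>2 \<le> (dnorm P c (zt T - c))\<^sup>2
    + 2 * (\<xi> * \<alpha> k) * l_star0 C * dnorm P c (zt T - c) * norm q + 2 * (\<xi> * \<alpha> k) * noise_z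
    + (2 * \<bar>l_star1 C\<bar> + (l_star0 C)\<^sup>2) * (norm (x' - x))\<^sup>2"
    unfolding noise_z_def
    by (rule tracking_after_drift[OF c_in z_err_le has_derivative_linear[OF ys_derivative] J_bound x_move _ ys_first_order ys_lipschitz])
      (use xi alpha_pos[of k] in simp)
  also have "(2 * \<bar>l_star1 C\<bar> + (l_star0 C)\<^sup>2) * (norm (x' - x))\<^sup>2 \<le> KD * (norm (x' - x))\<^sup>2"
    by (intro mult_right_mono) (auto simp: KD_def)
  finally show ?thesis using D_le(1)[of k] by (simp add: mult_left_mono)
qed

text \<open>The growth of \<open>lam\<close> contributes linearly, through \<open>8 lam_drift\<close>, because all distances involved are at
  most \<open>1\<close>.\<close>

lemma y_next_sq:
  assumes adv: "advanced k"
  shows "(dnorm P m' (yt T - m'))\<^sup>2 \<le> Dy k * ((dnorm P m (yt T - m))\<^sup>2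
    + 2 * (\<xi> * \<alpha> k) * (2 * l_star0 C) * dnorm P m (yt T - m) * norm q + 2 * (\<xi> * \<alpha> k) * noise_y
    + KD * (norm (x' - x))\<^sup>2 + 8 * lam_drift k)"
proof -
  \<comment> \<open>the target moves first with \<open>x\<close> and then with \<open>lam\<close>\<close>
  define n where "n = yl (lam k) x'"
  have n_in: "n \<in> inside" unfolding n_def by (rule yl_inside[OF lam_pos])
  have nm: "dnorm P m (n - m) \<le> l_lam0 C * norm (x' - x)"
    using yl_lipschitz[OF lam_ge lam_ge, of k x k x'] by (simp add: n_def)
  have sm: "l_lam0 C * norm (x' - x) \<le> 1/72" "lam_drift k \<le> 1/72"
    using m_drift_sum eta_Gy lam_drift_nonneg[of k] l_lam0_nonneg by (smt (verit) mult_nonneg_nonneg norm_ge_zero)+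
  have "dnorm P m (m' - n) \<le> (1 + l_lam0 C * norm (x' - x)) * dnorm P n (m' - n)"
    by (rule dnorm_change_centre(2)[OF m_in nm]) (use sm in linarith)
  also have "\<dots> \<le> 2 * lam_drift k"
  proof (intro mult_mono)
    show "dnorm P n (m' - n) \<le> lam_drift k"
      using yl_lipschitz[OF lam_ge lam_ge, of k x' "Suc k" x'] by (simp add: n_def lam_drift_def)
  qed (use sm dnorm_nonneg[OF n_in] in auto)
  finally have w: "dnorm P m (m' - n) \<le> 2 * lam_drift k" .
  have yn: "dnorm P m (yt T - n) \<le> 1"
  proof -
    have "dnorm P m (yt T - n) \<le> dnorm P m (yt T - m) + dnorm P m (n - m)"
      using dnorm_triangle_diff[OF m_in, of "yt T - m" "n - m"] by simp
    also have "\<dots> \<le> 1/9 + 1/72" using y_end eta_ninth nm sm by (intro add_mono) (auto simp: dikin_tube_def)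
    finally show ?thesis by simp
  qed
  have "(dnorm P m (yt T - m'))\<^sup>2 \<le> (dnorm P m (yt T - n) + 2 * lam_drift k)\<^sup>2"
    using dnorm_triangle_diff[OF m_in, of "yt T - n" "m' - n"] w dnorm_nonneg[OF m_in] by (intro power_mono) auto
  also have "\<dots> = (dnorm P m (yt T - n))\<^sup>2 + 4 * lam_drift k * (dnorm P m (yt T - n) + lam_drift k)"
    by (simp add: power2_eq_square algebra_simps)
  also have "\<dots> \<le> (dnorm P m (yt T - n))\<^sup>2 + 4 * lam_drift k * 2"
    using yn sm lam_drift_nonneg[of k] by (intro add_left_mono mult_left_mono) auto
  also have "(dnorm P m (yt T - n))\<^sup>2 \<le> (dnorm P m (yt T - m))\<^sup>2
    + 2 * (\<xi> * \<alpha> k) * (2 * l_star0 C) * dnorm P m (yt T - m) * norm q + 2 * (\<xi> * \<alpha> k) * noise_y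
    + (2 * \<bar>l_lam1 C\<bar> + (l_lam0 C)\<^sup>2) * (norm (x' - x))\<^sup>2"
    unfolding noise_y_def n_def
    by (rule tracking_after_drift[OF m_in y_err_le has_derivative_linear[OF yl_derivative[OF lam_ge]] Jl_bound_star x_move _ yl_first_order[OF lam_ge] nm[unfolded n_def]])
      (use adv xi alpha_pos[of k] in \<open>auto simp: advanced_def\<close>)
  also have "(2 * \<bar>l_lam1 C\<bar> + (l_lam0 C)\<^sup>2) * (norm (x' - x))\<^sup>2 \<le> KD * (norm (x' - x))\<^sup>2"
    by (intro mult_right_mono) (auto simp: KD_def)
  finally have *: "(dnorm P m (yt T - m'))\<^sup>2 \<le> (dnorm P m (yt T - m))\<^sup>2
    + 2 * (\<xi> * \<alpha> k) * (2 * l_star0 C) * dnorm P m (yt T - m) * norm q + 2 * (\<xi> * \<alpha> k) * noise_y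
    + KD * (norm (x' - x))\<^sup>2 + 8 * lam_drift k" by simp
  have "(dnorm P m' (yt T - m'))\<^sup>2 \<le> Dy k * (dnorm P m (yt T - m'))\<^sup>2"
    unfolding Dy_def by (rule moved_le[OF m_in m_drift]) (use eta_Gy in linarith)
  also have "\<dots> \<le> Dy k * ((dnorm P m (yt T - m))\<^sup>2
    + 2 * (\<xi> * \<alpha> k) * (2 * l_star0 C) * dnorm P m (yt T - m) * norm q + 2 * (\<xi> * \<alpha> k) * noise_y
    + KD * (norm (x' - x))\<^sup>2 + 8 * lam_drift k)"
    using * D_le(3) by (rule mult_left_mono)
  finally show ?thesis .
qed

definition noise_sum :: real where
  "noise_sum = - (\<xi> * \<alpha> k) * noise_f + (\<kappa> * lam (Suc k)) * Dz k * 2 * (\<xi> * \<alpha> k) * noise_z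
    + (\<kappa> * lam (Suc k)) * Dy k * 2 * (\<xi> * \<alpha> k) * noise_y
    - (\<kappa> * lam k) * ry k * (2 * \<alpha> k * (\<Sum>i<T. (1 - qy k) ^ (2 * (T - 1 - i)) * cross i))"

lemma potential_decrease:
  assumes adv: "advanced k"
  shows "Fmu P x' + (\<kappa> * lam (Suc k)) * ((dnorm P c' (zt T - c'))\<^sup>2 + (dnorm P m' (yt T - m'))\<^sup>2)
    - (Fmu P x + (\<kappa> * lam k) * ((dnorm P c (zt 0 - c))\<^sup>2 + (dnorm P m (yt 0 - m))\<^sup>2))
    + \<xi> * \<alpha> k * (norm (grad (Fmu P) x))\<^sup>2 / 2 \<le> err k + noise_sum"
proof -
  define s where "s = \<xi> * \<alpha> k"
  define \<Lambda> where "\<Lambda> = lam k * \<l>"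
  define Ey where "Ey = real T * (\<alpha> k * (5/4 * \<sigma>b))\<^sup>2 - 2 * \<alpha> k * (\<Sum>i<T. (1 - qy k) ^ (2 * (T - 1 - i)) * cross i)"
  let ?p = "dnorm P c (zt T - c)" and ?r = "dnorm P m (yt T - m)"
  let ?E = "norm (q - grad (Fmu P) x)"
  have s: "0 < s" using xi alpha_pos[of k] by (simp add: s_def)
  have tau: "0 \<le> real T * \<rho> * \<beta> k" "real T * \<rho> * \<beta> k \<le> real T * \<rho> * \<gamma> k"
    using rho_pos beta_pos[of k] beta_gamma[of k] by (auto intro: mult_left_mono)
  have "Fmu P x' + (\<kappa> * lam (Suc k)) * ((dnorm P c' (zt T - c'))\<^sup>2 + (dnorm P m' (yt T - m'))\<^sup>2)
    - (Fmu P x + (\<kappa> * lam k) * ((dnorm P c (zt 0 - c))\<^sup>2 + (dnorm P m (yt 0 - m))\<^sup>2))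
    + s * (norm (grad (Fmu P) x))\<^sup>2 / 2
    \<le> 3/2 * s * (K2 / lam k)\<^sup>2 + 2 * s\<^sup>2 * (\<bar>L_F C\<bar> + 4 * (\<kappa> * lam k) * KD) * nx_max\<^sup>2 + 16 * (\<kappa> * lam k) * lam_drift k
      + (\<kappa> * lam k) * ry k * Ey - s * noise_f + (\<kappa> * lam (Suc k)) * Dz k * 2 * s * noise_z
      + (\<kappa> * lam (Suc k)) * Dy k * 2 * s * noise_y"
  proof (rule potential_step[where \<tau> = "real T * \<rho> * \<beta> k" and \<tau>g = "real T * \<rho> * \<gamma> k" and l = "l_star0 C"
        and \<Lambda> = \<Lambda> and E = ?E and P = ?p and R = ?r and Q = "norm q" and \<Delta> = "(norm (x' - x))\<^sup>2"
        and gq = "grad (Fmu P) x \<bullet> q"])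
    show "\<kappa> * lam (Suc k) \<le> (1 + real T * \<rho> * \<beta> k / 16) * (\<kappa> * lam k)"
    proof -
      have "lam (Suc k) \<le> (1 + real T * \<rho> * \<beta> k / 16) * lam k" using lam_rel[of k] by (simp add: distrib_right)
      from mult_left_mono[OF this less_imp_le[OF kappa_pos]] show ?thesis by (simp add: mult_ac)
    qed
    show "(1 + real T * \<rho> * \<gamma> k) * ?p\<^sup>2 \<le> (dnorm P c (zt 0 - c))\<^sup>2"
    proof -
      have "?p\<^sup>2 \<le> ((1 - qz k) ^ T * dnorm P c (zt 0 - c))\<^sup>2"
        using z_track[of T] dnorm_nonneg[OF c_in] by (intro power_mono) auto
      then have 1: "?p\<^sup>2 \<le> (1 - qz k) ^ (2 * T) * (dnorm P c (zt 0 - c))\<^sup>2"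
        by (simp add: power_mult_distrib power_mult[symmetric] mult.commute)
      have 2: "(1 - qz k) ^ (2 * T) * (1 + real (2 * T) * qz k) \<le> 1" by (rule power_le_inverse) (rule qz)+
      have 3: "1 + real T * \<rho> * \<gamma> k \<le> 1 + real (2 * T) * qz k"
        using rho_pos gamma_pos[of k] by (simp add: qz_def)
      have "(1 + real T * \<rho> * \<gamma> k) * ?p\<^sup>2 \<le> (1 + real (2 * T) * qz k) * ((1 - qz k) ^ (2 * T) * (dnorm P c (zt 0 - c))\<^sup>2)"
        using 1 3 qz[of k] by (intro mult_mono) auto
      also have "\<dots> = ((1 - qz k) ^ (2 * T) * (1 + real (2 * T) * qz k)) * (dnorm P c (zt 0 - c))\<^sup>2" by simp
      also have "\<dots> \<le> 1 * (dnorm P c (zt 0 - c))\<^sup>2" using 2 by (rule mult_right_mono) simp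
      finally show ?thesis by simp
    qed
    show "ry k * (?r\<^sup>2 - Ey) \<le> (dnorm P m (yt 0 - m))\<^sup>2"
    proof -
      have "?r\<^sup>2 - Ey \<le> (1 - qy k) ^ (2 * T) * (dnorm P m (yt 0 - m))\<^sup>2"
        using y_track_sq[of T] by (simp add: Ey_def)
      then show ?thesis using ry_bounds(3)[of k] by (simp add: ry_def divide_le_eq mult.commute)
    qed
    show "\<kappa> * lam k * (real T * \<rho> * \<beta> k) = 20 * s * \<Lambda>\<^sup>2"
      using T rho_pos by (simp add: \<kappa>_def s_def \<Lambda>_def \<beta>_def power2_eq_square)
    show "\<kappa> * lam k * l_star0 C \<le> \<Lambda> / 50"
    proof -
      have "\<kappa> * lam k * l_star0 C = (20 * lam k * \<l> / (real T * \<rho>)) * (\<xi> * \<l> * l_star0 C)"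
        by (simp add: \<kappa>_def power2_eq_square)
      also have "\<dots> \<le> (20 * lam k * \<l> / (real T * \<rho>)) * (real T * \<rho> / 1000)"
        using lam_pos[of k] l_pos rho_pos by (intro mult_left_mono step_ratio) auto
      also have "\<dots> = \<Lambda> / 50" using T rho_pos by (simp add: \<Lambda>_def)
      finally show ?thesis .
    qed
    show "(dnorm P c' (zt T - c'))\<^sup>2 \<le> Dz k * (?p\<^sup>2 + 2 * s * l_star0 C * ?p * norm q + 2 * s * noise_z + KD * (norm (x' - x))\<^sup>2)"
      unfolding s_def by (rule z_next_sq)
    show "(dnorm P m' (yt T - m'))\<^sup>2 \<le> Dy k * (?r\<^sup>2 + 2 * s * (2 * l_star0 C) * ?r * norm q + 2 * s * noise_y
      + KD * (norm (x' - x))\<^sup>2 + 8 * lam_drift k)"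
      unfolding s_def by (rule y_next_sq[OF adv])
    show "(norm (x' - x))\<^sup>2 \<le> 2 * s\<^sup>2 * ((norm q)\<^sup>2 + nx_max\<^sup>2)" unfolding s_def by (rule x_move_sq)
    show "Fmu P x' \<le> Fmu P x - s * (grad (Fmu P) x \<bullet> q) - s * noise_f + \<bar>L_F C\<bar> * (norm (x' - x))\<^sup>2"
    proof -
      have "grad (Fmu P) x \<bullet> (x' - x) = - s * (grad (Fmu P) x \<bullet> q) - s * noise_f"
        unfolding x_move noise_f_def s_def by (simp add: inner_simps algebra_simps)
      then show ?thesis using descent[of x' x] by simp
    qed
    show "(norm (grad (Fmu P) x))\<^sup>2 / 2 + (norm q)\<^sup>2 / 2 - ?E\<^sup>2 / 2 \<le> grad (Fmu P) x \<bullet> q"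
      by (simp add: power2_norm_eq_inner inner_simps inner_commute add_divide_distrib diff_divide_distrib)
    show "?E \<le> K2 / lam k + 2 * \<Lambda> * ?r + \<Lambda> * ?p"
      using bias_bound[OF _ y_end z_end] adv by (simp add: q_def \<Lambda>_def advanced_def mult_ac)
    show "2 * s * (\<bar>L_F C\<bar> + 4 * (\<kappa> * lam k) * KD) \<le> 1/4"
      using adv by (simp add: advanced_def s_def)
  qed (use s tau gamma_T[of k] kappa_pos lam_pos[of k] lam_pos[of "Suc k"] D_le[of k] ry_bounds[of k]
      dnorm_nonneg[OF c_in] dnorm_nonneg[OF m_in] KD_nonneg l_star0_ge1 l_pos lam_drift_nonneg[of k] in \<open>auto simp: \<Lambda>_def\<close>)
  then show ?thesis by (simp add: err_def noise_sum_def s_def Ey_def algebra_simps)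
qed

lemma noise_f_bound: "\<bar>noise_f\<bar> \<le> norm (grad (Fmu P) x) * nx_max"
proof -
  have "\<bar>noise_f\<bar> \<le> norm (grad (Fmu P) x) * norm nx" unfolding noise_f_def by (rule Cauchy_Schwarz_ineq2)
  also have "\<dots> \<le> norm (grad (Fmu P) x) * nx_max" by (intro mult_left_mono nx_bound) simp
  finally show ?thesis .
qed

lemma noise_z_bound: "\<bar>noise_z\<bar> \<le> l_star0 C * nx_max"
proof -
  have "\<bar>noise_z\<bar> \<le> dnorm P c (zt T - c) * dnorm P c (J x nx)" unfolding noise_z_def by (rule dikin_cauchy[OF c_in])
  also have "\<dots> \<le> 1 * (l_star0 C * norm nx)"
    using z_err_le J_bound dnorm_nonneg[OF c_in] by (intro mult_mono) auto
  also have "\<dots> \<le> l_star0 C * nx_max" using nx_bound l_star0_ge1 by (simp add: mult_left_mono)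
  finally show ?thesis .
qed

lemma noise_y_bound: "\<bar>noise_y\<bar> \<le> l_lam0 C * nx_max"
proof -
  have "\<bar>noise_y\<bar> \<le> dnorm P m (yt T - m) * dnorm P m (Jl (lam k) x nx)"
    unfolding noise_y_def by (rule dikin_cauchy[OF m_in])
  also have "\<dots> \<le> 1 * (l_lam0 C * norm nx)"
    using y_err_le Jl_bound[OF lam_ge] dnorm_nonneg[OF m_in] by (intro mult_mono) auto
  also have "\<dots> \<le> l_lam0 C * nx_max" using nx_bound l_lam0_nonneg by (simp add: mult_left_mono)
  finally show ?thesis .
qed

end

section \<open>Centred noise\<close>

lemma measurable_vec_nth_comp: "f \<in> borel_measurable N \<Longrightarrow> (\<lambda>w. (f w :: real^'e) $ i) \<in> borel_measurable N"
  by (rule measurable_compose[of _ _ borel])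
    (auto intro!: borel_measurable_continuous_onI continuous_intros)

lemma measurable_continuous_pair:
  fixes h :: "'a::second_countable_topology \<times> 'b::second_countable_topology \<Rightarrow> 'c::topological_space"
  assumes "continuous_on UNIV h" and f: "f \<in> borel_measurable N" and g: "g \<in> borel_measurable N"
  shows "(\<lambda>w. h (f w, g w)) \<in> borel_measurable N"
proof -
  have "(\<lambda>w. (f w, g w)) \<in> borel_measurable N" by (rule borel_measurable_Pair[OF f g])
  then show ?thesis by (rule measurable_compose) (rule borel_measurable_continuous_onI[OF assms(1)])
qed

definition centred_noise :: "'w measure \<Rightarrow> 'w measure \<Rightarrow> ('w \<Rightarrow> real^'e) \<Rightarrow> bool" where
  "centred_noise M F n \<longleftrightarrow> n \<in> borel_measurable M \<and> (\<forall>i. integrable M (\<lambda>w. n w $ i)) \<and>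
     (\<forall>i. AE w in M. real_cond_exp M F (\<lambda>w. n w $ i) w = 0)"

text \<open>Centred noise is orthogonal to every earlier vector with which its product is bounded. The
  vector is truncated, and the limit is taken under the bound on the product; this avoids estimating the
  metrics at the random centres.\<close>

lemma centred_noise_orthogonal:
  fixes U n :: "'w \<Rightarrow> real^'e::finite"
  assumes M: "prob_space M" and F: "subalgebra M F" and n: "centred_noise M F n"
    and U: "U \<in> borel_measurable F" and K: "AE w in M. \<bar>U w \<bullet> n w\<bar> \<le> K"
  shows "integrable M (\<lambda>w. U w \<bullet> n w)" and "(\<integral>w. U w \<bullet> n w \<partial>M) = 0"
proof -
  interpret prob_space M by fact
  interpret finite_measure_subalgebra M F by unfold_locales (rule F)
  have nM: "n \<in> borel_measurable M" and ni: "\<And>i. integrable M (\<lambda>w. n w $ i)"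
    and n0: "\<And>i. AE w in M. real_cond_exp M F (\<lambda>w. n w $ i) w = 0"
    using n by (auto simp: centred_noise_def)
  have UM: "U \<in> borel_measurable M" by (rule measurable_from_subalg[OF F U])
  have Un: "(\<lambda>w. U w \<bullet> n w) \<in> borel_measurable M" by (rule borel_measurable_inner[OF UM nM])
  show int: "integrable M (\<lambda>w. U w \<bullet> n w)"
    by (rule integrable_const_bound[OF _ Un, of K]) (use K in simp)
  define Uj where "Uj = (\<lambda>j w. if norm (U w) \<le> real j then U w else 0)"
  have UjF: "Uj j \<in> borel_measurable F" for j
    unfolding Uj_def using U by measurable
  have UjM: "Uj j \<in> borel_measurable M" for j by (rule measurable_from_subalg[OF F UjF])
  have Uji: "(\<lambda>w. Uj j w $ i) \<in> borel_measurable F" for j i by (rule measurable_vec_nth_comp[OF UjF])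
  have term_int: "integrable M (\<lambda>w. Uj j w $ i * n w $ i)" for j i
  proof (rule Bochner_Integration.integrable_bound[OF integrable_mult_right[OF integrable_norm[OF ni[of i]], of "real j"]])
    show "(\<lambda>w. Uj j w $ i * n w $ i) \<in> borel_measurable M"
      using measurable_from_subalg[OF F Uji[of j i]] ni[of i] by (auto intro: borel_measurable_times)
    have "norm (Uj j w) \<le> real j" for w by (simp add: Uj_def)
    then have "\<bar>Uj j w $ i\<bar> \<le> real j" for w using component_le_norm_cart order_trans by blast
    then show "AE w in M. norm (Uj j w $ i * n w $ i) \<le> norm (real j * norm (n w $ i))"
      by (intro AE_I2) (auto simp: abs_mult intro: mult_right_mono)
  qed
  have zero: "(\<integral>w. Uj j w \<bullet> n w \<partial>M) = 0" for j
  proof -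
    have "(\<integral>w. Uj j w $ i * n w $ i \<partial>M) = 0" for i
    proof -
      have "(\<integral>w. Uj j w $ i * n w $ i \<partial>M) = (\<integral>w. Uj j w $ i * real_cond_exp M F (\<lambda>w. n w $ i) w \<partial>M)"
        using real_cond_exp_intg(2)[OF term_int Uji measurable_vec_nth_comp[OF nM]] by simp
      also have "\<dots> = (\<integral>w. 0 \<partial>M)"
        using n0[of i] measurable_from_subalg[OF F Uji[of j i]]
        by (intro integral_cong_AE) (auto intro!: borel_measurable_times borel_measurable_cond_exp2)
      finally show ?thesis by simp
    qed
    then show ?thesis
      using Bochner_Integration.integral_sum[of UNIV M "\<lambda>i w. Uj j w $ i * n w $ i"] term_int
      by (simp add: inner_vec_def)
  qed
  have "(\<lambda>j. \<integral>w. Uj j w \<bullet> n w \<partial>M) \<longlonglongrightarrow> (\<integral>w. U w \<bullet> n w \<partial>M)"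
  proof (rule integral_dominated_convergence[where w = "\<lambda>_. \<bar>K\<bar>"])
    show "AE w in M. (\<lambda>j. Uj j w \<bullet> n w) \<longlonglongrightarrow> U w \<bullet> n w"
    proof (rule AE_I2)
      fix w
      obtain j0 :: nat where "norm (U w) \<le> real j0" using real_arch_simple by blast
      then have "eventually (\<lambda>j. Uj j w \<bullet> n w = U w \<bullet> n w) sequentially"
        unfolding eventually_sequentially Uj_def by (intro exI[of _ j0]) (auto intro: order_trans)
      then show "(\<lambda>j. Uj j w \<bullet> n w) \<longlonglongrightarrow> U w \<bullet> n w" by (rule tendsto_eventually)
    qed
    show "AE w in M. norm (Uj j w \<bullet> n w) \<le> \<bar>K\<bar>" for j
      using K by eventually_elim (auto simp: Uj_def)
  qed (auto intro: Un borel_measurable_inner UjM nM)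
  then show "(\<integral>w. U w \<bullet> n w \<partial>M) = 0" by (simp add: zero LIMSEQ_const_iff)
qed

text \<open>The conditional variance bound makes the noise square integrable; this gives the integrability
  without which the conditional mean carries no information.\<close>

lemma oracle_noise_centred:
  fixes G :: "(real^'n::finite) \<times> (real^'d::finite) \<Rightarrow> 's \<Rightarrow> real^'e::finite"
  assumes M: "prob_space M" and F: "subalgebra M F" and o: "oracle_at M F \<zeta> G G0 \<sigma>"
    and G: "(\<lambda>(v, s). G v s) \<in> borel_measurable (borel \<Otimes>\<^sub>M S)" and z: "\<zeta> \<in> measurable M S"
    and X: "X \<in> borel_measurable F" and G0: "continuous_on UNIV G0" and B: "\<And>v. norm (G0 v) \<le> B"
  shows "centred_noise M F (\<lambda>w. G (X w) (\<zeta> w) - G0 (X w))"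
proof -
  interpret prob_space M by fact
  interpret finite_measure_subalgebra M F by unfold_locales (rule F)
  define n where "n = (\<lambda>w. G (X w) (\<zeta> w) - G0 (X w))"
  have XM: "X \<in> borel_measurable M" by (rule measurable_from_subalg[OF F X])
  have "(\<lambda>w. (X w, \<zeta> w)) \<in> measurable M (borel \<Otimes>\<^sub>M S)" by (rule measurable_Pair[OF XM z])
  from measurable_compose[OF this G] have GM: "(\<lambda>w. G (X w) (\<zeta> w)) \<in> borel_measurable M" by simp
  have G0F: "(\<lambda>w. G0 (X w)) \<in> borel_measurable F"
    by (rule measurable_compose[OF X borel_measurable_continuous_onI[OF G0]])
  have G0M: "(\<lambda>w. G0 (X w)) \<in> borel_measurable M" by (rule measurable_from_subalg[OF F G0F])
  have nM: "n \<in> borel_measurable M" unfolding n_def using GM G0M by (rule borel_measurable_diff)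
  have mean: "AE w in M. vec_cond_exp M F (\<lambda>w. G (X w) (\<zeta> w)) w = G0 (X w)"
    and var: "AE w in M. nn_cond_exp M F (\<lambda>w. ennreal ((norm (n w))\<^sup>2)) w \<le> ennreal (\<sigma>\<^sup>2)"
    using o X by (auto simp: oracle_at_def n_def)
  have sqM: "(\<lambda>w. ennreal ((norm (n w))\<^sup>2)) \<in> borel_measurable M" using nM by measurable
  have "(\<integral>\<^sup>+w. ennreal ((norm (n w))\<^sup>2) \<partial>M) = (\<integral>\<^sup>+w. nn_cond_exp M F (\<lambda>w. ennreal ((norm (n w))\<^sup>2)) w \<partial>M)"
    using nn_cond_exp_intg[of "\<lambda>_. 1", OF _ sqM] by simp
  also have "\<dots> \<le> (\<integral>\<^sup>+w. ennreal (\<sigma>\<^sup>2) \<partial>M)" using var by (rule nn_integral_mono_AE)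
  also have "\<dots> < \<infinity>" by (simp add: emeasure_space_1)
  finally have "integrable M (\<lambda>w. (norm (n w))\<^sup>2)"
    using nM by (intro integrableI_nonneg) auto
  then have sq: "integrable M (\<lambda>w. 1 + (norm (n w))\<^sup>2)" by simp
  have ni: "integrable M (\<lambda>w. n w $ i)" for i
  proof (rule Bochner_Integration.integrable_bound[OF sq measurable_vec_nth_comp[OF nM]])
    have "\<bar>n w $ i\<bar> \<le> 1 + (norm (n w))\<^sup>2" for w
    proof -
      have "\<bar>n w $ i\<bar> \<le> norm (n w)" by (rule component_le_norm_cart)
      also have "\<dots> \<le> 1 + (norm (n w))\<^sup>2"
      proof -
        have "2 * norm (n w) \<le> 1 + (norm (n w))\<^sup>2" using sum_squares_bound[of 1 "norm (n w)"] by simp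
        then show ?thesis using norm_ge_zero[of "n w"] by linarith
      qed
      finally show ?thesis .
    qed
    then show "AE w in M. norm (n w $ i) \<le> norm (1 + (norm (n w))\<^sup>2)" by (intro AE_I2) simp
  qed
  have G0i: "integrable M (\<lambda>w. G0 (X w) $ i)" for i
    by (rule integrable_const_bound[OF _ measurable_vec_nth_comp[OF G0M], where B = B])
      (auto intro!: AE_I2 order_trans[OF component_le_norm_cart] B)
  have Gi: "integrable M (\<lambda>w. G (X w) (\<zeta> w) $ i)" for i
    using Bochner_Integration.integrable_add[OF ni[of i] G0i[of i]] by (simp add: n_def)
  have "AE w in M. real_cond_exp M F (\<lambda>w. n w $ i) w = 0" for i
  proof -
    have 1: "AE w in M. real_cond_exp M F (\<lambda>w. G (X w) (\<zeta> w) $ i) w = G0 (X w) $ i"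
      using mean by eventually_elim (auto simp: vec_cond_exp_def dest!: arg_cong[where f = "\<lambda>v. v $ i"])
    have 2: "AE w in M. real_cond_exp M F (\<lambda>w. G0 (X w) $ i) w = G0 (X w) $ i"
      by (rule real_cond_exp_F_meas[OF G0i measurable_vec_nth_comp[OF G0F]])
    have 3: "AE w in M. real_cond_exp M F (\<lambda>w. G (X w) (\<zeta> w) $ i - G0 (X w) $ i) w
      = real_cond_exp M F (\<lambda>w. G (X w) (\<zeta> w) $ i) w - real_cond_exp M F (\<lambda>w. G0 (X w) $ i) w"
      by (rule real_cond_exp_diff[OF Gi G0i])
    show ?thesis using 1 2 3 by eventually_elim (simp add: n_def)
  qed
  then show ?thesis using nM ni by (simp add: centred_noise_def n_def)
qed

section \<open>Measurability of the geometric quantities\<close>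

context barrier
begin

text \<open>Total and measurable versions of the barrier Hessian, of its inverse and of the barrier gradient.
  The iterates lie inside the polytope only almost surely, and \<open>inv\<close> of an operator that is not
  bijective is arbitrary.\<close>

definition form_vec :: "real^'d \<Rightarrow> real^'d \<Rightarrow> real^'d" where
  "form_vec c u = (\<Sum>i\<in>UNIV. ((a i \<bullet> u) / (slack i c)\<^sup>2) *\<^sub>R a i)"

definition inv_vec :: "(real^'d) \<times> (real^'d) \<Rightarrow> real^'d" where
  "inv_vec cw = (if cw \<in> inside \<times> UNIV then inv (Hm (fst cw)) (snd cw) else 0)"

definition barrier_grad :: "real^'d \<Rightarrow> real^'d" where
  "barrier_grad y = (\<Sum>i\<in>UNIV. (1 / slack i y) *\<^sub>R a i)"

lemma form_vec: "c \<in> inside \<Longrightarrow> form_vec c u = Hm c u" by (simp add: form_vec_def hess_phi)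
lemma barrier_grad: "y \<in> inside \<Longrightarrow> barrier_grad y = grad (phi P) y" by (simp add: barrier_grad_def grad_phi)
lemma inv_vec: "c \<in> inside \<Longrightarrow> inv_vec (c, w) = inv (Hm c) w" by (simp add: inv_vec_def)

lemma slack_measurable: "f \<in> borel_measurable N \<Longrightarrow> (\<lambda>w. slack i (f w)) \<in> borel_measurable N"
  unfolding slack_def by measurable

lemma form_vec_measurable:
  "f \<in> borel_measurable N \<Longrightarrow> g \<in> borel_measurable N \<Longrightarrow> (\<lambda>w. form_vec (f w) (g w)) \<in> borel_measurable N"
  unfolding form_vec_def
  by (intro borel_measurable_sum borel_measurable_scaleR borel_measurable_divide borel_measurable_inner
      borel_measurable_power borel_measurable_const slack_measurable)

lemma barrier_grad_measurable: "f \<in> borel_measurable N \<Longrightarrow> (\<lambda>w. barrier_grad (f w)) \<in> borel_measurable N"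
  unfolding barrier_grad_def
  by (intro borel_measurable_sum borel_measurable_scaleR borel_measurable_divide borel_measurable_const slack_measurable)

text \<open>The Hessians are bounded below uniformly in \<open>c\<close>, so the distance between \<open>u = inv (Hm c) w\<close> and
  \<open>inv (Hm c') w'\<close> is at most a constant times \<open>norm (w' - Hm c' u)\<close>, which tends to \<open>0\<close>.\<close>

lemma inv_vec_continuous: "continuous_on (inside \<times> UNIV) (\<lambda>cw. inv (Hm (fst cw)) (snd cw))"
proof -
  obtain t where t: "0 < t" "\<And>c u. c \<in> inside \<Longrightarrow> (norm u)\<^sup>2 \<le> t\<^sup>2 * (Hm c u \<bullet> u)"
    using norm_le_dikin by blast
  have lower: "norm u \<le> t\<^sup>2 * norm (Hm c u)" if c: "c \<in> inside" for c u
  proof (cases "u = 0")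
    case False
    have "(norm u)\<^sup>2 \<le> t\<^sup>2 * (Hm c u \<bullet> u)" by (rule t(2)[OF c])
    also have "\<dots> \<le> t\<^sup>2 * (norm (Hm c u) * norm u)" by (intro mult_left_mono norm_cauchy_schwarz) simp
    finally show ?thesis using False by (simp add: power2_eq_square mult.assoc[symmetric])
  qed simp
  show ?thesis
    unfolding continuous_on_def
  proof
    fix cw assume cw: "cw \<in> inside \<times> (UNIV :: (real^'d) set)"
    obtain c w where e: "cw = (c, w)" by (cases cw)
    have c: "c \<in> inside" using cw e by simp
    let ?F = "at cw within inside \<times> (UNIV :: (real^'d) set)"
    define u where "u = inv (Hm c) w"
    have bound: "norm (inv (Hm (fst p)) (snd p) - u) \<le> t\<^sup>2 * norm (snd p - form_vec (fst p) u)"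
      if p: "p \<in> inside \<times> UNIV" for p
    proof -
      have pi: "fst p \<in> inside" using p by auto
      interpret H: spd "Hm (fst p)" by (rule spd_Hm[OF pi])
      have "Hm (fst p) (inv (Hm (fst p)) (snd p) - u) = snd p - form_vec (fst p) u"
        using H.lin by (simp add: linear_diff form_vec[OF pi])
      then show ?thesis using lower[OF pi, of "inv (Hm (fst p)) (snd p) - u"] by simp
    qed
    have sl: "(slack i c)\<^sup>2 \<noteq> 0" if "a i \<noteq> 0" for i using c that by (force simp: inside_iff)
    have "((\<lambda>p. ((a i \<bullet> u) / (slack i (fst p))\<^sup>2) *\<^sub>R a i) \<longlongrightarrow> ((a i \<bullet> u) / (slack i c)\<^sup>2) *\<^sub>R a i) ?F" for i
    proof (cases "a i = 0")
      case False
      have "((\<lambda>p. slack i (fst p)) \<longlongrightarrow> slack i (fst cw)) ?F"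
        unfolding slack_def by (intro tendsto_intros)
      then show ?thesis using sl[OF False] by (intro tendsto_intros) (auto simp: e)
    qed simp
    then have "((\<lambda>p. form_vec (fst p) u) \<longlongrightarrow> form_vec c u) ?F"
      unfolding form_vec_def by (intro tendsto_sum)
    moreover have "form_vec c u = w" unfolding form_vec[OF c] u_def using spd.H_inv[OF spd_Hm[OF c]] by simp
    ultimately have l: "((\<lambda>p. form_vec (fst p) u) \<longlongrightarrow> w) ?F" by simp
    have "((\<lambda>p. snd p) \<longlongrightarrow> w) ?F" using tendsto_snd[OF tendsto_ident_at, of cw] by (simp add: e)
    then have "((\<lambda>p. snd p - form_vec (fst p) u) \<longlongrightarrow> w - w) ?F" using l by (rule tendsto_diff)
    then have "((\<lambda>p. t\<^sup>2 * norm (snd p - form_vec (fst p) u)) \<longlongrightarrow> t\<^sup>2 * norm (w - w)) ?F"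
      by (intro tendsto_mult tendsto_const tendsto_norm)
    then have z: "((\<lambda>p. t\<^sup>2 * norm (snd p - form_vec (fst p) u)) \<longlongrightarrow> 0) ?F" by simp
    have "((\<lambda>p. inv (Hm (fst p)) (snd p) - u) \<longlongrightarrow> 0) ?F"
      by (rule Lim_null_comparison[OF _ z])
        (auto simp: eventually_at_filter intro!: always_eventually bound)
    then show "((\<lambda>cw. inv (Hm (fst cw)) (snd cw)) \<longlongrightarrow> inv (Hm (fst cw)) (snd cw)) ?F"
      using Lim_null[of "\<lambda>p. inv (Hm (fst p)) (snd p)" u] by (simp add: e u_def)
  qed
qed

lemma inv_vec_measurable:
  assumes "f \<in> borel_measurable N" "g \<in> borel_measurable N"
  shows "(\<lambda>w. inv_vec (f w, g w)) \<in> borel_measurable N"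
proof -
  have "inside \<times> (UNIV :: (real^'d) set) \<in> sets borel" by (intro borel_open open_Times) auto
  then have "inv_vec \<in> borel_measurable borel"
    unfolding inv_vec_def[abs_def]
    by (intro borel_measurable_continuous_on_if inv_vec_continuous continuous_intros)
  from measurable_compose[OF borel_measurable_Pair[OF assms] this] show ?thesis by simp
qed

end

context dikin_problem
begin

lemma ys_measurable: "f \<in> borel_measurable N \<Longrightarrow> (\<lambda>w. ys (f w)) \<in> borel_measurable N"
  by (rule measurable_compose, assumption, rule borel_measurable_continuous_onI)
    (auto intro!: continuous_at_imp_continuous_on has_derivative_continuous[OF ys_derivative])

lemma yl_measurable: "lam0 \<le> lam \<Longrightarrow> f \<in> borel_measurable N \<Longrightarrow> (\<lambda>w. yl lam (f w)) \<in> borel_measurable N"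
  by (rule measurable_compose, assumption, rule borel_measurable_continuous_onI)
    (auto intro!: continuous_at_imp_continuous_on has_derivative_continuous[OF yl_derivative])

lemma lipschitz_derivative_continuous:
  fixes d :: "real^'n \<Rightarrow> real^'d"
  assumes c: "\<And>x. c x \<in> inside" and d: "\<And>x. (d has_derivative d' x) (at x)"
    and L: "\<And>x x'. op_norm norm (dnorm P (c x)) (\<lambda>u. d' x' u - d' x u) \<le> L * norm (x' - x)"
  shows "continuous_on UNIV (\<lambda>x. d' x u)"
proof -
  obtain t where t: "0 < t" "\<And>c u. c \<in> inside \<Longrightarrow> norm u \<le> t * dnorm P c u" using norm_le_dnorm by blast
  have b: "norm (d' x' u - d' x u) \<le> t * (\<bar>L\<bar> * norm u) * norm (x' - x)" for x x'
  proof -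
    have lin: "linear (\<lambda>u. d' x' u - d' x u)" by (intro linear_compose_sub has_derivative_linear[OF d])
    have "norm (d' x' u - d' x u) \<le> t * dnorm P (c x) (d' x' u - d' x u)" by (rule t(2)[OF c])
    also have "\<dots> \<le> t * (L * norm (x' - x) * norm u)"
      using op_norm_2_dikin[OF c lin L] t(1) by (intro mult_left_mono) auto
    also have "\<dots> \<le> t * (\<bar>L\<bar> * norm (x' - x) * norm u)"
      using t(1) by (intro mult_left_mono mult_right_mono) auto
    finally show ?thesis by (simp add: mult_ac)
  qed
  have "(t * (\<bar>L\<bar> * norm u))-lipschitz_on UNIV (\<lambda>x. d' x u)"
    using t(1) by (intro lipschitz_onI) (auto simp: dist_norm b)
  then show ?thesis by (rule lipschitz_on_continuous_on)
qed

lemma J_continuous: "continuous_on UNIV (\<lambda>x. J x u)"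
  by (rule lipschitz_derivative_continuous[OF ystar_inside ys_derivative, where L = "l_star1 C"])
    (use constants in \<open>auto simp: local_dikin_constants_def\<close>)

lemma Jl_continuous: "lam0 \<le> lam \<Longrightarrow> continuous_on UNIV (\<lambda>x. Jl lam x u)"
  by (rule lipschitz_derivative_continuous[where c = "yl lam" and L = "l_lam1 C", OF yl_inside yl_derivative])
    (use constants lam0_pos in \<open>auto simp: local_dikin_constants_def\<close>)

lemma grad_Fmu_continuous: "continuous_on UNIV (grad (Fmu P))"
proof -
  have "\<bar>L_F C\<bar>-lipschitz_on UNIV (grad (Fmu P))"
    by (intro lipschitz_onI) (auto simp: dist_norm intro!: order_trans[OF grad_Fmu_lipschitz] mult_right_mono)
  then show ?thesis by (rule lipschitz_on_continuous_on)
qed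

text \<open>The adjoint of \<open>A\<close> as a finite sum, whose measurability in a parameter of \<open>A\<close> is immediate.\<close>

definition pullback :: "(real^'n \<Rightarrow> real^'d) \<Rightarrow> real^'d \<Rightarrow> real^'n" where
  "pullback A v = (\<Sum>b\<in>Basis. (v \<bullet> A b) *\<^sub>R b)"

lemma pullback: "linear A \<Longrightarrow> pullback A v \<bullet> n = v \<bullet> A n"
proof -
  assume A: "linear A"
  have "v \<bullet> A n = v \<bullet> A (\<Sum>b\<in>Basis. (n \<bullet> b) *\<^sub>R b)" by (simp add: euclidean_representation)
  also have "\<dots> = (\<Sum>b\<in>Basis. (n \<bullet> b) * (v \<bullet> A b))"
    using A by (simp add: linear_sum linear_cmul inner_sum_right)
  also have "\<dots> = (\<Sum>b\<in>Basis. (v \<bullet> A b) * (b \<bullet> n))"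
    by (intro sum.cong) (simp_all add: inner_commute)
  also have "\<dots> = pullback A v \<bullet> n" by (simp add: pullback_def inner_sum_left)
  finally show ?thesis by simp
qed

lemma pullback_measurable:
  assumes A: "\<And>u. continuous_on UNIV (\<lambda>x. A x u)" and f: "f \<in> borel_measurable N" and g: "g \<in> borel_measurable N"
  shows "(\<lambda>w. pullback (A (f w)) (g w)) \<in> borel_measurable N"
proof -
  have "(\<lambda>w. A (f w) b) \<in> borel_measurable N" for b
    by (rule measurable_compose[OF f borel_measurable_continuous_onI[OF A]])
  then show ?thesis unfolding pullback_def using g by measurable
qed

definition penalised_field :: "real \<Rightarrow> real^'n \<Rightarrow> real^'d \<Rightarrow> real^'d" where
  "penalised_field lam x y = grad_y (upper P) x y + lam *\<^sub>R (grad_y (lower P) x y + mu P *\<^sub>R barrier_grad y)"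

lemma penalised_field: "y \<in> inside \<Longrightarrow> penalised_field lam x y = penalised_grad lam x y"
  by (simp add: penalised_field_def penalised_grad_def grad_y_psi barrier_grad)

lemma penalised_field_measurable:
  assumes "f \<in> borel_measurable N" "g \<in> borel_measurable N"
  shows "(\<lambda>w. penalised_field lam (f w) (g w)) \<in> borel_measurable N"
proof -
  have "(\<lambda>w. grad_y (upper P) (f w) (g w)) \<in> borel_measurable N" "(\<lambda>w. grad_y (lower P) (f w) (g w)) \<in> borel_measurable N"
    using measurable_continuous_pair[OF continuous_grad_y[OF C2_upper] assms]
      measurable_continuous_pair[OF continuous_grad_y[OF C2_lower] assms] by simp_all
  then show ?thesis unfolding penalised_field_def using barrier_grad_measurable[OF assms(2)] by measurable
qed

end

section \<open>The stochastic run\<close>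

locale stochastic_run = schedule P R yl C \<eta> lam0 T \<xi> c\<xi> bfx bfy \<alpha> \<gamma> lam
  for P :: "('n::finite, 'd::finite, 'm::finite) bilevel" and R :: reg_consts
    and yl :: "real \<Rightarrow> real^'n \<Rightarrow> real^'d" and C :: dikin_consts and \<eta> lam0 :: real
    and T :: nat and \<xi> c\<xi> bfx bfy :: real and \<alpha> \<gamma> lam :: "nat \<Rightarrow> real" +
  fixes M :: "'w measure" and S :: "'s measure"
    and Hx :: "nat \<Rightarrow> 'w measure" and Hy :: "nat \<Rightarrow> nat \<Rightarrow> 'w measure"
    and Ox :: "(real^'n) \<times> (real^'d) \<Rightarrow> 's \<Rightarrow> real^'n" and Oy :: "(real^'n) \<times> (real^'d) \<Rightarrow> 's \<Rightarrow> real^'d"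
    and \<zeta>x :: "nat \<Rightarrow> 'w \<Rightarrow> 's" and \<zeta>y :: "nat \<Rightarrow> nat \<Rightarrow> 'w \<Rightarrow> 's"
    and x :: "nat \<Rightarrow> 'w \<Rightarrow> real^'n" and y z :: "nat \<Rightarrow> nat \<Rightarrow> 'w \<Rightarrow> real^'d"
    and x0 :: "real^'n" and y0 z0 :: "real^'d" and \<sigma>x \<sigma>y :: real
  assumes prob: "prob_space M"
    and run: "\<forall>w\<in>space M. barrier_run P T \<xi> \<alpha> \<gamma> lam Ox Oy (\<lambda>k. \<zeta>x k w) (\<lambda>k t. \<zeta>y k t w)
           (\<lambda>k. x k w) (\<lambda>k t. y k t w) (\<lambda>k t. z k t w)"
    and init: "\<forall>w\<in>space M. x 0 w = x0 \<and> y 0 0 w = y0 \<and> z 0 0 w = z0"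
    and z0: "z0 \<in> tube P \<eta> x0" and y0: "y0 \<in> dikin_tube P \<eta> (yl lam0 x0)"
    and hist: "history M T Hx Hy x y z"
    and oracles: "stochastic_oracles P M S T Hx Hy Ox Oy \<zeta>x \<zeta>y \<sigma>x \<sigma>y"
    and bounds: "oracle_local_bounds P yl \<eta> M T lam Hx Hy Ox Oy \<zeta>x \<zeta>y x y z bfx bfy"
    and below: "bdd_below (range (Fmu P))"
begin

abbreviation Gy :: "nat \<Rightarrow> 'w \<Rightarrow> nat \<Rightarrow> real^'d" where
  "Gy k w \<equiv> \<lambda>t. Oy (x k w, y k t w) (\<zeta>y k t w)"
abbreviation Gx :: "nat \<Rightarrow> 'w \<Rightarrow> real^'n" where
  "Gx k w \<equiv> Ox (x k w, y k T w) (\<zeta>x k w)"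

text \<open>The event on which iteration \<open>k\<close> starts in the neighbourhoods and its samples obey their bounds.\<close>

definition good :: "nat \<Rightarrow> 'w \<Rightarrow> bool" where
  "good k w \<longleftrightarrow> iteration P R yl C \<eta> lam0 T \<xi> c\<xi> bfx bfy \<alpha> \<gamma> lam k (x k w) (x (Suc k) w)
     (\<lambda>t. z k t w) (\<lambda>t. y k t w) (Gy k w) (Gx k w)"

lemma z_next: "w \<in> space M \<Longrightarrow> z (Suc k) 0 w = z k T w" and y_next: "w \<in> space M \<Longrightarrow> y (Suc k) 0 w = y k T w"
  using run by (auto simp: barrier_run_def)

lemma good_pointwise:
  assumes w: "w \<in> space M"
    and bdy: "\<And>k t. t < T \<Longrightarrow> z k t w \<in> tube P \<eta> (x k w) \<Longrightarrow> y k t w \<in> dikin_tube P \<eta> (yl (lam k) (x k w)) \<Longrightarrow>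
      dual_norm P (yl (lam k) (x k w)) (Gy k w t) \<le> bfy"
    and bdx: "\<And>k. z k T w \<in> tube P \<eta> (x k w) \<Longrightarrow> y k T w \<in> dikin_tube P \<eta> (yl (lam k) (x k w)) \<Longrightarrow>
      norm (Gx k w) \<le> bfx"
  shows "good k w"
proof -
  have r: "barrier_run P T \<xi> \<alpha> \<gamma> lam Ox Oy (\<lambda>k. \<zeta>x k w) (\<lambda>k t. \<zeta>y k t w)
           (\<lambda>k. x k w) (\<lambda>k t. y k t w) (\<lambda>k t. z k t w)" using run w by simp
  have step: "good k w" if "z k 0 w \<in> tube P \<eta> (x k w)" "y k 0 w \<in> dikin_tube P \<eta> (yl (lam k) (x k w))" for k
    unfolding good_def
    by (intro iteration.intro iteration_axioms.intro schedule_axioms that bdy bdx)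
      (use r in \<open>auto simp: barrier_run_def\<close>)
  have "z k 0 w \<in> tube P \<eta> (x k w) \<and> y k 0 w \<in> dikin_tube P \<eta> (yl (lam k) (x k w))" for k
  proof (induction k)
    case 0
    then show ?case using init z0 y0 w lam_0 by simp
  next
    case (Suc k)
    have "good k w" using Suc step by blast
    then have g: "iteration P R yl C \<eta> lam0 T \<xi> c\<xi> bfx bfy \<alpha> \<gamma> lam k (x k w) (x (Suc k) w)
     (\<lambda>t. z k t w) (\<lambda>t. y k t w) (Gy k w) (Gx k w)" by (simp only: good_def)
    show ?case using iteration.next_z[OF g] iteration.next_y[OF g] by (simp add: z_next[OF w] y_next[OF w])
  qed
  then show ?thesis using step by blast
qed

lemma hist_x: "x k \<in> borel_measurable (Hx k)" "y k T \<in> borel_measurable (Hx k)" "z k T \<in> borel_measurable (Hx k)"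
  and sub_x: "subalgebra M (Hx k)"
  using hist by (auto simp: history_def)

lemma hist_y: "t < T \<Longrightarrow> x k \<in> borel_measurable (Hy k t)" "t < T \<Longrightarrow> y k t \<in> borel_measurable (Hy k t)"
  and sub_y: "t < T \<Longrightarrow> subalgebra M (Hy k t)"
  using hist by (auto simp: history_def)

lemma hist_y0: "t < T \<Longrightarrow> y k 0 \<in> borel_measurable (Hy k t)"
proof -
  have "t < T \<Longrightarrow> subalgebra (Hy k t) (Hy k 0)"
  proof (induction t)
    case (Suc t)
    then have "subalgebra (Hy k t) (Hy k 0)" "subalgebra (Hy k (Suc t)) (Hy k t)"
      using hist by (auto simp: history_def)
    then show ?case by (auto simp: subalgebra_def)
  qed (simp add: subalgebra_def)
  moreover assume "t < T"
  ultimately show ?thesis using measurable_from_subalg hist_y(2)[of 0 k] by auto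
qed

text \<open>The almost sure bounds hold for each of the countably many queries, hence for all of them on one
  event, and on that event the neighbourhoods are preserved from one iteration to the next.\<close>

lemma AE_good: "AE w in M. \<forall>k. good k w"
proof -
  have tube2: "v \<in> dikin_tube P \<eta> c \<Longrightarrow> v \<in> dikin_tube P (2 * \<eta>) c" for v c
    using eta_pos by (auto simp: dikin_tube_def)
  have "AE w in M. t < T \<longrightarrow> z k t w \<in> tube P \<eta> (x k w) \<longrightarrow> y k t w \<in> dikin_tube P \<eta> (yl (lam k) (x k w)) \<longrightarrow>
      dual_norm P (yl (lam k) (x k w)) (Gy k w t) \<le> bfy" for k t
  proof (cases "t < T")
    case True
    have "AE w in M. z k t w \<in> tube P \<eta> (x k w) \<and> y k t w \<in> dikin_tube P \<eta> (yl (lam k) (x k w)) \<longrightarrow>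
          (y k t w \<in> tube P (2 * \<eta>) (x k w) \<longrightarrow>
             dual_norm P (ystar P (x k w)) (Oy (x k w, y k t w) (\<zeta>y k t w)) \<le> bfy) \<and>
          (y k t w \<in> dikin_tube P (2 * \<eta>) (yl (lam k) (x k w)) \<longrightarrow>
             dual_norm P (yl (lam k) (x k w)) (Oy (x k w, y k t w) (\<zeta>y k t w)) \<le> bfy)"
      using bounds True hist_y(2)[OF True, of k] unfolding oracle_local_bounds_def by blast
    then show ?thesis by eventually_elim (use tube2 in blast)
  qed simp
  then have 1: "AE w in M. \<forall>k t. t < T \<longrightarrow> z k t w \<in> tube P \<eta> (x k w) \<longrightarrow> y k t w \<in> dikin_tube P \<eta> (yl (lam k) (x k w)) \<longrightarrow>
      dual_norm P (yl (lam k) (x k w)) (Gy k w t) \<le> bfy"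
    by (simp add: AE_all_countable)
  have "AE w in M. z k T w \<in> tube P \<eta> (x k w) \<longrightarrow> y k T w \<in> dikin_tube P \<eta> (yl (lam k) (x k w)) \<longrightarrow>
      norm (Gx k w) \<le> bfx" for k
  proof -
    have "AE w in M. z k T w \<in> tube P \<eta> (x k w) \<and> y k T w \<in> dikin_tube P \<eta> (yl (lam k) (x k w)) \<and>
        y k T w \<in> tube P (2 * \<eta>) (x k w) \<union> dikin_tube P (2 * \<eta>) (yl (lam k) (x k w)) \<longrightarrow>
          norm (Ox (x k w, y k T w) (\<zeta>x k w)) \<le> bfx"
      using bounds hist_x(2)[of k] unfolding oracle_local_bounds_def by blast
    then show ?thesis by eventually_elim (use tube2 in blast)
  qed
  then have 2: "AE w in M. \<forall>k. z k T w \<in> tube P \<eta> (x k w) \<longrightarrow> y k T w \<in> dikin_tube P \<eta> (yl (lam k) (x k w)) \<longrightarrow>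
      norm (Gx k w) \<le> bfx"
    by (simp add: AE_all_countable)
  show ?thesis using 1 2 AE_space
    by eventually_elim (intro allI good_pointwise; blast)
qed

text \<open>The noise terms, written through globally defined measurable functions; on the good event they
  agree with the terms of the one-step inequality.\<close>

definition nx :: "nat \<Rightarrow> 'w \<Rightarrow> real^'n" where "nx k w = Gx k w - grad_x (upper P) (x k w) (y k T w)"
definition ny :: "nat \<Rightarrow> nat \<Rightarrow> 'w \<Rightarrow> real^'d" where "ny k t w = Gy k w t - grad_y (upper P) (x k w) (y k t w)"

definition Uz :: "nat \<Rightarrow> 'w \<Rightarrow> real^'n" where
  "Uz k w = pullback (J (x k w)) (form_vec (ys (x k w)) (z k T w - ys (x k w)))"
definition Uy :: "nat \<Rightarrow> 'w \<Rightarrow> real^'n" where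
  "Uy k w = pullback (Jl (lam k) (x k w)) (form_vec (yl (lam k) (x k w)) (y k T w - yl (lam k) (x k w)))"
definition Uc :: "nat \<Rightarrow> nat \<Rightarrow> 'w \<Rightarrow> real^'d" where
  "Uc k t w = inv_vec (y k 0 w, form_vec (yl (lam k) (x k w))
     (y k t w - \<alpha> k *\<^sub>R inv_vec (y k 0 w, penalised_field (lam k) (x k w) (y k t w)) - yl (lam k) (x k w)))"

definition total_noise :: "nat \<Rightarrow> 'w \<Rightarrow> real" where
  "total_noise k w = - (\<xi> * \<alpha> k) * (grad (Fmu P) (x k w) \<bullet> nx k w)
    + (\<kappa> * lam (Suc k)) * Dz k * 2 * (\<xi> * \<alpha> k) * (Uz k w \<bullet> nx k w)
    + (\<kappa> * lam (Suc k)) * Dy k * 2 * (\<xi> * \<alpha> k) * (Uy k w \<bullet> nx k w)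
    - (\<kappa> * lam k) * ry k * (2 * \<alpha> k * (\<Sum>t<T. (1 - qy k) ^ (2 * (T - 1 - t)) * (Uc k t w \<bullet> ny k t w)))"

text \<open>The potential: the objective plus the weighted squared tracking errors.\<close>

definition pot :: "nat \<Rightarrow> 'w \<Rightarrow> real" where
  "pot k w = Fmu P (x k w) + (\<kappa> * lam k) * ((dnorm P (ys (x k w)) (z k 0 w - ys (x k w)))\<^sup>2
     + (dnorm P (yl (lam k) (x k w)) (y k 0 w - yl (lam k) (x k w)))\<^sup>2)"

text \<open>A deterministic bound on the distance of the \<open>k\<close>-th iterate from the start; it makes all quantities
  along the run bounded.\<close>

definition reach :: "nat \<Rightarrow> real" where
  "reach k = (\<Sum>j<k. \<xi> * \<beta> j * (bfx / lam0 + 2 * l_g0 R))"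

context
  fixes k w assumes g: "good k w" and w: "w \<in> space M"
begin

interpretation it: iteration P R yl C \<eta> lam0 T \<xi> c\<xi> bfx bfy \<alpha> \<gamma> lam k "x k w" "x (Suc k) w"
     "\<lambda>t. z k t w" "\<lambda>t. y k t w" "Gy k w" "Gx k w"
  using g by (simp only: good_def)

lemma good_tubes:
  "t \<le> T \<Longrightarrow> z k t w \<in> tube P \<eta> (x k w)" "t \<le> T \<Longrightarrow> y k t w \<in> dikin_tube P \<eta> (yl (lam k) (x k w))"
  "z (Suc k) 0 w \<in> tube P \<eta> (x (Suc k) w)" "y (Suc k) 0 w \<in> dikin_tube P \<eta> (yl (lam (Suc k)) (x (Suc k) w))"
  using it.z_track[of t] it.y_track[of t] it.next_z it.next_y by (auto simp: z_next[OF w] y_next[OF w])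

lemma good_shift: "norm (x (Suc k) w - x k w) \<le> \<xi> * \<beta> k * (bfx / lam0 + 2 * l_g0 R)"
  using it.x_shift by (simp add: it.shift_def)

lemma nx_eq: "nx k w = it.nx" by (simp add: nx_def it.nx_def)
lemma ny_eq: "ny k t w = it.noise t" by (simp add: ny_def it.noise_def)

lemma noise_f_eq: "grad (Fmu P) (x k w) \<bullet> nx k w = it.noise_f"
  by (simp add: it.noise_f_def nx_eq)

lemma noise_z_eq: "Uz k w \<bullet> nx k w = it.noise_z"
  by (simp add: it.noise_z_def nx_eq Uz_def pullback[OF has_derivative_linear[OF ys_derivative]] form_vec[OF it.c_in])

lemma noise_y_eq: "Uy k w \<bullet> nx k w = it.noise_y"
  by (simp add: it.noise_y_def nx_eq Uy_def pullback[OF has_derivative_linear[OF yl_derivative[OF lam_ge]]] form_vec[OF it.m_in])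

lemma cross_eq: "t < T \<Longrightarrow> Uc k t w \<bullet> ny k t w = it.cross t"
proof -
  assume t: "t < T"
  have "y k 0 w \<in> inside" "y k t w \<in> inside"
    using it.y_track[of 0] it.y_track[of t] t by (auto simp: dikin_tube_def)
  then show ?thesis
    by (simp add: it.cross_def ny_eq Uc_def inv_vec form_vec[OF it.m_in] penalised_field it.det_step_def)
qed

lemma total_noise_eq: "total_noise k w = it.noise_sum"
  by (simp add: total_noise_def it.noise_sum_def noise_f_eq noise_z_eq noise_y_eq cross_eq cong: sum.cong_simp)

lemma pot_step:
  assumes "advanced k"
  shows "pot (Suc k) w - pot k w + \<xi> * \<alpha> k * (norm (grad (Fmu P) (x k w)))\<^sup>2 / 2 \<le> err k + total_noise k w"
  using it.potential_decrease[OF assms] by (simp add: pot_def total_noise_eq z_next[OF w] y_next[OF w])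

lemma noise_bounds:
  "\<bar>grad (Fmu P) (x k w) \<bullet> nx k w\<bar> \<le> norm (grad (Fmu P) (x k w)) * nx_max"
  "\<bar>Uz k w \<bullet> nx k w\<bar> \<le> l_star0 C * nx_max" "\<bar>Uy k w \<bullet> nx k w\<bar> \<le> l_lam0 C * nx_max"
  "t < T \<Longrightarrow> \<bar>Uc k t w \<bullet> ny k t w\<bar> \<le> 5/4 * \<sigma>b" "0 \<le> nx_max"
  using it.noise_f_bound it.noise_z_bound it.noise_y_bound it.cross_bound[of t]
    order_trans[OF norm_ge_zero it.nx_bound]
  by (simp_all add: noise_f_eq noise_z_eq noise_y_eq cross_eq)

lemma pot_le: "pot k w \<le> Fmu P (x k w) + 2 * (\<kappa> * lam k)"
proof -
  have "dnorm P (ys (x k w)) (z k 0 w - ys (x k w)) \<le> 1" "dnorm P (yl (lam k) (x k w)) (y k 0 w - yl (lam k) (x k w)) \<le> 1"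
    using good_tubes(1,2)[of 0] eta_half by (auto simp: dikin_tube_def)
  then have "(dnorm P (ys (x k w)) (z k 0 w - ys (x k w)))\<^sup>2 + (dnorm P (yl (lam k) (x k w)) (y k 0 w - yl (lam k) (x k w)))\<^sup>2 \<le> 1 + 1"
    using dnorm_nonneg[OF it.c_in] dnorm_nonneg[OF it.m_in] by (intro add_mono) (auto simp: power_le_one)
  then have "(\<kappa> * lam k) * ((dnorm P (ys (x k w)) (z k 0 w - ys (x k w)))\<^sup>2 + (dnorm P (yl (lam k) (x k w)) (y k 0 w - yl (lam k) (x k w)))\<^sup>2)
    \<le> (\<kappa> * lam k) * 2"
    using kappa_pos lam_pos[of k] by (intro mult_left_mono) auto
  then show ?thesis by (simp add: pot_def mult_ac)
qed

end

lemma pot_ge: "Fmu P (x k w) \<le> pot k w"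
  using kappa_pos lam_pos[of k] by (simp add: pot_def)

lemma nx_centred: "centred_noise M (Hx k) (nx k)"
proof -
  have "centred_noise M (Hx k) (\<lambda>w. Ox (x k w, y k T w) (\<zeta>x k w) - (\<lambda>(x, y). grad_x (upper P) x y) (x k w, y k T w))"
  proof (rule oracle_noise_centred[OF prob sub_x, where B = "l_f0 R" and S = S])
    show "oracle_at M (Hx k) (\<zeta>x k) Ox (\<lambda>(x, y). grad_x (upper P) x y) \<sigma>x"
      "(\<lambda>(v, s). Ox v s) \<in> borel_measurable (borel \<Otimes>\<^sub>M S)" "\<zeta>x k \<in> measurable M S"
      using oracles by (auto simp: stochastic_oracles_def)
    show "(\<lambda>w. (x k w, y k T w)) \<in> borel_measurable (Hx k)" by (rule borel_measurable_Pair[OF hist_x(1,2)])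
    show "continuous_on UNIV (\<lambda>(x, y). grad_x (upper P) x y)" by (rule continuous_grad_x[OF C2_upper])
    show "norm (case v of (x, y) \<Rightarrow> grad_x (upper P) x y) \<le> l_f0 R" for v
      using regular by (auto simp: objective_regularity_def split: prod.split)
  qed
  then show ?thesis by (simp add: nx_def[abs_def])
qed

lemma ny_centred:
  assumes t: "t < T" shows "centred_noise M (Hy k t) (ny k t)"
proof -
  have "centred_noise M (Hy k t) (\<lambda>w. Oy (x k w, y k t w) (\<zeta>y k t w) - (\<lambda>(x, y). grad_y (upper P) x y) (x k w, y k t w))"
  proof (rule oracle_noise_centred[OF prob sub_y[OF t], where B = "l_f0 R" and S = S])
    show "oracle_at M (Hy k t) (\<zeta>y k t) Oy (\<lambda>(x, y). grad_y (upper P) x y) \<sigma>y"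
      "(\<lambda>(v, s). Oy v s) \<in> borel_measurable (borel \<Otimes>\<^sub>M S)" "\<zeta>y k t \<in> measurable M S"
      using oracles t by (auto simp: stochastic_oracles_def)
    show "(\<lambda>w. (x k w, y k t w)) \<in> borel_measurable (Hy k t)" by (rule borel_measurable_Pair[OF hist_y(1,2)[OF t]])
    show "continuous_on UNIV (\<lambda>(x, y). grad_y (upper P) x y)" by (rule continuous_grad_y[OF C2_upper])
    show "norm (case v of (x, y) \<Rightarrow> grad_y (upper P) x y) \<le> l_f0 R" for v
      using regular by (auto simp: objective_regularity_def split: prod.split)
  qed
  then show ?thesis by (simp add: ny_def[abs_def])
qed

lemma gradF_measurable: "(\<lambda>w. grad (Fmu P) (x k w)) \<in> borel_measurable (Hx k)"
  by (rule measurable_compose[OF hist_x(1) borel_measurable_continuous_onI[OF grad_Fmu_continuous]])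

lemma Uz_measurable: "Uz k \<in> borel_measurable (Hx k)"
  unfolding Uz_def[abs_def]
  by (intro pullback_measurable J_continuous hist_x form_vec_measurable ys_measurable borel_measurable_diff)

lemma Uy_measurable: "Uy k \<in> borel_measurable (Hx k)"
  unfolding Uy_def[abs_def]
  by (intro pullback_measurable Jl_continuous hist_x form_vec_measurable yl_measurable borel_measurable_diff lam_ge)

lemma Uc_measurable: "t < T \<Longrightarrow> Uc k t \<in> borel_measurable (Hy k t)"
  unfolding Uc_def[abs_def]
  by (intro inv_vec_measurable form_vec_measurable yl_measurable borel_measurable_diff borel_measurable_scaleR
      borel_measurable_const penalised_field_measurable hist_y hist_y0 lam_ge)

lemma good_space: "AE w in M. w \<in> space M \<and> (\<forall>k. good k w)"
  using AE_good AE_space by eventually_elim simp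

lemma reach_bound: "AE w in M. \<forall>k. norm (x k w - x0) \<le> reach k"
  using good_space
proof eventually_elim
  case (elim w)
  show ?case
  proof
    fix k show "norm (x k w - x0) \<le> reach k"
    proof (induction k)
      case 0
      then show ?case using init elim by (simp add: reach_def)
    next
      case (Suc k)
      have "norm (x (Suc k) w - x0) \<le> norm (x (Suc k) w - x k w) + norm (x k w - x0)"
        using norm_triangle_ineq[of "x (Suc k) w - x k w" "x k w - x0"] by simp
      also have "\<dots> \<le> reach (Suc k)" using good_shift[of k w] elim Suc by (simp add: reach_def)
      finally show ?case .
    qed
  qed
qed

definition gmax :: "nat \<Rightarrow> real" where "gmax k = norm (grad (Fmu P) x0) + \<bar>L_F C\<bar> * reach k"

lemma gradF_bound: "AE w in M. \<forall>k. norm (grad (Fmu P) (x k w)) \<le> gmax k"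
  using reach_bound
proof eventually_elim
  case (elim w)
  show ?case
  proof
    fix k
    have "norm (grad (Fmu P) (x k w)) \<le> norm (grad (Fmu P) x0) + norm (grad (Fmu P) (x k w) - grad (Fmu P) x0)"
      using norm_triangle_ineq[of "grad (Fmu P) x0" "grad (Fmu P) (x k w) - grad (Fmu P) x0"] by simp
    also have "\<dots> \<le> norm (grad (Fmu P) x0) + L_F C * norm (x k w - x0)" by (intro add_left_mono grad_Fmu_lipschitz)
    also have "\<dots> \<le> norm (grad (Fmu P) x0) + \<bar>L_F C\<bar> * reach k"
      using elim by (intro add_left_mono mult_mono) auto
    finally show "norm (grad (Fmu P) (x k w)) \<le> gmax k" by (simp add: gmax_def)
  qed
qed

lemma gradF_sq_integrable: "integrable M (\<lambda>w. (norm (grad (Fmu P) (x k w)))\<^sup>2)"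
proof -
  interpret prob_space M by (rule prob)
  have [measurable]: "(\<lambda>w. grad (Fmu P) (x k w)) \<in> borel_measurable M"
    by (rule measurable_from_subalg[OF sub_x gradF_measurable])
  show ?thesis
  proof (rule integrable_const_bound)
    show "AE w in M. norm ((norm (grad (Fmu P) (x k w)))\<^sup>2) \<le> (gmax k)\<^sup>2"
      using gradF_bound by eventually_elim (auto intro: power_mono)
  qed measurable
qed

lemma total_noise_mean: "integrable M (total_noise k)" "(\<integral>w. total_noise k w \<partial>M) = 0"
proof -
  have b1: "AE w in M. \<bar>grad (Fmu P) (x k w) \<bullet> nx k w\<bar> \<le> gmax k * nx_max"
    using good_space gradF_bound
  proof eventually_elim
    case (elim w)
    have "norm (grad (Fmu P) (x k w)) * nx_max \<le> gmax k * nx_max"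
      using elim noise_bounds(5)[of k w] by (intro mult_right_mono) auto
    then show ?case using noise_bounds(1)[of k w] elim by auto
  qed
  note 1 = centred_noise_orthogonal[OF prob sub_x nx_centred gradF_measurable b1]
  have b2: "AE w in M. \<bar>Uz k w \<bullet> nx k w\<bar> \<le> l_star0 C * nx_max" "AE w in M. \<bar>Uy k w \<bullet> nx k w\<bar> \<le> l_lam0 C * nx_max"
    using good_space by (eventually_elim, use noise_bounds in blast)+
  note 2 = centred_noise_orthogonal[OF prob sub_x nx_centred Uz_measurable b2(1)]
  note 3 = centred_noise_orthogonal[OF prob sub_x nx_centred Uy_measurable b2(2)]
  have b4: "AE w in M. \<bar>Uc k t w \<bullet> ny k t w\<bar> \<le> 5/4 * \<sigma>b" if "t < T" for t
    using good_space by eventually_elim (use noise_bounds(4) that in blast)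
  note 4 = centred_noise_orthogonal[OF prob sub_y ny_centred Uc_measurable b4]
  have i4: "integrable M (\<lambda>w. \<Sum>t<T. (1 - qy k) ^ (2 * (T - 1 - t)) * (Uc k t w \<bullet> ny k t w))"
    using 4(1) by (intro Bochner_Integration.integrable_sum integrable_mult_right) auto
  have z4: "(\<integral>w. (\<Sum>t<T. (1 - qy k) ^ (2 * (T - 1 - t)) * (Uc k t w \<bullet> ny k t w)) \<partial>M) = 0"
    using 4 by (subst Bochner_Integration.integral_sum) auto
  show "integrable M (total_noise k)"
    unfolding total_noise_def[abs_def]
    by (intro Bochner_Integration.integrable_add Bochner_Integration.integrable_diff integrable_mult_right 1 2 3 i4)
  show "(\<integral>w. total_noise k w \<partial>M) = 0"
    unfolding total_noise_def
    using 1 2 3 i4 z4 by simp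
qed

text \<open>The one-step inequality is summed before it is integrated, so the potential enters only
  through bounds: its first value is bounded, and its last value is at least the infimum of the
  objective. The noise terms have mean zero.\<close>

lemma summed_decrease:
  assumes adv: "\<And>k. k1 \<le> k \<Longrightarrow> advanced k"
  shows "\<exists>B. \<forall>K\<ge>k1. (\<Sum>k\<in>{k1..<K}. \<alpha> k * (\<integral>w. (norm (grad (Fmu P) (x k w)))\<^sup>2 \<partial>M))
    \<le> 2 / \<xi> * (B + (\<Sum>k\<in>{k1..<K}. err k))"
proof -
  interpret prob_space M by (rule prob)
  obtain Fi where Fi: "\<And>v. Fi \<le> Fmu P v" using below by (auto simp: bdd_below_def)
  define B where "B = Fmu P x0 + norm (grad (Fmu P) x0) * reach k1 + \<bar>L_F C\<bar> * (reach k1)\<^sup>2 + 2 * (\<kappa> * lam k1) - Fi"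
  have "(\<Sum>k\<in>{k1..<K}. \<alpha> k * (\<integral>w. (norm (grad (Fmu P) (x k w)))\<^sup>2 \<partial>M)) \<le> 2 / \<xi> * (B + (\<Sum>k\<in>{k1..<K}. err k))"
    if K: "k1 \<le> K" for K
  proof -
    have "AE w in M. (\<Sum>k\<in>{k1..<K}. \<xi> * \<alpha> k / 2 * (norm (grad (Fmu P) (x k w)))\<^sup>2)
        \<le> B + (\<Sum>k\<in>{k1..<K}. err k) + (\<Sum>k\<in>{k1..<K}. total_noise k w)"
      using good_space reach_bound
    proof eventually_elim
      case (elim w)
      have "pot K w - pot k1 w + (\<Sum>k\<in>{k1..<K}. \<xi> * \<alpha> k / 2 * (norm (grad (Fmu P) (x k w)))\<^sup>2)
        \<le> (\<Sum>k\<in>{k1..<K}. err k) + (\<Sum>k\<in>{k1..<K}. total_noise k w)"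
        using K
      proof (induction K rule: dec_induct)
        case (step K)
        have "pot (Suc K) w - pot K w + \<xi> * \<alpha> K * (norm (grad (Fmu P) (x K w)))\<^sup>2 / 2 \<le> err K + total_noise K w"
          using pot_step elim adv step(1) by blast
        then show ?case using step by (simp add: sum.atLeastLessThan_Suc)
      qed simp
      moreover have "Fi \<le> pot K w" using Fi pot_ge order_trans by blast
      moreover have "pot k1 w \<le> B + Fi"
      proof -
        have r: "norm (x k1 w - x0) \<le> reach k1" using elim by simp
        have "grad (Fmu P) x0 \<bullet> (x k1 w - x0) \<le> norm (grad (Fmu P) x0) * norm (x k1 w - x0)" by (rule norm_cauchy_schwarz)
        also have "\<dots> \<le> norm (grad (Fmu P) x0) * reach k1" using r by (intro mult_left_mono) auto
        finally have 1: "grad (Fmu P) x0 \<bullet> (x k1 w - x0) \<le> norm (grad (Fmu P) x0) * reach k1" .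
        have 2: "\<bar>L_F C\<bar> * (norm (x k1 w - x0))\<^sup>2 \<le> \<bar>L_F C\<bar> * (reach k1)\<^sup>2"
          using r by (intro mult_left_mono power_mono) auto
        have "pot k1 w \<le> Fmu P (x k1 w) + 2 * (\<kappa> * lam k1)" using pot_le elim by blast
        then show ?thesis using descent[of "x k1 w" x0] 1 2 by (simp add: B_def)
      qed
      ultimately show ?case by simp
    qed
    then have "(\<integral>w. (\<Sum>k\<in>{k1..<K}. \<xi> * \<alpha> k / 2 * (norm (grad (Fmu P) (x k w)))\<^sup>2) \<partial>M)
        \<le> (\<integral>w. B + (\<Sum>k\<in>{k1..<K}. err k) + (\<Sum>k\<in>{k1..<K}. total_noise k w) \<partial>M)"
      by (intro integral_mono_AE Bochner_Integration.integrable_sum integrable_mult_right gradF_sq_integrable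
          Bochner_Integration.integrable_add integrable_const total_noise_mean)
    also have "\<dots> = B + (\<Sum>k\<in>{k1..<K}. err k)"
      using total_noise_mean by (simp add: prob_space)
    also have "(\<integral>w. (\<Sum>k\<in>{k1..<K}. \<xi> * \<alpha> k / 2 * (norm (grad (Fmu P) (x k w)))\<^sup>2) \<partial>M)
      = (\<Sum>k\<in>{k1..<K}. \<xi> * \<alpha> k / 2 * (\<integral>w. (norm (grad (Fmu P) (x k w)))\<^sup>2 \<partial>M))"
      using gradF_sq_integrable by simp
    also have "\<dots> = \<xi> / 2 * (\<Sum>k\<in>{k1..<K}. \<alpha> k * (\<integral>w. (norm (grad (Fmu P) (x k w)))\<^sup>2 \<partial>M))"
      by (simp add: sum_distrib_left mult_ac)
    finally show ?thesis using xi by (simp add: field_simps)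
  qed
  then show ?thesis by blast
qed

end

section \<open>Rates\<close>

lemma inverse_sum_le_ln:
  assumes "0 < k0" "1 \<le> k1" "k1 < K"
  shows "(\<Sum>k\<in>{k1..<K}. 1 / (real k + k0)) \<le> ln (real K) + 1"
proof -
  have "(\<Sum>k\<in>{k1..<K}. 1 / (real k + k0)) \<le> (\<Sum>k\<in>{k1..<K}. 1 / real k)"
    using assms by (intro sum_mono divide_left_mono) auto
  also have "\<dots> \<le> (\<Sum>k\<in>{1..K}. 1 / real k)" using assms by (intro sum_mono2) auto
  also have "\<dots> = harm K" by (simp add: harm_def inverse_eq_divide)
  also have "\<dots> \<le> ln (real K) + 1"
  proof -
    obtain n where "K = Suc n" using assms by (cases K) auto
    then show ?thesis using decseqD[OF decseq_harm_diff_ln, of 0 n] by (simp add: harm_expand)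
  qed
  finally show ?thesis .
qed

text \<open>With weights of order \<open>k powr (-3/5)\<close> the total weight is of order \<open>K powr (2/5)\<close>, and a weighted
  sum of order \<open>ln K\<close> pushes the smallest term down to order \<open>ln K * K powr (-2/5)\<close>.\<close>

lemma weighted_min_rate:
  fixes g :: "nat \<Rightarrow> real"
  assumes a0: "0 < \<alpha>0" and k0: "0 < k0" and D: "0 \<le> D"
    and g: "\<And>k. 0 \<le> g k"
    and sum: "\<And>K. k1 \<le> K \<Longrightarrow> (\<Sum>k\<in>{k1..<K}. \<alpha>0 / (real k + k0) powr (3/5) * g k)
      \<le> B + D * (\<Sum>k\<in>{k1..<K}. 1 / (real k + k0))" and k1: "1 \<le> k1"
  shows "\<exists>C>0. eventually (\<lambda>K. Min (g ` {0..<K}) \<le> C * (ln (real K) * real K powr (-2/5))) sequentially"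
proof -
  define c where "c = \<alpha>0 / (2 * 2 powr (3/5))"
  have c: "0 < c" using a0 by (simp add: c_def)
  define C where "C = (\<bar>B\<bar> + 2 * D + 1) / c"
  have C: "0 < C" using c D by (simp add: C_def add_nonneg_pos)
  have "Min (g ` {0..<K}) \<le> C * (ln (real K) * real K powr (-2/5))"
    if K: "2 * k1 + 3 \<le> K" "k0 \<le> real K" for K
  proof -
    define b where "b = Min (g ` {0..<K})"
    have bg: "b \<le> g k" if "k < K" for k unfolding b_def using that by (intro Min_le) auto
    have b0: "0 \<le> b"
    proof -
      have "b \<in> g ` {0..<K}" unfolding b_def using K by (intro Min_in) auto
      then show ?thesis using g by auto
    qed
    have Kp: "0 < real K" using K by simp
    have w: "\<alpha>0 / (2 * real K) powr (3/5) \<le> \<alpha>0 / (real k + k0) powr (3/5)" if "k < K" for k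
      using a0 k0 that K by (intro divide_left_mono powr_mono2 mult_pos_pos) auto
    have "c * real K powr (2/5) * b \<le> (real K / 2) * (\<alpha>0 / (2 * real K) powr (3/5)) * b"
    proof -
      have "real K powr (2/5) = real K * real K powr (-3/5)"
        using Kp powr_add[of "real K" 1 "-3/5"] by simp
      then have "c * real K powr (2/5) = (real K / 2) * (\<alpha>0 / (2 * real K) powr (3/5))"
        using Kp by (simp add: c_def powr_mult powr_minus_divide mult_ac)
      then show ?thesis by simp
    qed
    also have "\<dots> \<le> real (K - k1) * (\<alpha>0 / (2 * real K) powr (3/5)) * b"
      using K a0 b0 by (intro mult_right_mono) auto
    also have "\<dots> = (\<Sum>k\<in>{k1..<K}. (\<alpha>0 / (2 * real K) powr (3/5)) * b)" by simp
    also have "\<dots> \<le> (\<Sum>k\<in>{k1..<K}. \<alpha>0 / (real k + k0) powr (3/5) * g k)"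
      using w bg b0 a0 by (intro sum_mono mult_mono) auto
    also have "\<dots> \<le> B + D * (\<Sum>k\<in>{k1..<K}. 1 / (real k + k0))" using K by (intro sum) auto
    also have "\<dots> \<le> \<bar>B\<bar> + D * (ln (real K) + 1)"
      using D inverse_sum_le_ln[OF k0 k1, of K] K by (intro add_mono mult_left_mono) auto
    also have "\<dots> \<le> (\<bar>B\<bar> + 2 * D + 1) * ln (real K)"
    proof -
      have "exp 1 \<le> real K" using exp_le K by linarith
      then have l: "1 \<le> ln (real K)" using Kp by (simp add: ln_ge_iff)
      have "\<bar>B\<bar> * 1 \<le> \<bar>B\<bar> * ln (real K)" "D * 1 \<le> D * ln (real K)"
        using l D by (intro mult_left_mono; simp)+
      then show ?thesis using l by (simp add: algebra_simps)
    qed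
    finally have "c * real K powr (2/5) * b \<le> (\<bar>B\<bar> + 2 * D + 1) * ln (real K)" .
    then have "b \<le> (\<bar>B\<bar> + 2 * D + 1) * ln (real K) / (c * real K powr (2/5))"
      using c Kp by (simp add: pos_le_divide_eq mult.commute)
    also have "\<dots> = C * (ln (real K) * real K powr (-2/5))"
      by (simp add: C_def powr_minus_divide)
    finally show ?thesis by (simp add: b_def)
  qed
  moreover have "eventually (\<lambda>K. 2 * k1 + 3 \<le> K \<and> k0 \<le> real K) sequentially"
    by (intro eventually_conj eventually_ge_at_top eventually_compose_filterlim[OF eventually_ge_at_top filterlim_real_sequentially])
  ultimately have "eventually (\<lambda>K. Min (g ` {0..<K}) \<le> C * (ln (real K) * real K powr (-2/5))) sequentially"
    by (auto elim: eventually_mono)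
  then show ?thesis using C by blast
qed

lemma rate_soft_O:
  fixes b :: "nat \<Rightarrow> real"
  assumes C: "0 < C" and b: "eventually (\<lambda>K. b K \<le> C * (ln (real K) * real K powr (-2/5))) sequentially"
    and b0: "eventually (\<lambda>K. 0 \<le> b K) sequentially"
  shows "soft_O at_top b (\<lambda>K. real K powr (-2/5))"
  unfolding soft_O_def
proof (intro exI bigoI)
  show "eventually (\<lambda>K. norm (b K) \<le> (C * 5/2) * norm (real K powr (-2/5) * \<bar>ln \<bar>real K powr (-2/5)\<bar>\<bar> ^ 1)) at_top"
    using b b0 eventually_gt_at_top[of 0]
  proof eventually_elim
    case (elim K)
    have "\<bar>ln \<bar>real K powr (-2/5)\<bar>\<bar> = 2/5 * ln (real K)" using elim by (simp add: ln_powr)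
    then show ?case using elim by (simp add: mult_ac)
  qed
qed

text \<open>The rate \<open>ln K * K powr (-2/5)\<close> falls below \<open>\<epsilon>\<close> once \<open>K\<close> exceeds \<open>\<epsilon> powr (-5/2)\<close> by a factor that
  beats \<open>ln K powr (5/2)\<close>; the cube of \<open>ln (1/\<epsilon>)\<close> is such a factor.\<close>

lemma rate_complexity:
  fixes b :: "nat \<Rightarrow> real"
  assumes C: "0 < C" and b: "eventually (\<lambda>K. b K \<le> C * (ln (real K) * real K powr (-2/5))) sequentially"
  shows "\<exists>N :: real \<Rightarrow> nat. soft_O (at_right 0) (\<lambda>\<epsilon>. real (N \<epsilon>)) (\<lambda>\<epsilon>. \<epsilon> powr (-5/2)) \<and>
            (\<forall>\<epsilon>>0. N \<epsilon> \<ge> 1 \<and> b (N \<epsilon>) \<le> \<epsilon>)"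
proof -
  obtain K0 where K0: "\<And>K. K0 \<le> K \<Longrightarrow> b K \<le> C * (ln (real K) * real K powr (-2/5))"
    using b by (auto simp: eventually_sequentially)
  have ex: "\<exists>K\<ge>1. b K \<le> \<epsilon>" if e: "0 < \<epsilon>" for \<epsilon>
  proof -
    have "((\<lambda>K::nat. C * (ln (real K) * real K powr (-2/5))) \<longlongrightarrow> C * 0) sequentially"
      by (intro tendsto_mult tendsto_const) real_asymp
    then have "eventually (\<lambda>K. C * (ln (real K) * real K powr (-2/5)) < \<epsilon>) sequentially"
      using e by (intro order_tendstoD(2)) auto
    then have "eventually (\<lambda>K. 1 \<le> K \<and> b K \<le> \<epsilon>) sequentially"
      using b eventually_ge_at_top[of 1] by eventually_elim auto
    then show ?thesis by (auto simp: eventually_sequentially)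
  qed
  define X where "X = (\<lambda>\<epsilon>::real. \<epsilon> powr (-5/2) * (ln (1/\<epsilon>)) ^ 3)"
  define N0 where "N0 = (\<lambda>\<epsilon>. nat \<lceil>X \<epsilon>\<rceil>)"
  \<comment> \<open>for large \<open>\<epsilon>\<close> the formula may fail, and any index with the required value is taken\<close>
  define N where "N = (\<lambda>\<epsilon>. if 1 \<le> N0 \<epsilon> \<and> b (N0 \<epsilon>) \<le> \<epsilon> then N0 \<epsilon> else (SOME K. 1 \<le> K \<and> b K \<le> \<epsilon>))"
  have N: "1 \<le> N \<epsilon> \<and> b (N \<epsilon>) \<le> \<epsilon>" if "0 < \<epsilon>" for \<epsilon>
    using someI_ex[OF ex[OF that, unfolded Bex_def]] by (auto simp: N_def)
  have lim: "((\<lambda>\<epsilon>. ln (2 * X \<epsilon>) * X \<epsilon> powr (-2/5) / \<epsilon>) \<longlongrightarrow> 0) (at_right 0)"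
    unfolding X_def by real_asymp
  have inf: "filterlim X at_top (at_right 0)" unfolding X_def by real_asymp
  have "((\<lambda>\<epsilon>. C * (ln (2 * X \<epsilon>) * X \<epsilon> powr (-2/5) / \<epsilon>)) \<longlongrightarrow> C * 0) (at_right 0)"
    by (intro tendsto_mult tendsto_const lim)
  then have "eventually (\<lambda>\<epsilon>. C * (ln (2 * X \<epsilon>) * X \<epsilon> powr (-2/5) / \<epsilon>) < 1) (at_right 0)"
    by (intro order_tendstoD(2)) auto
  moreover have "eventually (\<lambda>\<epsilon>. max 1 (real K0) \<le> X \<epsilon>) (at_right 0)"
    using inf unfolding filterlim_at_top by blast
  moreover have "eventually (\<lambda>\<epsilon>::real. 0 < \<epsilon>) (at_right 0)" by (rule eventually_at_right_less)
  ultimately have main: "eventually (\<lambda>\<epsilon>. 0 < \<epsilon> \<and> 1 \<le> X \<epsilon> \<and> N \<epsilon> = N0 \<epsilon> \<and> real (N0 \<epsilon>) \<le> 2 * X \<epsilon>) (at_right 0)"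
  proof eventually_elim
    case (elim \<epsilon>)
    then have e: "0 < \<epsilon>" and X1: "1 \<le> X \<epsilon>" and XK: "real K0 \<le> X \<epsilon>" by auto
    have n: "X \<epsilon> \<le> real (N0 \<epsilon>)" "real (N0 \<epsilon>) \<le> 2 * X \<epsilon>" using X1 by (auto simp: N0_def) linarith
    have nK: "K0 \<le> N0 \<epsilon>" "1 \<le> N0 \<epsilon>" using n X1 XK by linarith+
    have "b (N0 \<epsilon>) \<le> C * (ln (real (N0 \<epsilon>)) * real (N0 \<epsilon>) powr (-2/5))" by (rule K0[OF nK(1)])
    also have "\<dots> \<le> C * (ln (2 * X \<epsilon>) * X \<epsilon> powr (-2/5))"
      using C n X1 by (intro mult_left_mono mult_mono powr_mono2') auto
    also have "\<dots> \<le> \<epsilon>" using elim(1) e by (simp add: field_simps)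
    finally have "b (N0 \<epsilon>) \<le> \<epsilon>" .
    then show ?case using e X1 n nK by (simp add: N_def)
  qed
  have "soft_O (at_right 0) (\<lambda>\<epsilon>. real (N \<epsilon>)) (\<lambda>\<epsilon>. \<epsilon> powr (-5/2))"
    unfolding soft_O_def
  proof (intro exI bigoI)
    show "eventually (\<lambda>\<epsilon>. norm (real (N \<epsilon>)) \<le> 2 * norm (\<epsilon> powr (-5/2) * \<bar>ln \<bar>\<epsilon> powr (-5/2)\<bar>\<bar> ^ 3)) (at_right 0)"
      using main
    proof eventually_elim
      case (elim \<epsilon>)
      have p: "0 < \<epsilon> powr (-5/2)" using elim by simp
      have "0 < X \<epsilon>" using elim by simp
      then have l3: "0 < (ln (1/\<epsilon>)) ^ 3" using p by (simp add: X_def zero_less_mult_iff)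
      then have l: "0 < ln (1/\<epsilon>)" by (simp add: zero_less_power_eq)
      have "\<bar>ln \<bar>\<epsilon> powr (-5/2)\<bar>\<bar> = 5/2 * ln (1/\<epsilon>)" using l elim by (simp add: ln_powr ln_div)
      then have "(ln (1/\<epsilon>)) ^ 3 \<le> \<bar>ln \<bar>\<epsilon> powr (-5/2)\<bar>\<bar> ^ 3" using l by (intro power_mono) auto
      then have "X \<epsilon> \<le> \<epsilon> powr (-5/2) * \<bar>ln \<bar>\<epsilon> powr (-5/2)\<bar>\<bar> ^ 3" using p by (simp add: X_def)
      then show ?case using elim p by (simp add: abs_mult)
    qed
  qed
  then show ?thesis using N by blast
qed

context schedule
begin

text \<open>The exponents balance the errors: \<open>\<alpha> / lam\<^sup>2\<close>, \<open>\<alpha>\<^sup>2 lam\<close> and the relative growth of \<open>lam\<close> are all of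
  order \<open>1/k\<close>.\<close>

lemma err_rate:
  assumes a0: "0 < \<alpha>0" and k0: "0 < k0"
    and al: "\<alpha> = (\<lambda>k. \<alpha>0 / (real k + k0) powr (3/5))"
    and la: "lam = (\<lambda>k. lam0 * ((real k + k0) / k0) powr (1/5))"
  shows "\<exists>D\<ge>0. \<forall>k. err k \<le> D * (1 / (real k + k0))"
proof -
  define L where "L = lam0 / k0 powr (1/5)"
  have L: "0 < L" using lam0_pos k0 by (simp add: L_def)
  define E1 where "E1 = 3/2 * \<xi> * \<alpha>0 * K2\<^sup>2 / L\<^sup>2"
  define E2 where "E2 = 2 * \<xi>\<^sup>2 * \<alpha>0\<^sup>2 * (\<bar>L_F C\<bar> * k0 powr (-1/5) + 4 * \<kappa> * L * KD) * nx_max\<^sup>2"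
  define E3 where "E3 = 16 * \<kappa> * (2 * d_f0 C / \<rho>)"
  define E4 where "E4 = \<kappa> * L * 2 * (real T * (\<alpha>0\<^sup>2 * (5/4 * \<sigma>b)\<^sup>2))"
  have E: "0 \<le> E1" "0 \<le> E2" "0 \<le> E3" "0 \<le> E4"
    using xi a0 L kappa_pos KD_nonneg d_f0_nonneg rho_pos by (auto simp: E1_def E2_def E3_def E4_def)
  have "err k \<le> (E1 + E2 + E3 + E4) * (1 / (real k + k0))" for k
  proof -
    define v where "v = real k + k0"
    have v: "0 < v" "k0 \<le> v" using k0 by (auto simp: v_def)
    have a: "\<alpha> k = \<alpha>0 * v powr (-3/5)" unfolding al v_def by (simp add: powr_minus_divide)
    have l: "lam k = L * v powr (1/5)" using v k0 unfolding la v_def L_def by (simp add: powr_divide)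
    have aa: "(\<alpha> k)\<^sup>2 = \<alpha>0\<^sup>2 * v powr (-6/5)"
      by (simp add: a power_mult_distrib power2_eq_square powr_add[symmetric])
    have ll: "(lam k)\<^sup>2 = L\<^sup>2 * v powr (2/5)"
      by (simp add: l power_mult_distrib power2_eq_square powr_add[symmetric])
    have aal: "(\<alpha> k)\<^sup>2 * lam k = \<alpha>0\<^sup>2 * L * (1 / v)"
    proof -
      have "v powr (-6/5) * v powr (1/5) = v powr (-6/5 + 1/5)" by (rule powr_add[symmetric])
      also have "\<dots> = v powr (-1)" by simp
      also have "\<dots> = 1 / v" using v by (simp add: powr_minus_divide)
      finally have "v powr (-6/5) * v powr (1/5) = 1 / v" .
      moreover have "(\<alpha> k)\<^sup>2 * lam k = \<alpha>0\<^sup>2 * L * (v powr (-6/5) * v powr (1/5))"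
        unfolding aa l by (simp only: mult_ac)
      ultimately show ?thesis by (simp only:)
    qed
    have a_l: "\<alpha> k / (lam k)\<^sup>2 = \<alpha>0 / L\<^sup>2 * (1 / v)"
    proof -
      have "v powr (-3/5) / v powr (2/5) = v powr (-3/5 - 2/5)" by (rule powr_diff[symmetric])
      also have "\<dots> = v powr (-1)" by simp
      also have "\<dots> = 1 / v" using v by (simp add: powr_minus_divide)
      finally have "v powr (-3/5) / v powr (2/5) = 1 / v" .
      moreover have "\<alpha> k / (lam k)\<^sup>2 = \<alpha>0 / L\<^sup>2 * (v powr (-3/5) / v powr (2/5))"
        unfolding a ll by (simp only: times_divide_times_eq)
      ultimately show ?thesis by (simp only:)
    qed
    have a2: "(\<alpha> k)\<^sup>2 \<le> \<alpha>0\<^sup>2 * k0 powr (-1/5) * (1 / v)"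
    proof -
      have "v powr (-6/5) = v powr (-1/5) * (1 / v)"
        using v powr_add[of v "-1/5" "-1"] by (simp add: powr_minus_divide)
      moreover have "v powr (-1/5) \<le> k0 powr (-1/5)" using v k0 by (intro powr_mono2') auto
      ultimately show ?thesis unfolding aa using v by (simp add: mult.assoc mult_left_mono divide_right_mono)
    qed
    have t1: "3/2 * (\<xi> * \<alpha> k) * (K2 / lam k)\<^sup>2 = E1 * (1 / v)"
    proof -
      have "3/2 * (\<xi> * \<alpha> k) * (K2 / lam k)\<^sup>2 = 3/2 * \<xi> * K2\<^sup>2 * (\<alpha> k / (lam k)\<^sup>2)" by (simp add: power_divide)
      then show ?thesis unfolding a_l E1_def by (simp add: mult_ac)
    qed
    have t2: "2 * (\<xi> * \<alpha> k)\<^sup>2 * (\<bar>L_F C\<bar> + 4 * (\<kappa> * lam k) * KD) * nx_max\<^sup>2 \<le> E2 * (1 / v)"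
    proof -
      have "2 * (\<xi> * \<alpha> k)\<^sup>2 * (\<bar>L_F C\<bar> + 4 * (\<kappa> * lam k) * KD) * nx_max\<^sup>2
        = 2 * \<xi>\<^sup>2 * nx_max\<^sup>2 * (\<bar>L_F C\<bar> * (\<alpha> k)\<^sup>2 + 4 * \<kappa> * KD * ((\<alpha> k)\<^sup>2 * lam k))"
        by (simp add: power_mult_distrib algebra_simps)
      also have "\<dots> \<le> 2 * \<xi>\<^sup>2 * nx_max\<^sup>2 * (\<bar>L_F C\<bar> * (\<alpha>0\<^sup>2 * k0 powr (-1/5) * (1 / v)) + 4 * \<kappa> * KD * (\<alpha>0\<^sup>2 * L * (1 / v)))"
        unfolding aal using a2 by (intro mult_left_mono add_right_mono) auto
      also have "\<dots> = E2 * (1 / v)" unfolding E2_def by (simp only: algebra_simps)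
      finally show ?thesis .
    qed
    have t3: "16 * (\<kappa> * lam k) * lam_drift k \<le> E3 * (1 / v)"
    proof -
      have l': "0 < lam k" "0 < lam (Suc k)" by (rule lam_pos)+
      have "lam (Suc k) \<le> (1 + 1 / v) * lam k"
      proof -
        have "lam (Suc k) = L * (v * (1 + 1 / v)) powr (1/5)"
          using v k0 unfolding la L_def by (simp add: powr_divide v_def distrib_left add_ac)
        also have "\<dots> = lam k * (1 + 1 / v) powr (1/5)" using v by (simp add: l powr_mult)
        also have "\<dots> \<le> lam k * (1 + 1 / v) powr 1"
          using v l' by (intro mult_left_mono powr_mono) auto
        finally show ?thesis using v by (simp add: mult.commute)
      qed
      then have "lam (Suc k) - lam k \<le> (1 / v) * lam k" by (simp add: algebra_simps)
      then have "(lam (Suc k) - lam k) / (lam k * lam (Suc k)) \<le> (1 / v) * lam k / (lam k * lam (Suc k))"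
        using l' by (intro divide_right_mono) auto
      also have "\<dots> = (1 / v) / lam (Suc k)" using l' by simp
      also have "\<dots> \<le> (1 / v) / lam k" using l' v lam_mono[of k] by (intro divide_left_mono) auto
      finally have "lam_drift k \<le> 2 * d_f0 C / \<rho> * ((1 / v) / lam k)"
        unfolding lam_drift_eq using d_f0_nonneg rho_pos by (intro mult_left_mono) auto
      then have "16 * (\<kappa> * lam k) * lam_drift k \<le> 16 * (\<kappa> * lam k) * (2 * d_f0 C / \<rho> * ((1 / v) / lam k))"
        using kappa_pos l' by (intro mult_left_mono) auto
      also have "\<dots> = E3 * (1 / v)" using l' by (simp add: E3_def)
      finally show ?thesis .
    qed
    have t4: "(\<kappa> * lam k) * ry k * (real T * (\<alpha> k * (5/4 * \<sigma>b))\<^sup>2) \<le> E4 * (1 / v)"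
    proof -
      have "(\<kappa> * lam k) * ry k * (real T * (\<alpha> k * (5/4 * \<sigma>b))\<^sup>2)
        \<le> (\<kappa> * lam k) * 2 * (real T * (\<alpha> k * (5/4 * \<sigma>b))\<^sup>2)"
        using ry_bounds(2)[of k] kappa_pos lam_pos[of k] by (intro mult_right_mono mult_left_mono) auto
      also have "\<dots> = \<kappa> * 2 * (real T * (5/4 * \<sigma>b)\<^sup>2) * ((\<alpha> k)\<^sup>2 * lam k)"
        by (simp only: power_mult_distrib mult_ac)
      also have "\<dots> = E4 * (1 / v)" unfolding aal by (simp add: E4_def)
      finally show ?thesis .
    qed
    show ?thesis unfolding err_def v_def[symmetric] distrib_right using t1 t2 t3 t4 by linarith
  qed
  then show ?thesis using E by (intro exI[of _ "E1 + E2 + E3 + E4"]) auto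
qed

text \<open>\<open>lam k\<close> tends to infinity, while \<open>\<alpha> k\<close> and \<open>\<alpha> k * lam k\<close> tend to \<open>0\<close>.\<close>

lemma eventually_advanced:
  assumes a0: "0 < \<alpha>0" and k0: "0 < k0"
    and al: "\<alpha> = (\<lambda>k. \<alpha>0 / (real k + k0) powr (3/5))"
    and la: "lam = (\<lambda>k. lam0 * ((real k + k0) / k0) powr (1/5))"
  shows "eventually advanced sequentially"
proof -
  have p: "0 < lam0" by (rule lam0_pos)
  have inf: "filterlim lam at_top sequentially" unfolding la using k0 p by real_asymp
  have "(\<alpha> \<longlongrightarrow> 0) sequentially" unfolding al using k0 by real_asymp
  moreover have "((\<lambda>k. \<alpha> k * lam k) \<longlongrightarrow> 0) sequentially" unfolding al la using k0 p by real_asymp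
  ultimately have "((\<lambda>k. 2 * \<xi> * \<bar>L_F C\<bar> * \<alpha> k + 8 * \<xi> * \<kappa> * KD * (\<alpha> k * lam k)) \<longlongrightarrow> 2 * \<xi> * \<bar>L_F C\<bar> * 0 + 8 * \<xi> * \<kappa> * KD * 0) sequentially"
    by (intro tendsto_add tendsto_mult tendsto_const)
  then have 1: "eventually (\<lambda>k. 2 * \<xi> * \<bar>L_F C\<bar> * \<alpha> k + 8 * \<xi> * \<kappa> * KD * (\<alpha> k * lam k) < 1/4) sequentially"
    by (intro order_tendstoD(2)) auto
  have 2: "eventually (\<lambda>k. max (2 * K1) (8 * d_f0 C / (\<eta> * mu P)) \<le> lam k) sequentially"
    using inf unfolding filterlim_at_top by blast
  show ?thesis using 1 2
  proof eventually_elim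
    case (elim k)
    have "8 * d_f0 C / (\<eta> * mu P) \<le> lam k" using elim by simp
    then have "8 * d_f0 C \<le> \<eta> * mu P * lam k" using eta_pos mu_pos by (simp add: pos_divide_le_eq mult_ac)
    moreover have "2 * (\<xi> * \<alpha> k) * (\<bar>L_F C\<bar> + 4 * (\<kappa> * lam k) * KD)
      = 2 * \<xi> * \<bar>L_F C\<bar> * \<alpha> k + 8 * \<xi> * \<kappa> * KD * (\<alpha> k * lam k)" by (simp add: algebra_simps)
    ultimately show ?case using elim lam_ge[of k] by (simp add: advanced_def large_def)
  qed
qed

end

lemma (in stochastic_run) best_grad_rate:
  assumes a0: "0 < \<alpha>0" and k0: "0 < k0"
    and al: "\<alpha> = (\<lambda>k. \<alpha>0 / (real k + k0) powr (3/5))"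
    and la: "lam = (\<lambda>k. lam0 * ((real k + k0) / k0) powr (1/5))"
  shows "\<exists>C>0. eventually (\<lambda>K. best_grad P M x K \<le> C * (ln (real K) * real K powr (-2/5))) sequentially"
proof -
  obtain k2 where k2: "\<And>k. k2 \<le> k \<Longrightarrow> advanced k"
    using eventually_advanced[OF assms] by (auto simp: eventually_sequentially)
  define k1 where "k1 = max 1 k2"
  obtain B where B: "\<And>K. k1 \<le> K \<Longrightarrow> (\<Sum>k\<in>{k1..<K}. \<alpha> k * (\<integral>w. (norm (grad (Fmu P) (x k w)))\<^sup>2 \<partial>M))
    \<le> 2 / \<xi> * (B + (\<Sum>k\<in>{k1..<K}. err k))"
    using summed_decrease[of k1] k2 by (auto simp: k1_def)
  obtain D where D: "0 \<le> D" "\<And>k. err k \<le> D * (1 / (real k + k0))" using err_rate[OF assms] by blast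
  show ?thesis
    unfolding best_grad_def
  proof (rule weighted_min_rate[OF a0 k0])
    show "0 \<le> 2 / \<xi> * D" using xi D by simp
    show "1 \<le> k1" by (simp add: k1_def)
    show "0 \<le> (\<integral>w. (norm (grad (Fmu P) (x k w)))\<^sup>2 \<partial>M)" for k by simp
    show "(\<Sum>k\<in>{k1..<K}. \<alpha>0 / (real k + k0) powr (3/5) * (\<integral>w. (norm (grad (Fmu P) (x k w)))\<^sup>2 \<partial>M))
      \<le> 2 / \<xi> * B + 2 / \<xi> * D * (\<Sum>k\<in>{k1..<K}. 1 / (real k + k0))" if "k1 \<le> K" for K
    proof -
      have "(\<Sum>k\<in>{k1..<K}. err k) \<le> (\<Sum>k\<in>{k1..<K}. D * (1 / (real k + k0)))" by (intro sum_mono D)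
      also have "\<dots> = D * (\<Sum>k\<in>{k1..<K}. 1 / (real k + k0))" by (simp add: sum_distrib_left)
      finally have "2 / \<xi> * (B + (\<Sum>k\<in>{k1..<K}. err k)) \<le> 2 / \<xi> * (B + D * (\<Sum>k\<in>{k1..<K}. 1 / (real k + k0)))"
        using xi by (intro mult_left_mono add_left_mono) auto
      also have "\<dots> = 2 / \<xi> * B + 2 / \<xi> * D * (\<Sum>k\<in>{k1..<K}. 1 / (real k + k0))"
        by (simp only: distrib_left mult.assoc)
      finally show ?thesis using B[OF that] unfolding al by linarith
    qed
  qed
qed

theorem theorem4:
  fixes P :: "('n::finite, 'd::finite, 'm::finite) bilevel"
    and R :: reg_consts and C :: dikin_consts
    and yl :: "real \<Rightarrow> real^'n \<Rightarrow> real^'d"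
    and M :: "'w measure" and S :: "'s measure"
    and Hx :: "nat \<Rightarrow> 'w measure" and Hy :: "nat \<Rightarrow> nat \<Rightarrow> 'w measure"
    and Gx :: "(real^'n) \<times> (real^'d) \<Rightarrow> 's \<Rightarrow> real^'n" and Gy :: "(real^'n) \<times> (real^'d) \<Rightarrow> 's \<Rightarrow> real^'d"
    and \<zeta>x :: "nat \<Rightarrow> 'w \<Rightarrow> 's" and \<zeta>y :: "nat \<Rightarrow> nat \<Rightarrow> 'w \<Rightarrow> 's"
    and x :: "nat \<Rightarrow> 'w \<Rightarrow> real^'n" and y z :: "nat \<Rightarrow> nat \<Rightarrow> 'w \<Rightarrow> real^'d"
    and x0 :: "real^'n" and y0 z0 :: "real^'d"
    and T :: nat
    and \<eta> \<xi> c\<^sub>\<xi> \<alpha>\<^sub>0 \<gamma>\<^sub>0 lam\<^sub>0 k\<^sub>0 \<sigma>x \<sigma>y bfx bfy :: real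
    and \<alpha> \<gamma> lam :: "nat \<Rightarrow> real"
  assumes "standing_problem P"
    and "objective_regularity P R"
    and "bdd_below (range (Fmu P))"
    and "proxy_selection P yl"
    and "local_dikin_constants P yl C \<eta> lam\<^sub>0"
    and "radius_condition C \<eta> lam\<^sub>0"
    and "lam\<^sub>0 \<ge> lam_eta C"
    and "T \<ge> 1" and "\<xi> > 0"
    and "0 < c\<^sub>\<xi>" and "c\<^sub>\<xi> \<le> 1 / 1000"
    and "\<alpha>\<^sub>0 > 0" and "\<gamma>\<^sub>0 > 0" and "k\<^sub>0 > 0"
    and "\<alpha> = (\<lambda>k. \<alpha>\<^sub>0 / (real k + k\<^sub>0) powr (3/5))"
    and "\<gamma> = (\<lambda>k. \<gamma>\<^sub>0 / (real k + k\<^sub>0) powr (2/5))"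
    and "lam = (\<lambda>k. lam\<^sub>0 * ((real k + k\<^sub>0) / k\<^sub>0) powr (1/5))"
    and "barrier_aware R C \<eta> T \<xi> c\<^sub>\<xi> \<alpha> \<gamma> lam"
    and "tube_closure R C \<eta> T \<xi> bfx bfy \<alpha> \<gamma> lam"
    and "prob_space M"
    and "\<forall>w\<in>space M. barrier_run P T \<xi> \<alpha> \<gamma> lam Gx Gy (\<lambda>k. \<zeta>x k w) (\<lambda>k t. \<zeta>y k t w)
           (\<lambda>k. x k w) (\<lambda>k t. y k t w) (\<lambda>k t. z k t w)"
    and "\<forall>w\<in>space M. x 0 w = x0 \<and> y 0 0 w = y0 \<and> z 0 0 w = z0"
    and "z0 \<in> tube P \<eta> x0" and "y0 \<in> dikin_tube P \<eta> (yl lam\<^sub>0 x0)"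
    and "history M T Hx Hy x y z"
    and "stochastic_oracles P M S T Hx Hy Gx Gy \<zeta>x \<zeta>y \<sigma>x \<sigma>y"
    and "oracle_local_bounds P yl \<eta> M T lam Hx Hy Gx Gy \<zeta>x \<zeta>y x y z bfx bfy"
  shows "(AE w in M. \<forall>k.
            (\<forall>t\<le>T. z k t w \<in> tube P \<eta> (x k w) \<and> y k t w \<in> dikin_tube P \<eta> (yl (lam k) (x k w))) \<and>
            z (Suc k) 0 w \<in> tube P \<eta> (x (Suc k) w) \<and>
            y (Suc k) 0 w \<in> dikin_tube P \<eta> (yl (lam (Suc k)) (x (Suc k) w)))
       \<and> (\<forall>k. integrable M (\<lambda>w. (norm (grad (Fmu P) (x k w)))\<^sup>2))
       \<and> soft_O at_top (best_grad P M x) (\<lambda>K. real K powr (-2/5))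
       \<and> (\<exists>N :: real \<Rightarrow> nat. soft_O (at_right 0) (\<lambda>\<epsilon>. real (N \<epsilon>)) (\<lambda>\<epsilon>. \<epsilon> powr (-5/2)) \<and>
            (\<forall>\<epsilon>>0. N \<epsilon> \<ge> 1 \<and> best_grad P M x (N \<epsilon>) \<le> \<epsilon>))"
proof -
  have lam_0: "lam 0 = lam\<^sub>0" using assms(14,17) by simp
  have f1: "2 * d_f1 C / rho_psi C \<le> lam\<^sub>0" using assms(18) lam_0 by (simp add: barrier_aware_def)
  have al: "0 < \<alpha> k" for k using assms(12,14,15) by (simp add: add_nonneg_pos)
  interpret stochastic_run P R yl C \<eta> lam\<^sub>0 T \<xi> c\<^sub>\<xi> bfx bfy \<alpha> \<gamma> lam M S Hx Hy Gx Gy \<zeta>x \<zeta>y x y z x0 y0 z0 \<sigma>x \<sigma>y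
    by (intro stochastic_run.intro schedule.intro dikin_problem.intro barrier.intro
        stochastic_run_axioms.intro schedule_axioms.intro dikin_problem_axioms.intro)
      (fact assms lam_0 f1 al)+
  have tubes: "AE w in M. \<forall>k.
            (\<forall>t\<le>T. z k t w \<in> tube P \<eta> (x k w) \<and> y k t w \<in> dikin_tube P \<eta> (yl (lam k) (x k w))) \<and>
            z (Suc k) 0 w \<in> tube P \<eta> (x (Suc k) w) \<and>
            y (Suc k) 0 w \<in> dikin_tube P \<eta> (yl (lam (Suc k)) (x (Suc k) w))"
    using good_space by eventually_elim (use good_tubes in blast)
  obtain B where B: "0 < B" "eventually (\<lambda>K. best_grad P M x K \<le> B * (ln (real K) * real K powr (-2/5))) sequentially"
    using best_grad_rate[OF assms(12,14,15,17)] by blast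
  have nonneg: "eventually (\<lambda>K. 0 \<le> best_grad P M x K) sequentially"
    using eventually_gt_at_top[of 0]
  proof eventually_elim
    case (elim K)
    have "best_grad P M x K \<in> (\<lambda>k. LINT w|M. (norm (grad (Fmu P) (x k w)))\<^sup>2) ` {0..<K}"
      unfolding best_grad_def using elim by (intro Min_in) auto
    then show ?case by auto
  qed
  show ?thesis
    using tubes gradF_sq_integrable rate_soft_O[OF B nonneg] rate_complexity[OF B] by blast
qed

end
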